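(* Let $p\geqslant 0$ be an integer, $q=p+1$, let $\lambda,\mu\in\mathbb{R}$ and $\delta=\mu-\lambda$. For every $t\in\mathbb{R}$, the linear map $Q\colon\mathcal{S}_\delta\to\mathcal{D}_{\lambda,\mu}$ given on $\mathcal{S}^k_\delta$ for $k\neq 1$ by $$Q(S)(f)=\sum_{r=0}^kC_{k,r}\,Q_{\mathrm{Aff}}(\mathrm{div}^rS)(f),\qquad C_{k,0}=1,\quad C_{k,r}=\frac{\prod_{j=1}^r(k-j)}{r!\,\prod_{j=1}^r(2k-1-j)}\ \ (r\geqslant 1),$$ and on $\mathcal{S}^1_\delta$ by $$Q(S)(f)=Q_{\mathrm{Aff}}(S)f+t\,\mathrm{div}(S)f,$$ defines a $\mathfrak{psl}(p+1|p+1)$-equivariant quantization over $\mathbb{R}^{p|p+1}$.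
   Context: All Lie superalgebras are over $\mathbb{R}$. Here $q=p+1$. The parity of a homogeneous object $a$ is $\tilde a$; for an index $i\in\{1,\ldots,p+q\}$, $\tilde i=0$ if $i\leqslant p$ and $\tilde i=1$ otherwise. The coordinates of $\mathbb{R}^{p|q}$ are $y^1,\ldots,y^{p+q}$, where $y^1=x^1,\ldots,y^p=x^p$ are even and $y^{p+1}=\theta^1,\ldots,y^{p+q}=\theta^q$ are odd (anticommuting), so $\tilde{y^i}=\tilde i$. $\mathcal{F}=C^\infty(\mathbb{R}^{p|q})=C^\infty(\mathbb{R}^p)\otimes\Lambda(\theta^1,\ldots,\theta^q)$, and $\mathrm{Vect}(\mathbb{R}^{p|q})$ is the Lie superalgebra of vector fields $X=\sum_i X^i\partial_{y^i}$, $X^i\in\mathcal{F}$. Formulas with signs are written for homogeneous elements and extended linearly. Let $e_1,\ldots,e_{p+q}$ be the standard basis of the superspace $\mathbb{R}^{p|q}$ (parity of $e_i$ is $\tilde i$), $\varepsilon^1,\ldots,\varepsilon^{p+q}$ the standard basis of row vectors of $(\mathbb{R}^{p|q})^*$ (parity of $\varepsilon^i$ is $\tilde i$), and let $\mathrm{str}(A)=\sum_i(-1)^{\tilde i}A^i_i$ for $A\in\mathfrak{gl}(p|q)$. Densities. For $X=\sum_i X^i\partial_{y^i}$ put $\mathrm{div}(X)=\sum_i(-1)^{\tilde{y^i}\widetilde{X^i}}\partial_{y^i}X^i$. $\mathcal{F}_\lambda$ is the space $\mathcal{F}$ with the action $L^\lambda_Xf=X(f)+\lambda\,\mathrm{div}(X)f$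 of $\mathrm{Vect}(\mathbb{R}^{p|q})$. Symbols. $S^k$ is the degree $k$ part of the (super)symmetric algebra of $\mathbb{R}^{p|q}$, with product $\vee$ satisfying $v\vee w=(-1)^{\tilde v\tilde w}w\vee v$. $\mathfrak{gl}(p|q)$ acts on $S^k$ by $\rho(A)(v_1\vee\cdots\vee v_k)=\sum_j(-1)^{\tilde A(\tilde v_1+\cdots+\tilde v_{j-1})}v_1\vee\cdots\vee Av_j\vee\cdots\vee v_k$. $B^\delta$ is the space of dimension $1|0$ spanned by $u$ with $\rho(A)u=-\delta\,\mathrm{str}(A)u$, and $S^k_\delta=B^\delta\otimes S^k$ with the tensor product representation $\rho$. $\mathcal{S}^k_\delta=\mathcal{F}\otimes S^k_\delta$ with the action $$L_X(f\otimes v)=X(f)\otimes v+(-1)^{\widetilde X\tilde f}\sum_{i,j}fJ_i^j\otimes\rho(e^i_j)v,\qquad J_i^j=(-1)^{\tilde{y^i}\widetilde X+1}\partial_{y^i}X^j,$$ where $e^i_j(e_k)=\delta^i_ke_j$; and $\mathcal{S}_\delta=\bigoplus_{k\geqslant 0}\mathcal{S}^k_\delta$. The generator $u$ is omitted from the notation. Differential operators. $\mathcal{D}_{\lambda,\mu}$ is the space of linear differential operators $\mathcal{F}_\lambda\to\mathcal{F}_\mu$ with action $\mathcal{L}_XD=L^\mu_X\circ D-(-1)^{\widetilde X\widetilde D}D\circ L^\lambda_X$; $\mathcal{D}^k_{\lambda,\mu}$ is the subspace of operators of order at most $k$. Every $D\in\mathcal{D}^k_{\lambda,\mu}$ is uniquely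 $D=\sum_{|\alpha|\leqslant k}f_\alpha\,\partial_{y^1}^{\alpha_1}\cdots\partial_{y^{p+q}}^{\alpha_{p+q}}$ with $f_\alpha\in\mathcal{F}$ and $\alpha_{p+1},\ldots,\alpha_{p+q}\in\{0,1\}$. The principal symbol is $\sigma_k\colon\mathcal{D}^k_{\lambda,\mu}\to\mathcal{S}^k_\delta$, $D\mapsto\sum_{|\alpha|=k}f_\alpha\otimes e_1^{\alpha_1}\vee\cdots\vee e_{p+q}^{\alpha_{p+q}}$, with $\delta=\mu-\lambda$. The affine quantization map $Q_{\mathrm{Aff}}\colon\mathcal{S}_\delta\to\mathcal{D}_{\lambda,\mu}$ is the linear bijection inverse to the total symbol map $D\mapsto\sum_{|\alpha|\leqslant k}f_\alpha\otimes e_1^{\alpha_1}\vee\cdots\vee e_{p+q}^{\alpha_{p+q}}$. A quantization is a linear bijection $Q\colon\mathcal{S}_\delta\to\mathcal{D}_{\lambda,\mu}$ such that $Q(T)\in\mathcal{D}^k_{\lambda,\mu}$ and $\sigma_k(Q(T))=T$ for all $T\in\mathcal{S}^k_\delta$ and all $k\in\mathbb{N}$. Divergence operator on symbols. For $h\in(\mathbb{R}^{p|q})^*$, the interior product is $i(h)(h_1\vee\cdots\vee h_k)=\sum_{j=1}^k(-1)^{\tilde h(\tilde h_1+\cdots+\tilde h_{j-1})}\langle h,h_j\rangle\,h_1\vee\cdots\widehat{j}\cdots\vee h_k$, where $\langle h,x\rangle$ is the matrix product of the row $h$ by the column $x$ and $\widehat{j}$ means that $h_j$ is omitted; it is extended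 to $\mathcal{S}_\delta$ by $i(h)u=0$ and as a differential operator of order zero and parity $\tilde h$, i.e. $i(h)(f\otimes w)=(-1)^{\tilde h\tilde f}f\otimes i(h)w$. Then $\mathrm{div}\colon\mathcal{S}^k_\delta\to\mathcal{S}^{k-1}_\delta$ is $\mathrm{div}\,S=\sum_{j=1}^{p+q}(-1)^{\tilde{y^j}}i(\varepsilon^j)\partial_{y^j}S$, where $\partial_{y^j}(f\otimes w)=(\partial_{y^j}f)\otimes w$, and $\mathrm{div}^r$ is its $r$-th iterate. Projective superalgebra. $\mathfrak{pgl}(p+1|q)=\mathfrak{gl}(p+1|q)/\mathbb{R}\,\mathrm{Id}$ is identified with $\mathbb{R}^{p|q}\oplus\mathfrak{gl}(p|q)\oplus(\mathbb{R}^{p|q})^*$ (columns, matrices, rows), through $\left[\begin{pmatrix}a&\xi\\ h&A\end{pmatrix}\right]\mapsto(h,A-a\,\mathrm{Id},\xi)$. It is realized in $\mathrm{Vect}(\mathbb{R}^{p|q})$ by the linear map $h\mapsto X^h$ with $X^v=-\sum_iv^i\partial_{y^i}$ for $v\in\mathbb{R}^{p|q}$, $X^A=-\sum_{i,j}(-1)^{\tilde j(\tilde i+\tilde j)}A^i_jy^j\partial_{y^i}$ for $A\in\mathfrak{gl}(p|q)$, and $X^\xi=\sum_j\xi_jy^j(-1)^{\tilde j}\mathcal{E}$ for $\xi\in(\mathbb{R}^{p|q})^*$, where $\mathcal{E}=\sum_iy^i\partial_{y^i}$. For $q=p+1$, $\mathfrak{psl}(p+1|p+1)=\mathfrak{sl}(p+1|p+1)/\mathbb{R}\,\mathrm{Id}$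 is a codimension one ideal of $\mathfrak{pgl}(p+1|p+1)$, corresponding under this identification to $\mathbb{R}^{p|p+1}\oplus\mathfrak{sl}(p|p+1)\oplus(\mathbb{R}^{p|p+1})^*$. A quantization $Q\colon\mathcal{S}_\delta\to\mathcal{D}_{\lambda,\mu}$ is $\mathfrak{psl}(p+1|p+1)$-equivariant if $\mathcal{L}_{X^h}\circ Q=Q\circ L_{X^h}$ for every $h\in\mathfrak{psl}(p+1|p+1)$. *)

theory Defs
  imports "HOL-Analysis.Analysis" "HOL-Library.Function_Algebras" "HOL-Library.Multiset"
begin

instantiation "fun" :: (type, real_vector) real_vector
begin

definition scaleR_fun :: "real \<Rightarrow> ('a \<Rightarrow> 'b) \<Rightarrow> 'a \<Rightarrow> 'b" where
  "scaleR_fun c f = (\<lambda>x. c *\<^sub>R f x)"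

instance
  by standard
    (simp_all add: scaleR_fun_def plus_fun_def scaleR_add_right scaleR_add_left)

end


section \<open>Superfunctions\<close>

text \<open>
  The superspace has \<open>p\<close> even and \<open>q\<close> odd coordinates, numbered \<open>1, \<dots>, p + q\<close> with the even
  ones first. Both numbers may vary, and \<open>p\<close> may be zero, so they are parameters rather than types.
  A point of the underlying space is a function on the naturals of which only the values at
  \<open>1, \<dots>, p\<close> matter.

  A superfunction \<open>f\<close> is the family of its components: \<open>f = (\<Sum>I. f I \<theta>\<^sub>I)\<close>, where
  \<open>\<theta>\<^sub>I\<close> is the product, in increasing order, of the odd coordinates with index in \<open>I\<close>.
\<close>

type_synonym point = "nat \<Rightarrow> real"
type_synonym sfun = "nat set \<Rightarrow> point \<Rightarrow> real"

definition par :: "nat \<Rightarrow> nat \<Rightarrow> nat" where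
  "par p i = (if i \<le> p then 0 else 1)"

definition partial_deriv :: "nat \<Rightarrow> (point \<Rightarrow> real) \<Rightarrow> point \<Rightarrow> real" where
  "partial_deriv i g x = deriv (\<lambda>t. g (x(i := t))) (x i)"

text \<open>
  Functions of class \<open>C\<^sup>\<infinity>\<close> on the \<open>p\<close>-dimensional space. For functions that depend only on finitely
  many coordinates, continuity for the product topology is ordinary continuity.
\<close>

definition smooth :: "nat \<Rightarrow> (point \<Rightarrow> real) set" where
  "smooth p = {g. (\<forall>x y. (\<forall>i\<in>{1..p}. x i = y i) \<longrightarrow> g x = g y) \<and>
     (\<forall>w. set w \<subseteq> {1..p} \<longrightarrow> continuous_on UNIV (foldr partial_deriv w g) \<and>
        (\<forall>i\<in>{1..p}. \<forall>x. (\<lambda>t. foldr partial_deriv w g (x(i := t))) differentiable at (x i)))}"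

definition sfuns :: "nat \<Rightarrow> nat \<Rightarrow> sfun set" where
  "sfuns p q = {f. \<forall>I. f I \<in> smooth p \<and> (f I \<noteq> 0 \<longrightarrow> I \<subseteq> {p+1..p+q})}"

text \<open>\<open>\<theta>\<^sub>I \<theta>\<^sub>J\<close> is \<open>\<theta>\<^bsub>I \<union> J\<^esub>\<close> up to the sign of the shuffle when \<open>I\<close> and \<open>J\<close> are disjoint,
  and zero otherwise.\<close>

definition sprod :: "sfun \<Rightarrow> sfun \<Rightarrow> sfun"  (infixl "\<odot>" 70) where
  "f \<odot> g = (\<lambda>K x. \<Sum>I\<in>Pow K.
     (-1) ^ card {(i, j). i \<in> I \<and> j \<in> K - I \<and> j < i} * f I x * g (K - I) x)"

definition sone :: sfun where
  "sone = (\<lambda>I x. if I = {} then 1 else 0)"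

definition coord :: "nat \<Rightarrow> nat \<Rightarrow> sfun" where
  "coord p i = (if i \<le> p then (\<lambda>I x. if I = {} then x i else 0)
                else (\<lambda>I x. if I = {i} then 1 else 0))"

definition sderiv :: "nat \<Rightarrow> nat \<Rightarrow> sfun \<Rightarrow> sfun" where
  "sderiv p i f = (if i \<le> p then (\<lambda>I. partial_deriv i (f I))
     else (\<lambda>I x. if i \<in> I then 0 else (-1) ^ card {j\<in>I. j < i} * f (insert i I) x))"

text \<open>
  The homogeneous component of parity \<open>a\<close>. Formulas with signs, stated for homogeneous arguments,
  are extended linearly by summing over the parities \<open>0\<close> and \<open>1\<close> of the components involved.
\<close>

definition hpart :: "nat \<Rightarrow> sfun \<Rightarrow> sfun" where
  "hpart a f = (\<lambda>I. if even (card I + a) then f I else 0)"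


section \<open>Vector fields and densities\<close>

text \<open>A vector field is the family of its coefficients \<open>X i\<close>, for \<open>i\<close> in \<open>1, \<dots>, p + q\<close>.\<close>

type_synonym vfield = "nat \<Rightarrow> sfun"

definition vpart :: "nat \<Rightarrow> nat \<Rightarrow> vfield \<Rightarrow> vfield" where
  "vpart p a X = (\<lambda>i. hpart (a + par p i) (X i))"

definition vapply :: "nat \<Rightarrow> nat \<Rightarrow> vfield \<Rightarrow> sfun \<Rightarrow> sfun" where
  "vapply p q X f = (\<Sum>i=1..p+q. X i \<odot> sderiv p i f)"

definition vdiv :: "nat \<Rightarrow> nat \<Rightarrow> vfield \<Rightarrow> sfun" where
  "vdiv p q X = (\<Sum>i=1..p+q. \<Sum>a\<in>{0,1}. (-1) ^ (par p i * a) *\<^sub>R sderiv p i (hpart a (X i)))"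

definition Ldens :: "nat \<Rightarrow> nat \<Rightarrow> real \<Rightarrow> vfield \<Rightarrow> sfun \<Rightarrow> sfun" where
  "Ldens p q l X f = vapply p q X f + l *\<^sub>R (vdiv p q X \<odot> f)"


section \<open>Matrices\<close>

text \<open>\<open>A i j\<close> is the entry in row \<open>i\<close> and column \<open>j\<close>.\<close>

type_synonym rmat = "nat \<Rightarrow> nat \<Rightarrow> real"

definition mpart :: "nat \<Rightarrow> nat \<Rightarrow> rmat \<Rightarrow> rmat" where
  "mpart p a A = (\<lambda>i j. if even (par p i + par p j + a) then A i j else 0)"

definition str :: "nat \<Rightarrow> nat set \<Rightarrow> rmat \<Rightarrow> real" where
  "str p I A = (\<Sum>i\<in>I. (-1) ^ par p i * A i i)"

text \<open>The elementary matrix sending the \<open>i\<close>-th basis vector to the \<open>j\<close>-th one.\<close>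

definition elem_mat :: "nat \<Rightarrow> nat \<Rightarrow> rmat" where
  "elem_mat i j = (\<lambda>k l. if k = j \<and> l = i then 1 else 0)"


section \<open>The supersymmetric algebra\<close>

text \<open>
  Elements are given by their coordinates in the basis of monomials \<open>e\<^sup>\<alpha>\<close>, where
  the multi-index \<open>\<alpha>\<close> is a multiset of indices in which odd indices occur at most once, and
  \<open>e\<^sup>\<alpha>\<close> is the product of the basis vectors with index in \<open>\<alpha>\<close> in increasing order.
\<close>

type_synonym salg = "nat multiset \<Rightarrow> real"

definition midx :: "nat \<Rightarrow> nat \<Rightarrow> nat multiset set" where
  "midx p q = {\<alpha>. set_mset \<alpha> \<subseteq> {1..p+q} \<and> (\<forall>i>p. count \<alpha> i \<le> 1)}"

definition mono_e :: "nat multiset \<Rightarrow> salg" where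
  "mono_e \<alpha> = (\<lambda>\<beta>. if \<beta> = \<alpha> then 1 else 0)"

fun odd_inversions :: "nat \<Rightarrow> nat list \<Rightarrow> nat" where
  "odd_inversions p [] = 0"
| "odd_inversions p (i # w) =
     (if p < i then length (filter (\<lambda>j. p < j \<and> j < i) w) else 0) + odd_inversions p w"

text \<open>
  \<open>vee p [i\<^sub>1, \<dots>, i\<^sub>k]\<close> is the product \<open>e\<^bsub>i\<^sub>1\<^esub> \<or> \<dots> \<or> e\<^bsub>i\<^sub>k\<^esub>\<close>. Reordering the factors yields one
  sign for each inversion between odd factors; a repeated odd factor gives zero.
\<close>

definition vee :: "nat \<Rightarrow> nat list \<Rightarrow> salg" where
  "vee p w = (if \<forall>i>p. count (mset w) i \<le> 1
              then (-1) ^ odd_inversions p w *\<^sub>R mono_e (mset w) else 0)"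

lemma vee_sorted:
  assumes "\<alpha> \<in> midx p q"
  shows "vee p (sorted_list_of_multiset \<alpha>) = mono_e \<alpha>"
proof -
  have "odd_inversions p w = 0" if "sorted w" for w
    using that by (induction w) (auto simp: filter_empty_conv)
  then show ?thesis
    using assms by (simp add: vee_def midx_def)
qed

lemma vee_swap:
  "vee p (u @ [i, j] @ w) = (-1) ^ (par p i * par p j) *\<^sub>R vee p (u @ [j, i] @ w)"
proof -
  define C where "C \<longleftrightarrow> (\<forall>k>p. count (mset (u @ [j, i] @ w)) k \<le> 1)"
  define E where "E = mono_e (mset (u @ [j, i] @ w))"
  have m: "mset (u @ [i, j] @ w) = mset (u @ [j, i] @ w)"
    by simp
  have v: "vee p (u @ [i, j] @ w) = (if C then (-1) ^ odd_inversions p (u @ [i, j] @ w) *\<^sub>R E else 0)"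
    "vee p (u @ [j, i] @ w) = (if C then (-1) ^ odd_inversions p (u @ [j, i] @ w) *\<^sub>R E else 0)"
    by (simp_all only: vee_def m C_def E_def)
  show ?thesis
  proof (cases "p < i \<and> p < j \<and> i \<noteq> j")
    case True
    have "even (odd_inversions p (u @ [i, j] @ w)) = odd (odd_inversions p (u @ [j, i] @ w))"
      using True by (induction u) auto
    then have "(-1::real) ^ odd_inversions p (u @ [i, j] @ w)
        = - ((-1) ^ odd_inversions p (u @ [j, i] @ w))"
      by (simp add: minus_one_power_iff)
    moreover have "par p i = 1" "par p j = 1"
      using True by (simp_all add: par_def)
    ultimately show ?thesis
      unfolding v by simp
  next
    case False
    have *: "odd_inversions p (u @ [i, j] @ w) = odd_inversions p (u @ [j, i] @ w)"
      using False by (induction u) auto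
    show ?thesis
    proof (cases "p < i \<and> p < j")
      case True
      then have "vee p (u @ [i, j] @ w) = 0" "vee p (u @ [j, i] @ w) = 0"
        using False by (auto simp: vee_def intro!: exI[of _ i])
      then show ?thesis by (simp only: scaleR_zero_right)
    next
      case False
      then have "(-1::real) ^ (par p i * par p j) = 1"
        by (auto simp: par_def)
      then show ?thesis
        unfolding v * by simp
    qed
  qed
qed

definition rho_word :: "nat \<Rightarrow> nat \<Rightarrow> rmat \<Rightarrow> nat list \<Rightarrow> salg" where
  "rho_word p q A w = (\<Sum>a\<in>{0,1}. \<Sum>m<length w. \<Sum>j=1..p+q.
     ((-1) ^ (a * (\<Sum>n<m. par p (w ! n))) * mpart p a A j (w ! m)) *\<^sub>R vee p (w[m := j]))"

text \<open>The action of \<open>A\<close> on the basis vector \<open>u \<otimes> e\<^sup>\<alpha>\<close> of \<open>B\<^sup>\<delta> \<otimes> S\<^sup>k\<close>, with the even generator \<open>u\<close>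
  left out of the notation.\<close>

definition rho :: "nat \<Rightarrow> nat \<Rightarrow> real \<Rightarrow> rmat \<Rightarrow> nat multiset \<Rightarrow> salg" where
  "rho p q d A \<alpha> =
     (- d * str p {1..p+q} A) *\<^sub>R mono_e \<alpha> + rho_word p q A (sorted_list_of_multiset \<alpha>)"

definition interior_word :: "nat \<Rightarrow> (nat \<Rightarrow> real) \<Rightarrow> nat list \<Rightarrow> salg" where
  "interior_word p h w = (\<Sum>a\<in>{0,1}. \<Sum>m<length w.
     ((-1) ^ (a * (\<Sum>n<m. par p (w ! n))) * (if par p (w ! m) = a then h (w ! m) else 0))
       *\<^sub>R vee p (take m w @ drop (Suc m) w))"


section \<open>Symbols\<close>

text \<open>A symbol \<open>S\<close> is the family of its components: \<open>S = (\<Sum>\<alpha>. S \<alpha> \<otimes> e\<^sup>\<alpha>)\<close>. The weight \<open>\<delta>\<close> only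
  affects the action of vector fields.\<close>

type_synonym symbol = "nat multiset \<Rightarrow> sfun"

definition symbols :: "nat \<Rightarrow> nat \<Rightarrow> symbol set" where
  "symbols p q = {S. finite {\<alpha>. S \<alpha> \<noteq> 0} \<and>
     (\<forall>\<alpha>. S \<alpha> \<in> sfuns p q \<and> (S \<alpha> \<noteq> 0 \<longrightarrow> \<alpha> \<in> midx p q))}"

definition symbols_deg :: "nat \<Rightarrow> nat \<Rightarrow> nat \<Rightarrow> symbol set" where
  "symbols_deg p q k = {S \<in> symbols p q. \<forall>\<alpha>. S \<alpha> \<noteq> 0 \<longrightarrow> size \<alpha> = k}"

definition deg_part :: "nat \<Rightarrow> symbol \<Rightarrow> symbol" where
  "deg_part k S = (\<lambda>\<alpha>. if size \<alpha> = k then S \<alpha> else 0)"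

definition tens :: "sfun \<Rightarrow> salg \<Rightarrow> symbol"  (infixl "\<otimes>\<^sub>s" 65) where
  "f \<otimes>\<^sub>s v = (\<lambda>\<alpha>. v \<alpha> *\<^sub>R f)"

text \<open>The coefficients \<open>J\<^sub>i\<^sup>j\<close> of a vector field \<open>X\<close> of parity \<open>a\<close>.\<close>

definition Jcoef :: "nat \<Rightarrow> nat \<Rightarrow> vfield \<Rightarrow> nat \<Rightarrow> nat \<Rightarrow> sfun" where
  "Jcoef p a X i j = (-1) ^ (par p i * a + 1) *\<^sub>R sderiv p i (X j)"

definition Lsym_tens :: "nat \<Rightarrow> nat \<Rightarrow> real \<Rightarrow> vfield \<Rightarrow> sfun \<Rightarrow> nat multiset \<Rightarrow> symbol" where
  "Lsym_tens p q d X f \<alpha> = vapply p q X f \<otimes>\<^sub>s mono_e \<alpha> +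
     (\<Sum>a\<in>{0,1}. \<Sum>b\<in>{0,1}. (-1) ^ (a * b) *\<^sub>R (\<Sum>i=1..p+q. \<Sum>j=1..p+q.
        (hpart b f \<odot> Jcoef p a (vpart p a X) i j) \<otimes>\<^sub>s rho p q d (elem_mat i j) \<alpha>))"

definition Lsym :: "nat \<Rightarrow> nat \<Rightarrow> real \<Rightarrow> vfield \<Rightarrow> symbol \<Rightarrow> symbol" where
  "Lsym p q d X S = (\<Sum>\<alpha> | S \<alpha> \<noteq> 0. Lsym_tens p q d X (S \<alpha>) \<alpha>)"

definition interior_prod :: "nat \<Rightarrow> (nat \<Rightarrow> real) \<Rightarrow> symbol \<Rightarrow> symbol" where
  "interior_prod p h S = (\<Sum>\<alpha> | S \<alpha> \<noteq> 0. \<Sum>a\<in>{0,1}. \<Sum>b\<in>{0,1}. (-1) ^ (a * b) *\<^sub>R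
     (hpart b (S \<alpha>) \<otimes>\<^sub>s
        interior_word p (\<lambda>i. if par p i = a then h i else 0) (sorted_list_of_multiset \<alpha>)))"

definition eps :: "nat \<Rightarrow> nat \<Rightarrow> real" where
  "eps j = (\<lambda>i. if i = j then 1 else 0)"

definition sym_div :: "nat \<Rightarrow> nat \<Rightarrow> symbol \<Rightarrow> symbol" where
  "sym_div p q S =
     (\<Sum>j=1..p+q. (-1) ^ par p j *\<^sub>R interior_prod p (eps j) (\<lambda>\<alpha>. sderiv p j (S \<alpha>)))"


section \<open>Differential operators\<close>

text \<open>Operators on superfunctions are taken to vanish outside of \<^term>\<open>sfuns p q\<close>, so that equality
  of HOL functions is equality of operators.\<close>

type_synonym sop = "sfun \<Rightarrow> sfun"

definition on_sfuns :: "nat \<Rightarrow> nat \<Rightarrow> sop \<Rightarrow> sop" where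
  "on_sfuns p q D = (\<lambda>f. if f \<in> sfuns p q then D f else 0)"

definition Qaff :: "nat \<Rightarrow> nat \<Rightarrow> symbol \<Rightarrow> sop" where
  "Qaff p q S = on_sfuns p q
     (\<lambda>f. \<Sum>\<alpha> | S \<alpha> \<noteq> 0. S \<alpha> \<odot> foldr (sderiv p) (sorted_list_of_multiset \<alpha>) f)"

definition diffops_ord :: "nat \<Rightarrow> nat \<Rightarrow> nat \<Rightarrow> sop set" where
  "diffops_ord p q k = Qaff p q ` {S \<in> symbols p q. \<forall>\<alpha>. S \<alpha> \<noteq> 0 \<longrightarrow> size \<alpha> \<le> k}"

definition diffops :: "nat \<Rightarrow> nat \<Rightarrow> sop set" where
  "diffops p q = (\<Union>k. diffops_ord p q k)"

definition total_symbol :: "nat \<Rightarrow> nat \<Rightarrow> sop \<Rightarrow> symbol" where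
  "total_symbol p q D = (THE S. S \<in> symbols p q \<and> Qaff p q S = D)"

definition principal_symbol :: "nat \<Rightarrow> nat \<Rightarrow> nat \<Rightarrow> sop \<Rightarrow> symbol" where
  "principal_symbol p q k D = deg_part k (total_symbol p q D)"

definition oppart :: "nat \<Rightarrow> sop \<Rightarrow> sop" where
  "oppart b D = (\<lambda>f. \<Sum>c\<in>{0,1}. hpart (b + c) (D (hpart c f)))"

definition Lop :: "nat \<Rightarrow> nat \<Rightarrow> real \<Rightarrow> real \<Rightarrow> vfield \<Rightarrow> sop \<Rightarrow> sop" where
  "Lop p q l m X D = on_sfuns p q (\<lambda>f. \<Sum>a\<in>{0,1}. \<Sum>b\<in>{0,1}.
     Ldens p q m (vpart p a X) (oppart b D f)
       - (-1) ^ (a * b) *\<^sub>R oppart b D (Ldens p q l (vpart p a X) f))"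


section \<open>Equivariant quantizations\<close>

definition quantization :: "nat \<Rightarrow> nat \<Rightarrow> (symbol \<Rightarrow> sop) \<Rightarrow> bool" where
  "quantization p q Q \<longleftrightarrow>
     (\<forall>S\<in>symbols p q. \<forall>T\<in>symbols p q. \<forall>a b. Q (a *\<^sub>R S + b *\<^sub>R T) = a *\<^sub>R Q S + b *\<^sub>R Q T) \<and>
     bij_betw Q (symbols p q) (diffops p q) \<and>
     (\<forall>k. \<forall>T\<in>symbols_deg p q k. Q T \<in> diffops_ord p q k \<and> principal_symbol p q k (Q T) = T)"

text \<open>
  Matrices in \<open>gl(p+1|q)\<close> have indices \<open>0, \<dots>, p + q\<close>; the additional index \<open>0\<close> is even. The map
  \<open>pgl_coords\<close> identifies the class of a matrix modulo the identity with a triple consisting of a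
  column, a matrix and a row, all with indices \<open>1, \<dots>, p + q\<close> (entries outside are set to zero).
  Its image of the matrices of supertrace zero is \<open>sl(p+1|q)\<close> modulo the identity when \<open>q = p + 1\<close>.
\<close>

definition gl_mats :: "nat \<Rightarrow> nat \<Rightarrow> rmat set" where
  "gl_mats p q = {M. \<forall>i j. i \<notin> {0..p+q} \<or> j \<notin> {0..p+q} \<longrightarrow> M i j = 0}"

definition pgl_coords :: "nat \<Rightarrow> nat \<Rightarrow> rmat \<Rightarrow> (nat \<Rightarrow> real) \<times> rmat \<times> (nat \<Rightarrow> real)" where
  "pgl_coords p q M =
     ((\<lambda>i. if i \<in> {1..p+q} then M i 0 else 0),
      (\<lambda>i j. if i \<in> {1..p+q} \<and> j \<in> {1..p+q} then M i j - (if i = j then M 0 0 else 0) else 0),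
      (\<lambda>j. if j \<in> {1..p+q} then M 0 j else 0))"

definition psl :: "nat \<Rightarrow> nat \<Rightarrow> ((nat \<Rightarrow> real) \<times> rmat \<times> (nat \<Rightarrow> real)) set" where
  "psl p q = pgl_coords p q ` {M \<in> gl_mats p q. str p {0..p+q} M = 0}"

definition proj_field ::
    "nat \<Rightarrow> nat \<Rightarrow> (nat \<Rightarrow> real) \<times> rmat \<times> (nat \<Rightarrow> real) \<Rightarrow> vfield" where
  "proj_field p q = (\<lambda>(v, A, \<xi>) i.
     - (v i *\<^sub>R sone)
     - (\<Sum>j=1..p+q. ((-1) ^ (par p j * (par p i + par p j)) * A i j) *\<^sub>R coord p j)
     + (\<Sum>j=1..p+q. (\<xi> j * (-1) ^ par p j) *\<^sub>R (coord p j \<odot> coord p i)))"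

definition equivariant ::
    "nat \<Rightarrow> nat \<Rightarrow> real \<Rightarrow> real \<Rightarrow> ((nat \<Rightarrow> real) \<times> rmat \<times> (nat \<Rightarrow> real)) set \<Rightarrow>
      (symbol \<Rightarrow> sop) \<Rightarrow> bool" where
  "equivariant p q l m \<g> Q \<longleftrightarrow> (\<forall>h\<in>\<g>. \<forall>S\<in>symbols p q.
     Lop p q l m (proj_field p q h) (Q S) = Q (Lsym p q (m - l) (proj_field p q h) S))"

definition Ccoef :: "nat \<Rightarrow> nat \<Rightarrow> real" where
  "Ccoef k r = (\<Prod>j=1..r. real k - real j) / (fact r * (\<Prod>j=1..r. 2 * real k - 1 - real j))"

text \<open>In degree one the divergence is a symbol of degree zero, that is, the superfunction at the empty
  multi-index, and it acts by multiplication. For other \<open>k\<close> no denominator of \<open>Ccoef k r\<close> with \<open>r \<le> k\<close>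
  vanishes.\<close>

definition Qdeg :: "nat \<Rightarrow> nat \<Rightarrow> real \<Rightarrow> nat \<Rightarrow> symbol \<Rightarrow> sop" where
  "Qdeg p q t k S =
     (if k = 1
      then on_sfuns p q (\<lambda>f. Qaff p q S f + t *\<^sub>R (sym_div p q S {#} \<odot> f))
      else on_sfuns p q (\<lambda>f. \<Sum>r=0..k. Ccoef k r *\<^sub>R Qaff p q ((sym_div p q ^^ r) S) f))"

definition Qmap :: "nat \<Rightarrow> nat \<Rightarrow> real \<Rightarrow> symbol \<Rightarrow> sop" where
  "Qmap p q t S = (\<Sum>k\<in>size ` {\<alpha>. S \<alpha> \<noteq> 0}. Qdeg p q t k (deg_part k S))"

end

theory Submission
  imports Defs
begin

text \<open>
  Let \<open>y\<^sub>j\<close>, \<open>\<partial>\<^sub>j\<close>, \<open>p\<^sub>j\<close> and \<open>\<iota>\<^sub>j\<close> act on symbols as multiplication by a coordinate, derivative, product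
  with \<open>e\<^sub>j\<close> and interior product; the pairs \<open>(\<partial>\<^sub>j, y\<^sub>j)\<close> and \<open>(\<iota>\<^sub>j, p\<^sub>j)\<close> satisfy the canonical relations
  and all other pairs supercommute. Under the affine quantization, composition with \<open>y\<^sub>j\<close> or \<open>\<partial>\<^sub>j\<close> on
  the left becomes \<open>y\<^sub>j\<close> or \<open>\<partial>\<^sub>j + p\<^sub>j\<close>, on the right \<open>y\<^sub>j \<plusminus> \<iota>\<^sub>j\<close> or \<open>p\<^sub>j\<close>. Hence both actions of a projective
  field are explicit polynomials in these operators. They agree for the affine fields, which commute
  with the divergence \<open>\<Delta>\<close>. For \<open>q = p + 1\<close> the divergence of the quadratic field \<open>X\<close> attached to
  \<open>y\<^sub>c\<close> vanishes, and with the degree operator \<open>N\<close> one finds \<open>\<L>\<^sub>X = L\<^sub>X - \<epsilon>\<^sub>c N \<iota>\<^sub>c\<close> and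
  \<open>[\<Delta>, L\<^sub>X] = - 2 \<epsilon>\<^sub>c N \<iota>\<^sub>c\<close>, where \<open>\<epsilon>\<^sub>c\<close> is \<open>1\<close> for even and \<open>-1\<close> for odd \<open>c\<close>. So equivariance amounts to
  \<open>r (2k - 1 - r) C\<^bsub>k,r\<^esub> = (k - r) C\<^bsub>k,r-1\<^esub>\<close>, which leaves \<open>C\<^bsub>1,1\<^esub>\<close> free. The map is a
  quantization because it is triangular for the degree.
\<close>

section \<open>Smooth functions\<close>

text \<open>Signs are the main obstacle: the definitions sum over the parities of field, operator
  and coefficient. Each such sum is rewritten as the twist \<open>flip\<close>, so the canonical
  relations hold for all symbols and not only for homogeneous ones. The recurrence arises as
  follows. On symbols the map is a sum of terms C_r(N) \<Delta>^r. Iterating the commutator of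
  \<Delta> and L_X, and moving \<Delta> through N, gives \<Delta>^r L_X = L_X \<Delta>^r -
  \<epsilon>_c r (2N + r - 1) \<iota>_c \<Delta>^(r-1), and the last term has to match the
  correction - \<epsilon>_c N \<iota>_c of the term with r - 1. If S has degree k, then \<iota>_c
  \<Delta>^(r-1) S has degree m = k - r, so r (2m + r - 1) = r (2k - 1 - r). For k = r = 1 both
  sides of the recurrence are zero. The equality q = p + 1 enters twice: the divergence of X is (p -
  q + 1) y_c, so the weights drop out, and the superdimension p - q in the commutator of \<Delta>
  with the sum of all y_k p_k cancels a leftover \<iota>_c in the commutator of \<Delta> and
  L_X.\<close>

lemma sum_fun_apply: "(\<Sum>i\<in>A. f i) x = (\<Sum>i\<in>A. f i x)"
  by (induction A rule: infinite_finite_induct) auto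

lemma smooth_cong:
  "g \<in> smooth p \<Longrightarrow> (\<And>i. i \<in> {1..p} \<Longrightarrow> x i = y i) \<Longrightarrow> g x = g y"
  unfolding smooth_def by blast

lemma smooth_continuous: "g \<in> smooth p \<Longrightarrow> continuous_on UNIV g"
  unfolding smooth_def by (auto dest!: spec[of _ "[]"])

lemma smooth_differentiable:
  "g \<in> smooth p \<Longrightarrow> i \<in> {1..p} \<Longrightarrow> (\<lambda>t. g (x(i := t))) differentiable at (x i)"
  unfolding smooth_def by (auto dest!: spec[of _ "[]"])

lemma smooth_partial_deriv:
  assumes g: "g \<in> smooth p" and i: "i \<in> {1..p}"
  shows "partial_deriv i g \<in> smooth p"
proof -
  have "partial_deriv i g x = partial_deriv i g y" if "\<forall>k\<in>{1..p}. x k = y k" for x y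
  proof -
    have "g (x(i := t)) = g (y(i := t))" for t
      by (rule smooth_cong[OF g]) (use that in auto)
    then show ?thesis
      using that i by (simp add: partial_deriv_def)
  qed
  moreover have "continuous_on UNIV (foldr partial_deriv w (partial_deriv i g)) \<and>
      (\<forall>k\<in>{1..p}. \<forall>x. (\<lambda>t. foldr partial_deriv w (partial_deriv i g) (x(k := t))) differentiable at (x k))"
    if w: "set w \<subseteq> {1..p}" for w
  proof -
    have "set (w @ [i]) \<subseteq> {1..p}" using w i by auto
    then show ?thesis
      using g unfolding smooth_def mem_Collect_eq by (auto dest!: spec[of _ "w @ [i]"])
  qed
  ultimately show ?thesis
    unfolding smooth_def by blast
qed

text \<open>Smooth functions form the largest class of continuous, coordinatewise differentiable
  functions of the first \<open>p\<close> coordinates that is stable under partial derivatives.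
  Closure properties are therefore shown by exhibiting a stable class, without induction over words
  of derivatives.\<close>

lemma smooth_coinduct [consumes 1, case_names cong continuous differentiable partial_deriv]:
  assumes g: "g \<in> C"
    and 1: "\<And>g x y. g \<in> C \<Longrightarrow> (\<And>i. i \<in> {1..p} \<Longrightarrow> x i = y i) \<Longrightarrow> g x = g y"
    and 2: "\<And>g. g \<in> C \<Longrightarrow> continuous_on UNIV g"
    and 3: "\<And>g i x. g \<in> C \<Longrightarrow> i \<in> {1..p} \<Longrightarrow> (\<lambda>t. g (x(i := t))) differentiable at (x i)"
    and 4: "\<And>g i. g \<in> C \<Longrightarrow> i \<in> {1..p} \<Longrightarrow> partial_deriv i g \<in> C"
  shows "g \<in> smooth p"
proof -
  have C: "foldr partial_deriv w g \<in> C" if "set w \<subseteq> {1..p}" for w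
    using that by (induction w) (auto intro: g 4)
  have "\<forall>x y. (\<forall>i\<in>{1..p}. x i = y i) \<longrightarrow> g x = g y"
    using 1[OF g] by blast
  then show ?thesis
    unfolding smooth_def using 2[OF C] 3[OF C] by blast
qed

section \<open>Calculus rules for partial derivatives\<close>

lemma has_partial_deriv:
  assumes "g \<in> smooth p" "i \<in> {1..p}"
  shows "((\<lambda>t. g (x(i := t))) has_field_derivative partial_deriv i g (x(i := t0))) (at t0)"
  using smooth_differentiable[OF assms, of "x(i := t0)"]
  by (simp add: partial_deriv_def DERIV_deriv_iff_real_differentiable)

lemma has_partial_deriv_at:
  assumes "g \<in> smooth p" "i \<in> {1..p}"
  shows "((\<lambda>t. g (x(i := t))) has_field_derivative partial_deriv i g x) (at (x i))"
  using has_partial_deriv[OF assms, of x "x i"] by simp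

lemma partial_derivI:
  "((\<lambda>t. g (x(i := t))) has_field_derivative D) (at (x i)) \<Longrightarrow> partial_deriv i g x = D"
  by (simp add: partial_deriv_def DERIV_imp_deriv)

lemma partial_deriv_const [simp]: "partial_deriv i (\<lambda>x. c) = 0"
  by (rule ext) (simp add: partial_derivI)

lemma partial_deriv_zero [simp]: "partial_deriv i 0 = 0"
  using partial_deriv_const[of i 0] by (simp add: zero_fun_def)

lemma partial_deriv_add:
  assumes "g \<in> smooth p" "h \<in> smooth p" "i \<in> {1..p}"
  shows "partial_deriv i (g + h) = partial_deriv i g + partial_deriv i h"
proof
  fix x
  show "partial_deriv i (g + h) x = (partial_deriv i g + partial_deriv i h) x"
    using DERIV_add[OF has_partial_deriv_at[OF assms(1,3), of x] has_partial_deriv_at[OF assms(2,3), of x]]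
    by (intro partial_derivI) simp
qed

lemma partial_deriv_mult:
  assumes "g \<in> smooth p" "h \<in> smooth p" "i \<in> {1..p}"
  shows "partial_deriv i (g * h) = partial_deriv i g * h + g * partial_deriv i h"
proof
  fix x
  show "partial_deriv i (g * h) x = (partial_deriv i g * h + g * partial_deriv i h) x"
    using DERIV_mult[OF has_partial_deriv_at[OF assms(1,3), of x] has_partial_deriv_at[OF assms(2,3), of x]]
    by (intro partial_derivI) (simp add: algebra_simps)
qed

section \<open>Constants, coordinates, products and sums are smooth\<close>

lemma smooth_const: "(\<lambda>x. c) \<in> smooth p"
proof -
  have "(\<lambda>x::point. c) \<in> range (\<lambda>(c::real) x. c)" by auto
  then show ?thesis
  proof (rule smooth_coinduct, goal_cases)
    case (4 g i)
    then obtain d where "g = (\<lambda>x. d)" by auto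
    then show ?case by (simp add: zero_fun_def)
  qed auto
qed

lemma smooth_zero: "0 \<in> smooth p"
  using smooth_const[of 0 p] by (simp add: zero_fun_def)

lemma smooth_coord:
  assumes "i \<in> {1..p}"
  shows "(\<lambda>x. x i) \<in> smooth p"
proof -
  have d: "partial_deriv k (\<lambda>x. x i) = (\<lambda>x. if k = i then 1 else 0)" for k
    by (rule ext) (auto intro!: partial_derivI)
  have "(\<lambda>x. x i) \<in> insert (\<lambda>x. x i) (smooth p)"
    by simp
  then show ?thesis
  proof (rule smooth_coinduct, goal_cases)
    case (1 g x y)
    then show ?case using assms by (auto intro: smooth_cong)
  next
    case (2 g)
    then show ?case by (auto intro: smooth_continuous continuous_on_product_coordinates)
  next
    case (3 g k x)
    then show ?case by (cases "k = i") (auto intro: smooth_differentiable)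
  next
    case (4 g k)
    then show ?case by (auto simp: d smooth_partial_deriv smooth_const)
  qed
qed

text \<open>The derivative of a product is a sum of two products, so products alone are not a stable
  class for \<open>smooth_coinduct\<close>; their finite sums are.\<close>

inductive_set sums_of_products :: "nat \<Rightarrow> (point \<Rightarrow> real) set" for p where
  products: "g \<in> smooth p \<Longrightarrow> h \<in> smooth p \<Longrightarrow> g * h \<in> sums_of_products p"
| sums: "g \<in> sums_of_products p \<Longrightarrow> h \<in> sums_of_products p \<Longrightarrow> g + h \<in> sums_of_products p"

lemma sums_of_products_smooth:
  assumes "g \<in> sums_of_products p"
  shows "g \<in> smooth p"
proof -
  have diff: "(\<lambda>t. g (x(i := t))) differentiable at (x i)"
    if "g \<in> sums_of_products p" "i \<in> {1..p}" for g i x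
    using that
  proof induction
    case (products g h)
    then show ?case
      using differentiable_mult[OF smooth_differentiable[of g p i x] smooth_differentiable[of h p i x]]
      by (simp only: times_fun_def)
  next
    case (sums g h)
    then show ?case by (simp add: differentiable_add)
  qed
  show ?thesis
    using assms
  proof (rule smooth_coinduct, goal_cases)
    case (1 g x y)
    from 1(1) show ?case
    proof induction
      case (products g h)
      then show ?case
        using smooth_cong[of g p x y] smooth_cong[of h p x y] 1(2) by simp
    qed simp
  next
    case (2 g)
    then show ?case
    proof induction
      case (products g h)
      then show ?case
        using continuous_on_mult[OF smooth_continuous smooth_continuous, of g p h p]
        by (simp add: times_fun_def)
    next
      case (sums g h)
      then show ?case using continuous_on_add[of UNIV g h] by (simp add: plus_fun_def)
    qed
  next
    case (3 g i x)
    then show ?case by (rule diff)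
  next
    case (4 g i)
    then show ?case
    proof induction
      case (products g h)
      then show ?case
        by (simp only: partial_deriv_mult) (intro sums_of_products.intros smooth_partial_deriv)
    next
      case (sums g h)
      \<comment> \<open>\<open>partial_deriv_add\<close> cannot be used here: members of the class
        are not yet known to be smooth, only differentiable by \<open>diff\<close>.\<close>
      have "partial_deriv i (g + h) = partial_deriv i g + partial_deriv i h"
      proof
        fix x
        have "((\<lambda>t. g (x(i := t))) has_field_derivative partial_deriv i g x) (at (x i))"
          "((\<lambda>t. h (x(i := t))) has_field_derivative partial_deriv i h x) (at (x i))"
          using diff[OF sums.hyps(1) sums.prems, of x] diff[OF sums.hyps(2) sums.prems, of x]
          by (simp_all add: partial_deriv_def DERIV_deriv_iff_real_differentiable)
        from DERIV_add[OF this]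
        show "partial_deriv i (g + h) x = (partial_deriv i g + partial_deriv i h) x"
          by (intro partial_derivI) simp
      qed
      then show ?case using sums sums_of_products.sums by metis
    qed
  qed
qed

lemma smooth_mult: "g \<in> smooth p \<Longrightarrow> h \<in> smooth p \<Longrightarrow> g * h \<in> smooth p"
  by (rule sums_of_products_smooth) (rule sums_of_products.products)

lemma smooth_add: "g \<in> smooth p \<Longrightarrow> h \<in> smooth p \<Longrightarrow> g + h \<in> smooth p"
proof -
  assume "g \<in> smooth p" "h \<in> smooth p"
  then have "g * (\<lambda>x. 1) + h * (\<lambda>x. 1) \<in> smooth p"
    by (intro sums_of_products_smooth[OF sums_of_products.sums] sums_of_products.products smooth_const)
  moreover have "g * (\<lambda>x. 1) + h * (\<lambda>x. 1) = g + h"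
    by auto
  ultimately show ?thesis by simp
qed

lemma scaleR_eq_mult: "c *\<^sub>R g = (\<lambda>x. c) * (g :: point \<Rightarrow> real)"
  by (auto simp: scaleR_fun_def)

lemma smooth_scaleR: "g \<in> smooth p \<Longrightarrow> c *\<^sub>R g \<in> smooth p"
  unfolding scaleR_eq_mult by (intro smooth_mult smooth_const)

lemma partial_deriv_scaleR:
  "g \<in> smooth p \<Longrightarrow> i \<in> {1..p} \<Longrightarrow> partial_deriv i (c *\<^sub>R g) = c *\<^sub>R partial_deriv i g"
  unfolding scaleR_eq_mult by (simp add: partial_deriv_mult smooth_const)

lemma smooth_sum: "(\<And>i. i \<in> A \<Longrightarrow> f i \<in> smooth p) \<Longrightarrow> (\<Sum>i\<in>A. f i) \<in> smooth p"
  by (induction A rule: infinite_finite_induct) (auto intro: smooth_add smooth_zero)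

section \<open>Symmetry of mixed partial derivatives\<close>

lemma second_difference_mean_value:
  assumes g: "g \<in> smooth p" and ij: "i \<in> {1..p}" "j \<in> {1..p}" "i \<noteq> j" and h: "h > 0"
  shows "\<exists>s t. x i < s \<and> s < x i + h \<and> x j < t \<and> t < x j + h \<and>
    g (x(i := x i + h, j := x j + h)) - g (x(i := x i + h)) - g (x(j := x j + h)) + g x
      = h * h * partial_deriv j (partial_deriv i g) (x(i := s, j := t))"
proof -
  \<comment> \<open>The mean value theorem is applied twice: to the increment in coordinate
    \<open>j\<close> as a function of coordinate \<open>i\<close>, and to the resulting first
    derivative as a function of coordinate \<open>j\<close>.\<close>
  define F where "F s = g ((x(j := x j + h))(i := s)) - g (x(i := s))" for s
  define F' where "F' s = partial_deriv i g ((x(j := x j + h))(i := s)) - partial_deriv i g (x(i := s))" for s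
  have "DERIV F s :> F' s" for s
    unfolding F_def F'_def by (intro DERIV_diff has_partial_deriv[OF g ij(1)])
  then obtain s where s: "x i < s" "s < x i + h" "F (x i + h) - F (x i) = h * F' s"
    using MVT2[of "x i" "x i + h" F F'] h by auto
  define G where "G t = partial_deriv i g ((x(i := s))(j := t))" for t
  define G' where "G' t = partial_deriv j (partial_deriv i g) ((x(i := s))(j := t))" for t
  have "DERIV G t :> G' t" for t
    unfolding G_def G'_def
    by (intro has_partial_deriv[OF _ ij(2)] smooth_partial_deriv g ij)
  then obtain t where t: "x j < t" "t < x j + h" "G (x j + h) - G (x j) = h * G' t"
    using MVT2[of "x j" "x j + h" G G'] h by auto
  have tw: "(x(j := a))(i := b) = x(i := b, j := a)" for a b
    using ij(3) by (intro fun_upd_twist) simp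
  have id: "x(i := b, j := x j) = x(i := b)" for b
    using ij(3) by auto
  have "F' s = G (x j + h) - G (x j)"
    by (simp add: F'_def G_def tw id)
  then have "F (x i + h) - F (x i) = h * h * G' t"
    using s(3) t(3) by simp
  moreover have "F (x i + h) - F (x i) =
      g (x(i := x i + h, j := x j + h)) - g (x(i := x i + h)) - g (x(j := x j + h)) + g x"
    unfolding F_def tw[of _ "x i + h"] by (simp add: tw fun_upd_idem)
  ultimately show ?thesis
    using s t unfolding G'_def by metis
qed

text \<open>Only two coordinates move, so continuity for the product topology is composed with a
  continuous map from the plane into the space of points.\<close>

lemma tendsto_two_coordinates:
  fixes x :: point
  assumes "continuous_on UNIV \<phi>"
    and "s \<longlonglongrightarrow> x i" "t \<longlonglongrightarrow> x j"
  shows "(\<lambda>n. \<phi> (x(i := s n, j := t n))) \<longlonglongrightarrow> (\<phi> x :: real)"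
proof -
  have "continuous_on UNIV (\<lambda>z::real \<times> real. x(i := fst z, j := snd z))"
  proof (rule continuous_on_coordinatewise_then_product)
    fix k
    show "continuous_on UNIV (\<lambda>z::real \<times> real. (x(i := fst z, j := snd z)) k)"
      by (cases "k = j"; cases "k = i") (auto intro!: continuous_intros)
  qed
  then have "continuous_on UNIV (\<lambda>z. \<phi> (x(i := fst z, j := snd z)))"
    using continuous_on_compose2[OF assms(1)] by blast
  moreover have "(\<lambda>n. (s n, t n)) \<longlonglongrightarrow> (x i, x j)"
    using assms(2,3) by (rule tendsto_Pair)
  ultimately have "(\<lambda>n. \<phi> (x(i := fst (s n, t n), j := snd (s n, t n)))) \<longlonglongrightarrow>
      \<phi> (x(i := fst (x i, x j), j := snd (x i, x j)))"
    by (rule continuous_on_tendsto_compose) simp_all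
  then show ?thesis by simp
qed

lemma tendsto_shrinking:
  fixes a :: real
  assumes "\<And>n. a < u n" "\<And>n. u n < a + 1 / real (Suc n)"
  shows "u \<longlonglongrightarrow> a"
proof (rule tendsto_sandwich[of "\<lambda>n. a" u _ "\<lambda>n. a + 1 / real (Suc n)"])
  show "(\<lambda>n. a + 1 / real (Suc n)) \<longlonglongrightarrow> a"
    using tendsto_add[OF tendsto_const LIMSEQ_Suc[OF lim_1_over_n], of a] by simp
  show "(\<lambda>n. a) \<longlonglongrightarrow> a" by simp
qed (auto intro!: always_eventually less_imp_le assms simp del: of_nat_Suc)

lemma second_difference_tendsto:
  assumes g: "g \<in> smooth p" and ij: "i \<in> {1..p}" "j \<in> {1..p}" "i \<noteq> j"
  shows "(\<lambda>n. let h = 1 / real (Suc n) in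
      (g (x(i := x i + h, j := x j + h)) - g (x(i := x i + h)) - g (x(j := x j + h)) + g x) / (h * h))
    \<longlonglongrightarrow> partial_deriv j (partial_deriv i g) x"
proof -
  define h where "h n = 1 / real (Suc n)" for n
  have h: "h n > 0" for n by (simp add: h_def)
  obtain s t where st: "\<And>n. x i < s n" "\<And>n. s n < x i + h n" "\<And>n. x j < t n" "\<And>n. t n < x j + h n"
    and eq: "\<And>n. g (x(i := x i + h n, j := x j + h n)) - g (x(i := x i + h n)) - g (x(j := x j + h n)) + g x
      = h n * h n * partial_deriv j (partial_deriv i g) (x(i := s n, j := t n))"
    using second_difference_mean_value[OF g ij h, of x] by metis
  have "(\<lambda>n. partial_deriv j (partial_deriv i g) (x(i := s n, j := t n)))
      \<longlonglongrightarrow> partial_deriv j (partial_deriv i g) x"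
    using st by (intro tendsto_two_coordinates tendsto_shrinking smooth_continuous[of _ p]
        smooth_partial_deriv g ij) (simp_all add: h_def)
  moreover have "h n * h n \<noteq> 0" for n using h[of n] by simp
  ultimately show ?thesis
    by (simp only: h_def[symmetric] Let_def eq nonzero_mult_div_cancel_left[OF \<open>\<And>n. h n * h n \<noteq> 0\<close>])
qed

text \<open>The second difference does not depend on the order of the two coordinates, and its
  quotient by the squared step tends to either mixed derivative.\<close>

lemma partial_deriv_commute:
  assumes g: "g \<in> smooth p" and ij: "i \<in> {1..p}" "j \<in> {1..p}"
  shows "partial_deriv i (partial_deriv j g) = partial_deriv j (partial_deriv i g)"
proof (cases "i = j")
  case False
  show ?thesis
  proof
    fix x
    have "(let h = 1 / real (Suc n) in
        (g (x(j := x j + h, i := x i + h)) - g (x(j := x j + h)) - g (x(i := x i + h)) + g x) / (h * h)) =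
      (let h = 1 / real (Suc n) in
        (g (x(i := x i + h, j := x j + h)) - g (x(i := x i + h)) - g (x(j := x j + h)) + g x) / (h * h))" for n
      unfolding Let_def fun_upd_twist[OF False] by simp
    with second_difference_tendsto[OF g ij False, of x]
      second_difference_tendsto[OF g ij(2,1) False[symmetric], of x]
    show "partial_deriv i (partial_deriv j g) x = partial_deriv j (partial_deriv i g) x"
      using LIMSEQ_unique by (simp only:)
  qed
qed simp

section \<open>The algebra of superfunctions\<close>

lemma scaleR_fun_apply: "(c *\<^sub>R f) x = c *\<^sub>R f x"
  by (simp add: scaleR_fun_def)

lemmas fun_apply =
  plus_fun_apply zero_fun_apply times_fun_apply minus_apply uminus_apply scaleR_fun_apply

text \<open>As simplification rules these may eta-expand function-typed sums inside a goal.\<close>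

declare plus_fun_apply [simp del] zero_fun_apply [simp del] times_fun_apply [simp del]
  minus_apply [simp del] uminus_apply [simp del]

lemma par_cases: "par p i = 0 \<and> i \<le> p \<or> par p i = 1 \<and> p < i"
  by (auto simp: par_def)

lemma par_mult_self [simp]: "par p i * par p i = par p i"
  by (simp add: par_def)

lemma sfunsI:
  "(\<And>I. f I \<in> smooth p) \<Longrightarrow> (\<And>I. \<not> I \<subseteq> {p+1..p+q} \<Longrightarrow> f I = 0) \<Longrightarrow> f \<in> sfuns p q"
  unfolding sfuns_def by blast

lemma sfuns_smooth: "f \<in> sfuns p q \<Longrightarrow> f I \<in> smooth p"
  by (auto simp: sfuns_def)

lemma sfuns_support: "f \<in> sfuns p q \<Longrightarrow> \<not> I \<subseteq> {p+1..p+q} \<Longrightarrow> f I = 0"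
  by (auto simp: sfuns_def)

lemma sfuns_infinite: "f \<in> sfuns p q \<Longrightarrow> infinite I \<Longrightarrow> f I = 0"
  by (metis sfuns_support finite_atLeastAtMost finite_subset)

lemma sfuns_zero [simp]: "0 \<in> sfuns p q"
  by (rule sfunsI) (simp_all add: fun_apply smooth_zero)

lemma sfuns_add [simp]: "f \<in> sfuns p q \<Longrightarrow> g \<in> sfuns p q \<Longrightarrow> f + g \<in> sfuns p q"
  by (rule sfunsI)
    (simp_all add: fun_apply smooth_add sfuns_smooth[of _ _ q] sfuns_support[of f p q] sfuns_support[of g p q])

lemma sfuns_scaleR [simp]: "f \<in> sfuns p q \<Longrightarrow> c *\<^sub>R f \<in> sfuns p q"
  by (rule sfunsI) (simp_all add: fun_apply smooth_scaleR sfuns_smooth[of _ _ q] sfuns_support[of f p q])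

lemma sfuns_sum: "(\<And>i. i \<in> A \<Longrightarrow> f i \<in> sfuns p q) \<Longrightarrow> (\<Sum>i\<in>A. f i) \<in> sfuns p q"
  by (induction A rule: infinite_finite_induct) auto

subsection \<open>The product\<close>

text \<open>The three counts are sign exponents: \<open>shuffle_inv I J\<close> for sorting
  \<theta>_I \<theta>_J, \<open>lower i I\<close> for moving \<theta>_i from the front of \<theta>_I
  to its place, and \<open>upper i I\<close> for moving it there from the back.\<close>

definition shuffle_inv :: "nat set \<Rightarrow> nat set \<Rightarrow> nat" where
  "shuffle_inv I J = card {(i, j). i \<in> I \<and> j \<in> J \<and> j < i}"

definition lower :: "nat \<Rightarrow> nat set \<Rightarrow> nat" where
  "lower i I = card {j\<in>I. j < i}"

definition upper :: "nat \<Rightarrow> nat set \<Rightarrow> nat" where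
  "upper i I = card {j\<in>I. i < j}"

lemma shuffle_inv_empty [simp]: "shuffle_inv {} J = 0" "shuffle_inv I {} = 0"
  by (simp_all add: shuffle_inv_def)

lemma lower_upper: "finite I \<Longrightarrow> i \<notin> I \<Longrightarrow> lower i I + upper i I = card I"
  unfolding lower_def upper_def
  by (subst card_Un_disjoint[symmetric]) (auto intro!: arg_cong[of _ _ card], metis nat_neq_iff)

lemma lower_insert_self [simp]: "lower i (insert i I) = lower i I"
  by (auto simp: lower_def intro!: arg_cong[of _ _ card])

lemma lower_remove_self [simp]: "lower i (I - {i}) = lower i I"
  by (auto simp: lower_def intro!: arg_cong[of _ _ card])

lemma lower_insert: "finite I \<Longrightarrow> k \<notin> I \<Longrightarrow> lower i (insert k I) = (if k < i then 1 else 0) + lower i I"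
proof -
  assume "finite I" "k \<notin> I"
  moreover have "{j \<in> insert k I. j < i} = (if k < i then {k} else {}) \<union> {j\<in>I. j < i}" by auto
  ultimately show ?thesis by (simp add: lower_def)
qed

lemma lower_diff: "finite K \<Longrightarrow> I \<subseteq> K \<Longrightarrow> lower i I + lower i (K - I) = lower i K"
  unfolding lower_def
  by (subst card_Un_disjoint[symmetric]) (auto intro!: arg_cong[of _ _ card] dest: finite_subset)

lemma shuffle_inv_insert_left:
  assumes "finite I" "finite J" "i \<notin> I"
  shows "shuffle_inv (insert i I) J = shuffle_inv I J + lower i J"
proof -
  have "{(k, j). k \<in> insert i I \<and> j \<in> J \<and> j < k} =
      {(k, j). k \<in> I \<and> j \<in> J \<and> j < k} \<union> Pair i ` {j\<in>J. j < i}" by auto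
  moreover have "finite {(k, j). k \<in> I \<and> j \<in> J \<and> j < k}"
    by (rule finite_subset[of _ "I \<times> J"]) (use assms in auto)
  ultimately show ?thesis
    using assms card_image[of "Pair i" "{j\<in>J. j < i}"]
    unfolding shuffle_inv_def lower_def by (simp add: inj_on_def) (subst card_Un_disjoint; auto)
qed

lemma shuffle_inv_insert_right:
  assumes "finite I" "finite J" "j \<notin> J"
  shows "shuffle_inv I (insert j J) = shuffle_inv I J + upper j I"
proof -
  have "{(k, l). k \<in> I \<and> l \<in> insert j J \<and> l < k} =
      {(k, l). k \<in> I \<and> l \<in> J \<and> l < k} \<union> (\<lambda>k. (k, j)) ` {k\<in>I. j < k}" by auto
  moreover have "finite {(k, l). k \<in> I \<and> l \<in> J \<and> l < k}"
    by (rule finite_subset[of _ "I \<times> J"]) (use assms in auto)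
  ultimately show ?thesis
    using assms card_image[of "\<lambda>k. (k, j)" "{k\<in>I. j < k}"]
    unfolding shuffle_inv_def upper_def by (simp add: inj_on_def) (subst card_Un_disjoint; auto)
qed

lemma sum_Pow_insert:
  assumes "finite K" "i \<notin> K"
  shows "(\<Sum>I\<in>Pow (insert i K). h I) = (\<Sum>I\<in>Pow K. h I + h (insert i I))"
proof -
  have "inj_on (insert i) (Pow K)" using assms(2) by (auto simp: inj_on_def)
  moreover have "Pow K \<inter> insert i ` Pow K = {}" using assms(2) by auto
  ultimately show ?thesis
    using assms by (simp add: Pow_insert sum.union_disjoint sum.reindex sum.distrib)
qed

lemma sprod_apply: "(f \<odot> g) K x =
    (\<Sum>I\<in>Pow K. (-1) ^ shuffle_inv I (K - I) * f I x * g (K - I) x)"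
  by (simp add: sprod_def shuffle_inv_def)

lemma sprod_component: "(f \<odot> g) K = (\<Sum>I\<in>Pow K. (-1) ^ shuffle_inv I (K - I) *\<^sub>R (f I * g (K - I)))"
  by (rule ext) (simp add: fun_apply sprod_apply sum_fun_apply mult.assoc)

lemma sign_lower:
  assumes "finite K" "I \<subseteq> K"
  shows "(-1) ^ lower i K = (-1) ^ lower i I * ((-1) ^ lower i (K - I) :: real)"
  by (simp flip: lower_diff[OF assms] add: power_add)

lemma sign_card:
  assumes "finite I" "i \<notin> I"
  shows "(-1) ^ card I = (-1) ^ lower i I * ((-1) ^ upper i I :: real)"
  by (simp flip: lower_upper[OF assms] add: power_add)

text \<open>The subsets of \<open>insert i K\<close> are grouped by whether they contain
  \<open>i\<close>: either \<theta>_i belongs to the right factor and crosses the larger part of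
  \<open>I\<close>, or it belongs to the left factor and crosses the smaller part of
  \<open>K - I\<close>. The rules for odd coordinates and derivatives then become comparisons of
  signs for each \<open>I\<close>.\<close>

lemma sprod_insert:
  assumes K: "finite K" "i \<notin> K"
  shows "(f \<odot> g) (insert i K) x = (\<Sum>I\<in>Pow K. (-1) ^ shuffle_inv I (K - I) *
    ((-1) ^ upper i I * (f I x * g (insert i (K - I)) x) +
     (-1) ^ lower i (K - I) * (f (insert i I) x * g (K - I) x)))"
  unfolding sprod_apply sum_Pow_insert[OF K]
proof (intro sum.cong refl)
  fix I assume "I \<in> Pow K"
  then have I: "finite I" "i \<notin> I" using K by (auto intro: finite_subset)
  have "insert i K - insert i I = K - I" "insert i K - I = insert i (K - I)" "i \<notin> K - I"
    "finite (K - I)"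
    using K I by auto
  then show "(-1) ^ shuffle_inv I (insert i K - I) * f I x * g (insert i K - I) x +
      (-1) ^ shuffle_inv (insert i I) (insert i K - insert i I) * f (insert i I) x *
        g (insert i K - insert i I) x =
    (-1) ^ shuffle_inv I (K - I) * ((-1) ^ upper i I * (f I x * g (insert i (K - I)) x) +
      (-1) ^ lower i (K - I) * (f (insert i I) x * g (K - I) x))"
    using I by (simp add: shuffle_inv_insert_left shuffle_inv_insert_right power_add algebra_simps)
qed

lemma sprod_infinite: "infinite K \<Longrightarrow> (f \<odot> g) K = 0"
  by (rule ext) (simp add: fun_apply sprod_apply)

lemma sprod_add_left: "(f + g) \<odot> h = f \<odot> h + g \<odot> h"
  by (intro ext) (simp add: fun_apply sprod_apply sum.distrib algebra_simps)

lemma sprod_add_right: "h \<odot> (f + g) = h \<odot> f + h \<odot> g"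
  by (intro ext) (simp add: fun_apply sprod_apply sum.distrib algebra_simps)

lemma sprod_scaleR_left [simp]: "(c *\<^sub>R f) \<odot> h = c *\<^sub>R (f \<odot> h)"
  by (intro ext) (simp add: fun_apply sprod_apply sum_distrib_left algebra_simps)

lemma sprod_scaleR_right [simp]: "h \<odot> (c *\<^sub>R f) = c *\<^sub>R (h \<odot> f)"
  by (intro ext) (simp add: fun_apply sprod_apply sum_distrib_left algebra_simps)

lemma sprod_zero [simp]: "0 \<odot> h = 0" "h \<odot> 0 = 0"
  by (intro ext, simp add: fun_apply sprod_apply)+

lemma sprod_minus [simp]: "(- f) \<odot> h = - (f \<odot> h)" "h \<odot> (- f) = - (h \<odot> f)"
  using sprod_scaleR_left[of "-1" f h] sprod_scaleR_right[of h "-1" f] by simp_all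

lemma sprod_diff_right: "h \<odot> (f - g) = h \<odot> f - h \<odot> g"
  using sprod_add_right[of h f "- g"] by simp

lemma sprod_sum_left: "(\<Sum>i\<in>A. f i) \<odot> h = (\<Sum>i\<in>A. f i \<odot> h)"
  by (induction A rule: infinite_finite_induct) (simp_all add: sprod_add_left)

lemma sfuns_sprod [simp]:
  assumes f: "f \<in> sfuns p q" and g: "g \<in> sfuns p q"
  shows "f \<odot> g \<in> sfuns p q"
proof (rule sfunsI)
  fix K
  show "(f \<odot> g) K \<in> smooth p"
    unfolding sprod_component
    by (intro smooth_sum smooth_scaleR smooth_mult sfuns_smooth[OF f] sfuns_smooth[OF g])
  assume "\<not> K \<subseteq> {p+1..p+q}"
  then have "f I = 0 \<or> g (K - I) = 0" for I
    using sfuns_support[OF f, of I] sfuns_support[OF g, of "K - I"] by blast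
  then have "f I * g (K - I) = 0" for I
    by (metis mult_zero_left mult_zero_right)
  then show "(f \<odot> g) K = 0"
    unfolding sprod_component by simp
qed

lemma sfuns_sone [simp]: "sone \<in> sfuns p q"
proof (rule sfunsI)
  fix I
  have "sone I = (\<lambda>x. if I = {} then 1 else 0)" by (simp add: sone_def)
  then show "sone I \<in> smooth p" by (simp add: smooth_const)
  assume "\<not> I \<subseteq> {p+1..p+q}"
  then show "sone I = 0" by (auto simp: sone_def fun_eq_iff fun_apply)
qed

lemma sone_sprod:
  assumes "f \<in> sfuns p q"
  shows "sone \<odot> f = f"
proof (intro ext)
  fix K x
  show "(sone \<odot> f) K x = f K x"
  proof (cases "finite K")
    case True
    have "(sone \<odot> f) K x = (\<Sum>I\<in>{{}}. (-1) ^ shuffle_inv I (K - I) * sone I x * f (K - I) x)"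
      unfolding sprod_apply by (rule sum.mono_neutral_right) (auto simp: True sone_def)
    then show ?thesis by (simp add: sone_def)
  qed (simp add: sprod_infinite sfuns_infinite[OF assms])
qed

lemma sprod_sone:
  assumes "f \<in> sfuns p q"
  shows "f \<odot> sone = f"
proof (intro ext)
  fix K x
  show "(f \<odot> sone) K x = f K x"
  proof (cases "finite K")
    case True
    have "(f \<odot> sone) K x = (\<Sum>I\<in>{K}. (-1) ^ shuffle_inv I (K - I) * f I x * sone (K - I) x)"
      unfolding sprod_apply by (rule sum.mono_neutral_right) (auto simp: True sone_def)
    then show ?thesis by (simp add: sone_def)
  qed (simp add: sprod_infinite sfuns_infinite[OF assms])
qed

subsection \<open>Coordinates and derivatives\<close>

lemma sfuns_coord [simp]:
  assumes "i \<in> {1..p+q}"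
  shows "coord p i \<in> sfuns p q"
proof (rule sfunsI)
  fix I
  show "coord p i I \<in> smooth p"
  proof (cases "i \<le> p")
    case True
    then have "coord p i I = (if I = {} then (\<lambda>x. x i) else (\<lambda>x. 0))"
      by (auto simp: coord_def)
    then show ?thesis using True assms by (simp add: smooth_const smooth_coord)
  next
    case False
    then have "coord p i I = (\<lambda>x. if I = {i} then 1 else 0)"
      by (auto simp: coord_def)
    then show ?thesis by (simp add: smooth_const)
  qed
  assume "\<not> I \<subseteq> {p+1..p+q}"
  then show "coord p i I = 0"
    using assms by (auto simp: coord_def fun_eq_iff fun_apply)
qed

lemma coord_sprod_even:
  assumes "i \<le> p" "finite K"
  shows "(coord p i \<odot> f) K x = x i * f K x"
proof -
  have "(coord p i \<odot> f) K x = (\<Sum>I\<in>{{}}. (-1) ^ shuffle_inv I (K - I) * coord p i I x * f (K - I) x)"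
    unfolding sprod_apply by (rule sum.mono_neutral_right) (auto simp: assms coord_def)
  also have "\<dots> = x i * f K x"
    using assms by (simp add: coord_def)
  finally show ?thesis .
qed

lemma coord_sprod_odd:
  assumes "p < i" "finite K"
  shows "(coord p i \<odot> f) K x = (if i \<in> K then (-1) ^ lower i K * f (K - {i}) x else 0)"
proof (cases "i \<in> K")
  case True
  have "(coord p i \<odot> f) K x = (\<Sum>I\<in>{{i}}. (-1) ^ shuffle_inv I (K - I) * coord p i I x * f (K - I) x)"
    unfolding sprod_apply by (rule sum.mono_neutral_right) (use True assms in \<open>auto simp: coord_def\<close>)
  then show ?thesis
    using assms True shuffle_inv_insert_left[of "{}" "K - {i}" i] by (simp add: coord_def)
next
  case False
  have "(coord p i \<odot> f) K x = (\<Sum>I\<in>{}. (-1) ^ shuffle_inv I (K - I) * coord p i I x * f (K - I) x)"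
    unfolding sprod_apply by (rule sum.mono_neutral_right) (use False assms in \<open>auto simp: coord_def\<close>)
  then show ?thesis using False by simp
qed

text \<open>For odd \<open>a\<close> this is the parity involution, for even \<open>a\<close> the
  identity. It implements the sign that an object of parity \<open>a\<close> produces when it passes
  a superfunction, without splitting the latter into homogeneous parts.\<close>

definition flip :: "nat \<Rightarrow> sfun \<Rightarrow> sfun" where
  "flip a f = (\<lambda>I. (-1) ^ (a * card I) *\<^sub>R f I)"

lemma flip_0 [simp]: "flip 0 f = f"
  by (simp add: flip_def)

lemma flip_flip: "flip a (flip b f) = flip (a + b) f"
  by (intro ext) (simp add: fun_apply flip_def power_add algebra_simps)

lemma flip_flip_self [simp]: "flip a (flip a f) = f"
  by (intro ext) (simp add: fun_apply flip_def flip: mult.assoc)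

lemma flip_add [simp]: "flip a (f + g) = flip a f + flip a g"
  by (intro ext) (simp add: fun_apply flip_def algebra_simps)

lemma flip_scaleR [simp]: "flip a (c *\<^sub>R f) = c *\<^sub>R flip a f"
  by (intro ext) (simp add: fun_apply flip_def algebra_simps)

lemma flip_minus [simp]: "flip a (- f) = - flip a f"
  by (intro ext) (simp add: fun_apply flip_def algebra_simps)

lemma flip_zero [simp]: "flip a 0 = 0"
  by (intro ext) (simp add: fun_apply flip_def algebra_simps)

lemma flip_diff [simp]: "flip a (f - g) = flip a f - flip a g"
  by (intro ext) (simp add: fun_apply flip_def algebra_simps)

lemma flip_sum: "flip a (\<Sum>i\<in>A. f i) = (\<Sum>i\<in>A. flip a (f i))"
  by (induction A rule: infinite_finite_induct) simp_all

lemma flip_eq_0_iff [simp]: "flip a f = 0 \<longleftrightarrow> f = 0"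
  by (metis flip_flip_self flip_zero)

lemma sfuns_flip [simp]: "f \<in> sfuns p q \<Longrightarrow> flip a f \<in> sfuns p q"
  unfolding flip_def
  by (rule sfunsI) (simp_all add: fun_apply smooth_scaleR sfuns_smooth[of _ _ q] sfuns_support[of f p q])

lemma flip_sprod: "flip a (f \<odot> g) = flip a f \<odot> flip a g"
proof (intro ext)
  fix K x
  show "flip a (f \<odot> g) K x = (flip a f \<odot> flip a g) K x"
  proof (cases "finite K")
    case True
    have "(-1) ^ (a * card K) = (-1) ^ (a * card I) * ((-1) ^ (a * card (K - I)) :: real)" if "I \<subseteq> K" for I
    proof -
      have "card K = card I + card (K - I)"
        using that True by (metis card_Diff_subset card_mono finite_subset le_add_diff_inverse)
      then show ?thesis by (simp add: power_add algebra_simps)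
    qed
    then show ?thesis
      by (auto simp: flip_def sprod_apply sum_distrib_left fun_apply algebra_simps intro!: sum.cong)
  qed (simp add: flip_def sprod_infinite)
qed

lemma flip_coord: "flip a (coord p i) = (-1) ^ (a * par p i) *\<^sub>R coord p i"
  by (intro ext) (auto simp: fun_apply flip_def coord_def par_def)

lemma flip_sone [simp]: "flip a sone = sone"
  by (intro ext) (auto simp: fun_apply flip_def sone_def)

lemma flip_sderiv:
  assumes "f \<in> sfuns p q" "i \<in> {1..p+q}"
  shows "flip a (sderiv p i f) = (-1) ^ (a * par p i) *\<^sub>R sderiv p i (flip a f)"
proof (cases "i \<le> p")
  case True
  then show ?thesis
    using assms by (intro ext) (simp add: fun_apply flip_def sderiv_def par_def partial_deriv_scaleR[OF sfuns_smooth])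
next
  case False
  show ?thesis
  proof (intro ext)
    fix I x
    show "flip a (sderiv p i f) I x = ((-1) ^ (a * par p i) *\<^sub>R sderiv p i (flip a f)) I x"
    proof (cases "finite I")
      case True
      then show ?thesis using False
        by (auto simp: flip_def sderiv_def par_def fun_apply power_add algebra_simps)
    next
      case False
      then have "f I = 0" "f (insert i I) = 0" "flip a f I = 0" "flip a f (insert i I) = 0"
        using assms by (auto intro!: sfuns_infinite[of _ p q])
      then show ?thesis using \<open>\<not> i \<le> p\<close> by (simp add: flip_def sderiv_def fun_apply)
    qed
  qed
qed

text \<open>For an odd coordinate both sides vanish at \<open>K\<close> unless \<open>i\<close> lies
  in \<open>K\<close>. With \<open>K = insert i L\<close> only the subsets in which \<theta>_i
  belongs to the left factor survive in \<open>sprod_insert\<close>, and the signs agree by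
  \<open>sign_lower\<close>.\<close>

lemma coord_sprod_assoc: "(coord p i \<odot> f) \<odot> g = coord p i \<odot> (f \<odot> g)"
proof (intro ext)
  fix K x
  show "((coord p i \<odot> f) \<odot> g) K x = (coord p i \<odot> (f \<odot> g)) K x"
  proof (cases "finite K")
    case True
    then have fin: "finite I" if "I \<in> Pow K" for I
      using that by (auto intro: finite_subset)
    show ?thesis
    proof (cases "i \<le> p")
      case True
      then show ?thesis using \<open>finite K\<close> fin
        by (simp add: coord_sprod_even sprod_apply[of _ g] sum_distrib_left algebra_simps)
    next
      case False
      show ?thesis
      proof (cases "i \<in> K")
        case False
        have "(coord p i \<odot> f) I x = 0" if "I \<in> Pow K" for I
          using that False \<open>\<not> i \<le> p\<close> fin by (auto simp: coord_sprod_odd)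
        then show ?thesis using \<open>finite K\<close> \<open>\<not> i \<le> p\<close> False
          by (simp add: sprod_apply[of _ g] coord_sprod_odd)
      next
        case True
        define L where "L = K - {i}"
        have K: "K = insert i L" "i \<notin> L" "finite L"
          using True \<open>finite K\<close> by (auto simp: L_def)
        have I: "finite I" "i \<notin> I" "(-1) ^ lower i L = (-1) ^ lower i I * ((-1) ^ lower i (L - I) :: real)"
          if "I \<subseteq> L" for I
          using that K sign_lower by (auto intro: finite_subset)
        show ?thesis
          using K \<open>\<not> i \<le> p\<close> I
          by (auto simp: coord_sprod_odd sprod_insert[of L i "coord p i \<odot> f"] sprod_apply[of f g L]
              sum_distrib_left intro!: sum.cong)
      qed
    qed
  qed (simp add: sprod_infinite)
qed

text \<open>An odd coordinate is pulled to the front through \<open>f\<close>. The sign from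
  \<open>flip\<close> is the product of the signs for the elements below and above \<open>i\<close>,
  as in \<open>sign_card\<close>; this turns the \<open>upper\<close> sign of
  \<open>sprod_insert\<close> into the \<open>lower\<close> sign of a coordinate standing in
  front.\<close>

lemma flip_sprod_coord: "flip (par p i) f \<odot> (coord p i \<odot> g) = coord p i \<odot> (f \<odot> g)"
proof (intro ext)
  fix K x
  show "(flip (par p i) f \<odot> (coord p i \<odot> g)) K x = (coord p i \<odot> (f \<odot> g)) K x"
  proof (cases "finite K")
    case True
    then have fin: "finite (K - I)" for I by simp
    show ?thesis
    proof (cases "i \<le> p")
      case True
      then show ?thesis using \<open>finite K\<close>
        by (simp add: par_def coord_sprod_even sprod_apply[of f] sum_distrib_left algebra_simps)
    next
      case False
      then have par: "par p i = 1" by (simp add: par_def)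
      show ?thesis
      proof (cases "i \<in> K")
        case False
        then show ?thesis using \<open>finite K\<close> \<open>\<not> i \<le> p\<close>
          by (simp add: sprod_apply[of "flip _ _"] coord_sprod_odd)
      next
        case True
        define L where "L = K - {i}"
        have K: "K = insert i L" "i \<notin> L" "finite L"
          using True \<open>finite K\<close> by (auto simp: L_def)
        have I: "finite I" "i \<notin> I" "(-1) ^ card I = (-1) ^ lower i I * ((-1) ^ upper i I :: real)"
          "(-1) ^ lower i L = (-1) ^ lower i I * ((-1) ^ lower i (L - I) :: real)"
          if "I \<subseteq> L" for I
          using that K sign_lower sign_card[of I i] by (auto intro: finite_subset)
        show ?thesis
          using K \<open>\<not> i \<le> p\<close> I
          by (auto simp: par flip_def fun_apply coord_sprod_odd sprod_insert[of L i _ "coord p i \<odot> g"]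
              sprod_apply[of f g L] sum_distrib_left intro!: sum.cong)
      qed
    qed
  qed (simp add: sprod_infinite)
qed

lemma sfuns_sderiv [simp]:
  assumes f: "f \<in> sfuns p q" and i: "i \<in> {1..p+q}"
  shows "sderiv p i f \<in> sfuns p q"
proof (cases "i \<le> p")
  case True
  show ?thesis
  proof (rule sfunsI)
    fix I
    show "sderiv p i f I \<in> smooth p"
      using True i by (simp add: sderiv_def smooth_partial_deriv sfuns_smooth[OF f])
    assume "\<not> I \<subseteq> {p+1..p+q}"
    then show "sderiv p i f I = 0"
      using True sfuns_support[OF f, of I] by (simp add: sderiv_def)
  qed
next
  case False
  then have eq: "sderiv p i f I = (if i \<in> I then 0 else (-1) ^ lower i I *\<^sub>R f (insert i I))" for I
    by (auto simp: sderiv_def lower_def fun_eq_iff fun_apply)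
  show ?thesis
  proof (rule sfunsI)
    fix I
    show "sderiv p i f I \<in> smooth p"
      unfolding eq by (simp add: smooth_zero smooth_scaleR sfuns_smooth[OF f])
    assume "\<not> I \<subseteq> {p+1..p+q}"
    then show "sderiv p i f I = 0"
      using sfuns_support[OF f, of "insert i I"] by (auto simp: eq)
  qed
qed

lemma sderiv_odd:
  "p < i \<Longrightarrow> sderiv p i f I x = (if i \<in> I then 0 else (-1) ^ lower i I * f (insert i I) x)"
  by (auto simp: sderiv_def lower_def)

lemma sderiv_zero [simp]: "sderiv p i 0 = 0"
  by (intro ext) (auto simp: fun_apply sderiv_def)

lemma sderiv_add:
  assumes "f \<in> sfuns p q" "g \<in> sfuns p q" "i \<in> {1..p+q}"
  shows "sderiv p i (f + g) = sderiv p i f + sderiv p i g"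
  using assms
  by (intro ext) (auto simp: fun_apply sderiv_def algebra_simps partial_deriv_add[OF sfuns_smooth sfuns_smooth])

lemma sderiv_scaleR:
  assumes "f \<in> sfuns p q" "i \<in> {1..p+q}"
  shows "sderiv p i (c *\<^sub>R f) = c *\<^sub>R sderiv p i f"
  using assms
  by (intro ext) (auto simp: fun_apply sderiv_def algebra_simps partial_deriv_scaleR[OF sfuns_smooth])

lemma sderiv_sprod:
  assumes f: "f \<in> sfuns p q" and g: "g \<in> sfuns p q" and i: "i \<in> {1..p+q}"
  shows "sderiv p i (f \<odot> g) = sderiv p i f \<odot> g + flip (par p i) f \<odot> sderiv p i g"
proof (cases "i \<le> p")
  case True
  then have i': "i \<in> {1..p}" using i by simp
  have psum: "partial_deriv i (\<Sum>I\<in>A. h I) = (\<Sum>I\<in>A. partial_deriv i (h I))"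
    if "\<And>I. I \<in> A \<Longrightarrow> h I \<in> smooth p" for A and h :: "nat set \<Rightarrow> point \<Rightarrow> real"
    using that
    by (induction A rule: infinite_finite_induct) (simp_all add: partial_deriv_add[OF _ _ i'] smooth_sum)
  have fg: "f I \<in> smooth p" "g I \<in> smooth p" for I
    using f g by (auto intro: sfuns_smooth)
  show ?thesis
  proof
    fix K
    have "sderiv p i (f \<odot> g) K =
      (\<Sum>I\<in>Pow K. (-1) ^ shuffle_inv I (K - I) *\<^sub>R (partial_deriv i (f I) * g (K - I) + f I * partial_deriv i (g (K - I))))"
      using True fg i' unfolding sderiv_def sprod_component
      by (simp add: psum smooth_scaleR smooth_mult partial_deriv_scaleR[OF smooth_mult[OF fg] i']
          partial_deriv_mult[OF fg i'])
    then show "sderiv p i (f \<odot> g) K = (sderiv p i f \<odot> g + flip (par p i) f \<odot> sderiv p i g) K"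
      using True by (simp add: sprod_component sderiv_def par_def scaleR_add_right sum.distrib fun_apply)
  qed
next
  case False
  then have pi: "p < i" and par: "par p i = 1" by (simp_all add: par_def)
  show ?thesis
  proof (intro ext)
    fix K x
    show "sderiv p i (f \<odot> g) K x = (sderiv p i f \<odot> g + flip (par p i) f \<odot> sderiv p i g) K x"
    proof (cases "finite K")
      case fin: True
      show ?thesis
      proof (cases "i \<in> K")
        case True
        define L where "L = K - {i}"
        have K: "K = insert i L" "i \<notin> L" "finite L"
          using True \<open>finite K\<close> by (auto simp: L_def)
        have I: "finite I" "i \<notin> I" "(-1) ^ card I = (-1) ^ lower i I * ((-1) ^ upper i I :: real)"
          if "I \<subseteq> L" for I
          using that K sign_card[of I i] by (auto intro: finite_subset)
        \<comment> \<open>The odd derivative has no component at a set containing \<open>i\<close>,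
          so the right-hand side must vanish there; its two products cancel for each subset
          \<open>I\<close> of \<open>L\<close>.\<close>
        have "(sderiv p i f \<odot> g + flip 1 f \<odot> sderiv p i g) K x = (\<Sum>I\<in>Pow L. 0)"
          unfolding K(1) plus_fun_apply sprod_insert[OF K(3,2)] sum.distrib[symmetric]
          using K pi I
          by (intro sum.cong refl) (auto simp: sderiv_odd flip_def fun_apply algebra_simps)
        then show ?thesis using True pi by (simp add: par sderiv_odd)
      next
        case False
        have I: "finite I" "i \<notin> I" "(-1) ^ card I = (-1) ^ lower i I * ((-1) ^ upper i I :: real)"
          "(-1) ^ lower i K = (-1) ^ lower i I * ((-1) ^ lower i (K - I) :: real)"
          if "I \<subseteq> K" for I
          using that fin False sign_lower sign_card[of I i] by (auto intro: finite_subset)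
        have "sderiv p i (f \<odot> g) K x = (\<Sum>I\<in>Pow K. (-1) ^ shuffle_inv I (K - I) *
          (sderiv p i f I x * g (K - I) x + flip 1 f I x * sderiv p i g (K - I) x))"
          using pi False I fin
          by (auto simp: sderiv_odd sprod_insert sum_distrib_left flip_def fun_apply algebra_simps
              intro!: sum.cong)
        then show ?thesis by (simp add: par sprod_apply sum.distrib fun_apply algebra_simps)
      qed
    next
      case False
      then show ?thesis using pi by (simp add: sprod_infinite sderiv_odd fun_apply)
    qed
  qed
qed

lemma sderiv_coord:
  "i \<in> {1..p+q} \<Longrightarrow> j \<in> {1..p+q} \<Longrightarrow> sderiv p i (coord p j) = (if i = j then sone else 0)"
proof (cases "i \<le> p")
  case True
  assume ij: "i \<in> {1..p+q}" "j \<in> {1..p+q}"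
  have "partial_deriv i (\<lambda>x. x j) = (\<lambda>x. if i = j then 1 else 0)"
    by (rule ext) (auto intro!: partial_derivI)
  moreover have "coord p j I = (if j \<le> p then (if I = {} then (\<lambda>x. x j) else (\<lambda>x. 0))
      else (if I = {j} then (\<lambda>x. 1) else (\<lambda>x. 0)))" for I
    by (auto simp: coord_def)
  ultimately show ?thesis using True
    by (intro ext) (auto simp: fun_apply sderiv_def sone_def)
next
  case False
  assume ij: "i \<in> {1..p+q}" "j \<in> {1..p+q}"
  show ?thesis using False
    by (intro ext) (auto simp: fun_apply sderiv_def coord_def sone_def)
qed

lemma sderiv_sone [simp]: "sderiv p i sone = 0"
proof -
  have "sone I = (\<lambda>x. if I = {} then 1 else 0)" for I by (simp add: sone_def)
  then show ?thesis by (intro ext) (auto simp: fun_apply sderiv_def)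
qed

subsection \<open>Supercommutation relations\<close>

definition sg :: "nat \<Rightarrow> nat \<Rightarrow> nat \<Rightarrow> real" where
  "sg p i j = (-1) ^ (par p i * par p j)"

lemma sg_commute: "sg p i j = sg p j i"
  by (simp add: sg_def mult.commute)

lemma sg_square [simp]: "sg p i j * sg p i j = 1" "sg p i j * (sg p i j * c) = c"
  by (simp_all add: sg_def flip: mult.assoc)

lemma sderiv_coord_sprod:
  assumes "f \<in> sfuns p q" "i \<in> {1..p+q}" "j \<in> {1..p+q}"
  shows "sderiv p i (coord p j \<odot> f) =
    sg p i j *\<^sub>R (coord p j \<odot> sderiv p i f) + (if i = j then f else 0)"
  using assms
  by (simp add: sderiv_sprod[of _ p q] sderiv_coord[of _ _ q] flip_coord sone_sprod[of _ p q] sg_def)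

lemma coord_sprod_commute:
  "coord p i \<odot> (coord p j \<odot> f) = sg p i j *\<^sub>R (coord p j \<odot> (coord p i \<odot> f))"
  using flip_sprod_coord[of p i "coord p j" f] by (simp add: flip_coord sg_def)

text \<open>Two even derivatives commute by symmetry of second derivatives. Two odd ones anticommute
  because inserting the smaller index raises \<open>lower\<close> of the larger one by one and
  leaves the other count unchanged.\<close>

lemma sderiv_commute:
  assumes f: "f \<in> sfuns p q" and ij: "i \<in> {1..p+q}" "j \<in> {1..p+q}"
  shows "sderiv p i (sderiv p j f) = sg p i j *\<^sub>R sderiv p j (sderiv p i f)"
proof -
  have sm: "f I \<in> smooth p" for I using f by (rule sfuns_smooth)
  have eo: "sderiv p i (sderiv p j f) = sderiv p j (sderiv p i f)"
    if "i \<le> p" "p < j" "i \<in> {1..p+q}" for i j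
  proof
    fix I
    have "sderiv p j f I = (if j \<in> I then 0 else (-1) ^ lower j I *\<^sub>R f (insert j I))"
      using that by (auto simp: sderiv_def lower_def fun_eq_iff fun_apply)
    then have "partial_deriv i (sderiv p j f I) =
        (if j \<in> I then 0 else (-1) ^ lower j I *\<^sub>R partial_deriv i (f (insert j I)))"
      using that by (simp add: partial_deriv_scaleR[OF sm])
    then show "sderiv p i (sderiv p j f) I = sderiv p j (sderiv p i f) I"
      using that by (auto simp: sderiv_def lower_def fun_eq_iff fun_apply)
  qed
  consider "i \<le> p" "j \<le> p" | "i \<le> p" "p < j" | "p < i" "j \<le> p" | "p < i" "p < j" by linarith
  then show ?thesis
  proof cases
    case 1
    then show ?thesis
      using ij by (intro ext) (simp add: fun_apply sderiv_def sg_def par_def partial_deriv_commute[OF sm])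
  next
    case 2
    then show ?thesis using eo[of i j] ij by (simp add: sg_def par_def)
  next
    case 3
    then show ?thesis using eo[of j i] ij by (simp add: sg_def par_def)
  next
    case 4
    show ?thesis
    proof (intro ext)
      fix I x
      show "sderiv p i (sderiv p j f) I x = (sg p i j *\<^sub>R sderiv p j (sderiv p i f)) I x"
      proof (cases "finite I")
        case True
        consider "i = j" | "i \<in> I" | "j \<in> I" | "i < j" "i \<notin> I" "j \<notin> I" | "j < i" "i \<notin> I" "j \<notin> I" by linarith
        then show ?thesis
        proof cases
          case 1
          then show ?thesis using 4 by (simp add: sderiv_odd fun_apply)
        qed (use 4 True in \<open>auto simp: fun_apply sderiv_odd lower_insert sg_def par_def insert_commute power_add\<close>)
      next
        case False
        then have "f (insert i (insert j I)) = 0" "f (insert j (insert i I)) = 0"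
          using f by (auto intro: sfuns_infinite)
        then show ?thesis using 4 by (simp add: sderiv_odd fun_apply)
      qed
    qed
  qed
qed

subsection \<open>Homogeneous components\<close>

lemma flip_hpart: "flip a (hpart b f) = (-1) ^ (a * b) *\<^sub>R hpart b f"
  by (intro ext) (auto simp: fun_apply flip_def hpart_def minus_one_power_iff)

lemma hpart_sum: "hpart 0 f + hpart 1 f = f"
  by (intro ext) (auto simp: fun_apply hpart_def)

text \<open>The bridge from the definitions, which sum over parities, to
  \<open>flip\<close>.\<close>

lemma flip_eq_sum_hpart: "(\<Sum>b\<in>{0,1}. (-1) ^ (a * b) *\<^sub>R hpart b f) = flip a f"
proof -
  have "flip a f = flip a (hpart 0 f) + flip a (hpart 1 f)"
    by (simp only: flip_add[symmetric] hpart_sum)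
  then show ?thesis by (simp add: flip_hpart)
qed

lemma sfuns_hpart [simp]: "f \<in> sfuns p q \<Longrightarrow> hpart a f \<in> sfuns p q"
  unfolding hpart_def by (rule sfunsI) (simp_all add: fun_apply sfuns_smooth[of _ _ q] smooth_zero sfuns_support[of f p q])

lemma hpart_add: "hpart a (f + g) = hpart a f + hpart a g"
  by (intro ext) (auto simp: fun_apply hpart_def)

lemma hpart_scaleR: "hpart a (c *\<^sub>R f) = c *\<^sub>R hpart a f"
  by (intro ext) (auto simp: fun_apply hpart_def)

section \<open>Operators on symbols\<close>

text \<open>The dimensions are arbitrary here; \<open>q = p + 1\<close> is a hypothesis of those
  lemmas in which the value \<open>-1\<close> of \<open>p - q\<close> enters.\<close>

locale superspace =
  fixes p q :: nat
begin

abbreviation idx :: "nat set" where "idx \<equiv> {1..p+q}"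
abbreviation F :: "sfun set" where "F \<equiv> sfuns p q"
abbreviation V :: "symbol set" where "V \<equiv> symbols p q"
abbreviation par' :: "nat \<Rightarrow> nat" where "par' \<equiv> par p"
abbreviation \<sigma> :: "nat \<Rightarrow> nat \<Rightarrow> real" where "\<sigma> \<equiv> sg p"
abbreviation \<epsilon> :: "nat \<Rightarrow> real" where "\<epsilon> i \<equiv> (-1) ^ par p i"

text \<open>The sign that sorts e_j into a monomial from the left: an odd e_j crosses the odd
  factors with smaller index.\<close>

definition lsign :: "nat \<Rightarrow> nat multiset \<Rightarrow> real" where
  "lsign j \<alpha> = (-1) ^ (par' j * size {#l \<in># \<alpha>. p < l \<and> l < j#})"

definition symY :: "nat \<Rightarrow> symbol \<Rightarrow> symbol" where
  "symY j S = (\<lambda>\<alpha>. coord p j \<odot> S \<alpha>)"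

definition symD :: "nat \<Rightarrow> symbol \<Rightarrow> symbol" where
  "symD j S = (\<lambda>\<alpha>. sderiv p j (S \<alpha>))"

text \<open>\<open>symP j\<close> is the left product with \<open>e\<^sub>j\<close> and \<open>symI j\<close> the interior product with the dual
  basis vector; both pass the coefficients with a sign.\<close>

definition symP :: "nat \<Rightarrow> symbol \<Rightarrow> symbol" where
  "symP j S = (\<lambda>\<beta>. if j \<in># \<beta> \<and> (p < j \<longrightarrow> count \<beta> j = 1)
     then lsign j \<beta> *\<^sub>R flip (par' j) (S (\<beta> - {#j#})) else 0)"

definition symI :: "nat \<Rightarrow> symbol \<Rightarrow> symbol" where
  "symI j S = (\<lambda>\<beta>. ((real (count \<beta> j) + 1) * lsign j \<beta>) *\<^sub>R flip (par' j) (S (add_mset j \<beta>)))"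

text \<open>The function \<phi>(N) of the degree operator N. Coefficients depending on the degree of
  a symbol become operators of this kind, and moving them past an operator that changes the degree
  shifts the argument of \<open>\<phi>\<close>.\<close>

definition degscale :: "(nat \<Rightarrow> real) \<Rightarrow> symbol \<Rightarrow> symbol" where
  "degscale \<phi> S = (\<lambda>\<beta>. \<phi> (size \<beta>) *\<^sub>R S \<beta>)"

definition sing :: "nat multiset \<Rightarrow> sfun \<Rightarrow> symbol" where
  "sing \<alpha> f = (\<lambda>\<beta>. if \<beta> = \<alpha> then f else 0)"

lemma tens_mono_e: "f \<otimes>\<^sub>s mono_e \<alpha> = sing \<alpha> f"
  by (rule ext) (simp add: tens_def mono_e_def sing_def)

lemma tens_scaleR: "f \<otimes>\<^sub>s (c *\<^sub>R v) = c *\<^sub>R (f \<otimes>\<^sub>s v)"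
  by (rule ext) (simp add: tens_def fun_apply)

lemma tens_add: "f \<otimes>\<^sub>s (v + w) = (f \<otimes>\<^sub>s v) + (f \<otimes>\<^sub>s w)"
  by (rule ext) (simp add: tens_def fun_apply scaleR_add_left)

lemma tens_zero [simp]: "f \<otimes>\<^sub>s 0 = 0" "0 \<otimes>\<^sub>s v = 0"
  by (rule ext, simp add: tens_def fun_apply)+

lemma tens_scaleR_left: "(c *\<^sub>R f) \<otimes>\<^sub>s v = c *\<^sub>R (f \<otimes>\<^sub>s v)"
  by (rule ext) (simp add: tens_def fun_apply scaleR_left_commute)

lemma tens_add_left: "(f + g) \<otimes>\<^sub>s v = (f \<otimes>\<^sub>s v) + (g \<otimes>\<^sub>s v)"
  by (rule ext) (simp add: tens_def fun_apply scaleR_add_right)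

lemma tens_sum_left: "(\<Sum>i\<in>A. f i) \<otimes>\<^sub>s v = (\<Sum>i\<in>A. f i \<otimes>\<^sub>s v)"
  by (induction A rule: infinite_finite_induct) (simp_all add: tens_add_left)

subsection \<open>Closure and linearity\<close>

lemma midx_empty [simp]: "{#} \<in> midx p q"
  by (simp add: midx_def)

lemma midx_mono: "\<alpha> \<subseteq># \<beta> \<Longrightarrow> \<beta> \<in> midx p q \<Longrightarrow> \<alpha> \<in> midx p q"
  unfolding midx_def mem_Collect_eq
  by (meson mset_subset_eq_count order_trans set_mset_mono)

lemma symbolsI:
  "finite {\<alpha>. S \<alpha> \<noteq> 0} \<Longrightarrow> (\<And>\<alpha>. S \<alpha> \<in> F) \<Longrightarrow> (\<And>\<alpha>. S \<alpha> \<noteq> 0 \<Longrightarrow> \<alpha> \<in> midx p q) \<Longrightarrow> S \<in> V"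
  by (auto simp: symbols_def)

lemma symbols_finite: "S \<in> V \<Longrightarrow> finite {\<alpha>. S \<alpha> \<noteq> 0}"
  and symbols_sfuns [simp]: "S \<in> V \<Longrightarrow> S \<alpha> \<in> F"
  and symbols_midx: "S \<in> V \<Longrightarrow> S \<alpha> \<noteq> 0 \<Longrightarrow> \<alpha> \<in> midx p q"
  by (auto simp: symbols_def)

lemma symbols_pointwise:
  assumes "S \<in> V" "\<And>\<alpha>. S \<alpha> = 0 \<Longrightarrow> T \<alpha> = 0" "\<And>\<alpha>. T \<alpha> \<in> F"
  shows "T \<in> V"
proof (rule symbolsI)
  show "finite {\<alpha>. T \<alpha> \<noteq> 0}"
    by (rule finite_subset[OF _ symbols_finite[OF assms(1)]]) (use assms(2) in auto)
qed (use assms(2,3) symbols_midx[OF assms(1)] in auto)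

lemma V_zero [simp]: "0 \<in> V"
  by (rule symbolsI) (simp_all add: fun_apply)

lemma V_add [simp]: "S \<in> V \<Longrightarrow> T \<in> V \<Longrightarrow> S + T \<in> V"
proof (rule symbolsI)
  assume ST: "S \<in> V" "T \<in> V"
  show "finite {\<alpha>. (S + T) \<alpha> \<noteq> 0}"
    by (rule finite_subset[OF _ finite_UnI[OF symbols_finite[OF ST(1)] symbols_finite[OF ST(2)]]])
      (auto simp: fun_apply)
  show "\<alpha> \<in> midx p q" if "(S + T) \<alpha> \<noteq> 0" for \<alpha>
  proof -
    have "S \<alpha> \<noteq> 0 \<or> T \<alpha> \<noteq> 0" using that by (auto simp: fun_apply)
    then show ?thesis using symbols_midx[OF ST(1)] symbols_midx[OF ST(2)] by blast
  qed
qed (simp add: fun_apply)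

lemma V_scaleR [simp]: "S \<in> V \<Longrightarrow> c *\<^sub>R S \<in> V"
  by (rule symbols_pointwise[of S]) (simp_all add: fun_apply)

lemma V_minus [simp]: "S \<in> V \<Longrightarrow> - S \<in> V"
  using V_scaleR[of S "-1"] by simp

lemma V_diff [simp]: "S \<in> V \<Longrightarrow> T \<in> V \<Longrightarrow> S - T \<in> V"
  using V_add[of S "- T"] by simp

lemma V_sum: "(\<And>i. i \<in> A \<Longrightarrow> S i \<in> V) \<Longrightarrow> (\<Sum>i\<in>A. S i) \<in> V"
  by (induction A rule: infinite_finite_induct) auto

lemma V_sing [simp]: "f \<in> F \<Longrightarrow> \<alpha> \<in> midx p q \<Longrightarrow> sing \<alpha> f \<in> V"
  by (rule symbolsI) (auto simp: sing_def)

lemma V_symY [simp]: "S \<in> V \<Longrightarrow> j \<in> idx \<Longrightarrow> symY j S \<in> V"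
  by (rule symbols_pointwise[of S]) (simp_all add: symY_def)

lemma V_symD [simp]: "S \<in> V \<Longrightarrow> j \<in> idx \<Longrightarrow> symD j S \<in> V"
  by (rule symbols_pointwise[of S]) (simp_all add: symD_def)

lemma V_degscale [simp]: "S \<in> V \<Longrightarrow> degscale \<phi> S \<in> V"
  by (rule symbols_pointwise[of S]) (simp_all add: degscale_def)

lemma V_symP [simp]:
  assumes S: "S \<in> V" and j: "j \<in> idx"
  shows "symP j S \<in> V"
proof (rule symbolsI)
  have "\<beta> \<in> add_mset j ` {\<alpha>. S \<alpha> \<noteq> 0}" if "symP j S \<beta> \<noteq> 0" for \<beta>
    using that by (intro image_eqI[of _ _ "\<beta> - {#j#}"]) (auto simp: symP_def split: if_splits)
  then show "finite {\<alpha>. symP j S \<alpha> \<noteq> 0}"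
    by (intro finite_subset[OF _ finite_imageI[OF symbols_finite[OF S]]]) blast
  show "symP j S \<alpha> \<in> F" for \<alpha>
    using S by (simp add: symP_def)
  show "\<beta> \<in> midx p q" if "symP j S \<beta> \<noteq> 0" for \<beta>
  proof -
    have "j \<in># \<beta>" "p < j \<longrightarrow> count \<beta> j = 1" "\<beta> - {#j#} \<in> midx p q"
      using that symbols_midx[OF S] by (auto simp: symP_def split: if_splits)
    moreover from this obtain \<gamma> where "\<beta> = add_mset j \<gamma>" by (metis insert_DiffM)
    ultimately show ?thesis using j by (auto simp: midx_def)
  qed
qed

lemma V_symI [simp]:
  assumes S: "S \<in> V" and j: "j \<in> idx"
  shows "symI j S \<in> V"
proof (rule symbolsI)
  have *: "S (add_mset j \<beta>) \<noteq> 0" if "symI j S \<beta> \<noteq> 0" for \<beta>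
    using that by (auto simp: symI_def)
  then have "\<beta> \<in> (\<lambda>\<alpha>. \<alpha> - {#j#}) ` {\<alpha>. S \<alpha> \<noteq> 0}" if "symI j S \<beta> \<noteq> 0" for \<beta>
    using that by (intro image_eqI[of _ _ "add_mset j \<beta>"]) auto
  then show "finite {\<alpha>. symI j S \<alpha> \<noteq> 0}"
    by (intro finite_subset[OF _ finite_imageI[OF symbols_finite[OF S]]]) blast
  show "symI j S \<alpha> \<in> F" for \<alpha>
    using S by (simp add: symI_def)
  show "\<beta> \<in> midx p q" if "symI j S \<beta> \<noteq> 0" for \<beta>
  proof -
    have "add_mset j \<beta> \<in> midx p q" using * that symbols_midx[OF S] by blast
    then show ?thesis
      by (rule midx_mono[rotated]) simp
  qed
qed

lemma symY_add: "symY j (S + T) = symY j S + symY j T"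
  by (rule ext) (simp add: symY_def fun_apply sprod_add_right)

lemma symY_scaleR: "symY j (c *\<^sub>R S) = c *\<^sub>R symY j S"
  by (rule ext) (simp add: symY_def fun_apply)

lemma symD_add: "S \<in> V \<Longrightarrow> T \<in> V \<Longrightarrow> j \<in> idx \<Longrightarrow> symD j (S + T) = symD j S + symD j T"
  by (rule ext) (simp add: symD_def fun_apply sderiv_add[of _ p q])

lemma symD_scaleR: "S \<in> V \<Longrightarrow> j \<in> idx \<Longrightarrow> symD j (c *\<^sub>R S) = c *\<^sub>R symD j S"
  by (rule ext) (simp add: symD_def fun_apply sderiv_scaleR[of _ p q])

lemma symP_add: "symP j (S + T) = symP j S + symP j T"
  by (rule ext) (auto simp: symP_def fun_apply scaleR_add_right)

lemma symP_scaleR: "symP j (c *\<^sub>R S) = c *\<^sub>R symP j S"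
  by (rule ext) (auto simp: symP_def fun_apply)

lemma symI_add: "symI j (S + T) = symI j S + symI j T"
  by (rule ext) (simp add: symI_def fun_apply scaleR_add_right)

lemma symI_scaleR: "symI j (c *\<^sub>R S) = c *\<^sub>R symI j S"
  by (rule ext) (simp add: symI_def fun_apply)

lemma degscale_add: "degscale \<phi> (S + T) = degscale \<phi> S + degscale \<phi> T"
  by (rule ext) (simp add: degscale_def fun_apply scaleR_add_right)

lemma degscale_scaleR: "degscale \<phi> (c *\<^sub>R S) = c *\<^sub>R degscale \<phi> S"
  by (rule ext) (simp add: degscale_def fun_apply)

lemma symY_zero [simp]: "symY j 0 = 0"
  using symY_scaleR[of j 0 0] by simp

lemma symD_zero [simp]: "symD j 0 = 0"
  by (rule ext) (simp add: symD_def fun_apply)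

lemma symP_zero [simp]: "symP j 0 = 0"
  using symP_scaleR[of j 0 0] by simp

lemma symI_zero [simp]: "symI j 0 = 0"
  using symI_scaleR[of j 0 0] by simp

lemma degscale_zero [simp]: "degscale \<phi> 0 = 0"
  using degscale_scaleR[of \<phi> 0 0] by simp

lemma symY_sum: "symY j (\<Sum>i\<in>A. S i) = (\<Sum>i\<in>A. symY j (S i))"
  by (induction A rule: infinite_finite_induct) (simp_all add: symY_add)

lemma symP_sum: "symP j (\<Sum>i\<in>A. S i) = (\<Sum>i\<in>A. symP j (S i))"
  by (induction A rule: infinite_finite_induct) (simp_all add: symP_add)

lemma symI_sum: "symI j (\<Sum>i\<in>A. S i) = (\<Sum>i\<in>A. symI j (S i))"
  by (induction A rule: infinite_finite_induct) (simp_all add: symI_add)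

lemma degscale_sum: "degscale \<phi> (\<Sum>i\<in>A. S i) = (\<Sum>i\<in>A. degscale \<phi> (S i))"
  by (induction A rule: infinite_finite_induct) (simp_all add: degscale_add)

lemma symD_sum:
  "(\<And>i. i \<in> A \<Longrightarrow> S i \<in> V) \<Longrightarrow> j \<in> idx \<Longrightarrow> symD j (\<Sum>i\<in>A. S i) = (\<Sum>i\<in>A. symD j (S i))"
  by (induction A rule: infinite_finite_induct) (simp_all add: symD_add V_sum)

subsection \<open>Canonical relations\<close>

lemma lsign_square [simp]: "lsign j \<alpha> * lsign j \<alpha> = 1" "lsign j \<alpha> * (lsign j \<alpha> * c) = c"
  by (simp_all add: lsign_def flip: mult.assoc)

lemma lsign_neq_0 [simp]: "lsign j \<alpha> \<noteq> 0"
  by (simp add: lsign_def)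

lemma lsign_even: "j \<le> p \<Longrightarrow> lsign j \<alpha> = 1"
  by (simp add: lsign_def par_def)

lemma lsign_add_mset: "lsign i (add_mset j \<alpha>) = (if j < i then \<sigma> i j else 1) * lsign i \<alpha>"
  by (auto simp: lsign_def sg_def par_def)

lemma lsign_add_mset_self [simp]: "lsign j (add_mset j \<alpha>) = lsign j \<alpha>"
  by (simp add: lsign_add_mset)

lemma lsign_remove_self [simp]: "lsign j (\<alpha> - {#j#}) = lsign j \<alpha>"
  by (cases "j \<in># \<alpha>") (metis insert_DiffM lsign_add_mset_self, simp add: diff_single_trivial)

text \<open>\<open>symI\<close> evaluates a symbol at multi-indices with one more factor, possibly a
  second copy of an odd one; there the symbol vanishes.\<close>

lemma odd_repeated:
  assumes "S \<in> V" "p < j" "2 \<le> count \<alpha> j"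
  shows "S \<alpha> = 0"
proof (rule ccontr)
  assume "S \<alpha> \<noteq> 0"
  from symbols_midx[OF assms(1) this] assms(2) have "count \<alpha> j \<le> 1" by (simp add: midx_def)
  then show False using assms(3) by simp
qed

lemma flip_par_flip_par: "flip (par' i) (flip (par' j) f) = flip (par' j) (flip (par' i) f)"
  by (simp add: flip_flip add.commute)

lemma symYY: "symY i (symY j S) = \<sigma> i j *\<^sub>R symY j (symY i S)"
  by (rule ext) (simp add: symY_def fun_apply coord_sprod_commute[of p i j])

lemma symDD: "S \<in> V \<Longrightarrow> i \<in> idx \<Longrightarrow> j \<in> idx \<Longrightarrow> symD i (symD j S) = \<sigma> i j *\<^sub>R symD j (symD i S)"
  by (rule ext) (simp add: symD_def fun_apply sderiv_commute[of _ p q i j])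

lemma symDY: "S \<in> V \<Longrightarrow> i \<in> idx \<Longrightarrow> j \<in> idx \<Longrightarrow>
    symD i (symY j S) = \<sigma> i j *\<^sub>R symY j (symD i S) + (if i = j then S else 0)"
  by (rule ext) (simp add: symD_def symY_def fun_apply sderiv_coord_sprod[of _ p q i j])

lemma symDP: "S \<in> V \<Longrightarrow> i \<in> idx \<Longrightarrow> symD i (symP j S) = \<sigma> i j *\<^sub>R symP j (symD i S)"
  by (rule ext)
    (auto simp: symD_def symP_def fun_apply flip_sderiv[of _ p q] sderiv_scaleR[of _ p q] sg_def mult.commute)

lemma symDI: "S \<in> V \<Longrightarrow> i \<in> idx \<Longrightarrow> symD i (symI j S) = \<sigma> i j *\<^sub>R symI j (symD i S)"
  by (rule ext)
    (simp add: symD_def symI_def fun_apply flip_sderiv[of _ p q] sderiv_scaleR[of _ p q] sg_def mult.commute)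

lemma symPY: "symP j (symY i S) = \<sigma> i j *\<^sub>R symY i (symP j S)"
  by (rule ext)
    (auto simp: symY_def symP_def fun_apply flip_sprod flip_coord sg_def mult.commute)

lemma symIY: "symI j (symY i S) = \<sigma> i j *\<^sub>R symY i (symI j S)"
  by (rule ext)
    (simp add: symY_def symI_def fun_apply flip_sprod flip_coord sg_def mult.commute)

text \<open>For distinct indices only the \<open>lsign\<close> of the larger one notices the
  presence of the smaller one, which gives exactly one factor \<open>\<sigma> i j\<close>. For equal
  odd indices both sides are zero.\<close>

lemma symPP: "symP i (symP j S) = \<sigma> i j *\<^sub>R symP j (symP i S)"
proof
  fix \<beta>
  show "symP i (symP j S) \<beta> = (\<sigma> i j *\<^sub>R symP j (symP i S)) \<beta>"
  proof (cases "i = j")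
    case True
    then show ?thesis
      by (cases "p < j") (auto simp: symP_def fun_apply sg_def par_def in_diff_count)
  next
    case False
    show ?thesis
    proof (cases "i \<in># \<beta> \<and> j \<in># \<beta>")
      case True
      with False obtain \<gamma> where \<beta>: "\<beta> = add_mset i (add_mset j \<gamma>)"
        by (metis insert_DiffM insert_noteq_member)
      have r: "add_mset i (add_mset j \<gamma>) - {#j#} = add_mset i \<gamma>"
        by (simp add: add_mset_commute)
      have l: "lsign i (add_mset i (add_mset j \<gamma>)) * lsign j (add_mset j \<gamma>) =
        \<sigma> i j * (lsign j (add_mset i (add_mset j \<gamma>)) * lsign i (add_mset i \<gamma>))"
        using False by (simp add: lsign_add_mset sg_commute[of p i j])
      show ?thesis
        using False unfolding \<beta>
        by (auto simp: symP_def fun_apply r l flip_par_flip_par[of i j] count_eq_zero_iff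
            simp del: lsign_add_mset_self)
    next
      case nin: False
      then show ?thesis using False by (auto simp: symP_def fun_apply in_diff_count)
    qed
  qed
qed

lemma symII: "S \<in> V \<Longrightarrow> symI i (symI j S) = \<sigma> i j *\<^sub>R symI j (symI i S)"
proof
  fix \<beta>
  assume S: "S \<in> V"
  show "symI i (symI j S) \<beta> = (\<sigma> i j *\<^sub>R symI j (symI i S)) \<beta>"
  proof (cases "i = j")
    case True
    show ?thesis
    proof (cases "p < j")
      case odd: True
      have "S (add_mset j (add_mset j \<beta>)) = 0"
        by (rule odd_repeated[OF S odd]) simp
      then show ?thesis using True by (simp add: symI_def fun_apply)
    qed (simp add: True sg_def par_def fun_apply)
  next
    case False
    have "lsign i \<beta> * lsign j (add_mset i \<beta>) = \<sigma> i j * (lsign j \<beta> * lsign i (add_mset j \<beta>))"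
      using False by (simp add: lsign_add_mset sg_commute[of p i j])
    then show ?thesis
      using False
      by (simp add: symI_def fun_apply flip_par_flip_par[of i j] add_mset_commute[of i j] algebra_simps)
  qed
qed

text \<open>For equal even indices the identity is (n + 1) - n = 1 with n the multiplicity of
  \<open>j\<close>. For equal odd indices and n = 0 or n = 1 exactly one of the two products is
  nonzero and reproduces \<open>S\<close>; for larger n everything vanishes. For distinct indices
  only signs are compared.\<close>

lemma symIP: "S \<in> V \<Longrightarrow> symI i (symP j S) = \<sigma> i j *\<^sub>R symP j (symI i S) + (if i = j then S else 0)"
proof
  fix \<beta>
  assume S: "S \<in> V"
  show "symI i (symP j S) \<beta> = (\<sigma> i j *\<^sub>R symP j (symI i S) + (if i = j then S else 0)) \<beta>"
  proof (cases "i = j")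
    case [simp]: True
    show ?thesis
    proof (cases "p < j")
      case odd: True
      then have [simp]: "par' j = 1" "\<sigma> j j = -1" by (simp_all add: par_def sg_def)
      consider "count \<beta> j = 0" | "count \<beta> j = 1" | "2 \<le> count \<beta> j" by linarith
      then show ?thesis
      proof cases
        case 1
        then have "j \<notin># \<beta>" by (simp add: not_in_iff)
        then show ?thesis using 1 odd by (simp add: symI_def symP_def fun_apply)
      next
        case 2
        then have "j \<in># \<beta>" by (simp flip: count_greater_zero_iff)
        then show ?thesis using 2 odd by (simp add: symI_def symP_def fun_apply)
      next
        case 3
        then show ?thesis using odd odd_repeated[OF S odd 3]
          by (simp add: symI_def symP_def fun_apply)
      qed
    next
      case False
      then have [simp]: "par' j = 0" "\<sigma> j j = 1" by (simp_all add: par_def sg_def)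
      show ?thesis using False
        by (cases "j \<in># \<beta>")
          (auto simp: symI_def symP_def fun_apply lsign_even scaleR_add_left scaleR_diff_left
            count_eq_zero_iff of_nat_diff Suc_le_eq)
    qed
  next
    case False
    show ?thesis
    proof (cases "j \<in># \<beta>")
      case True
      then obtain \<gamma> where \<beta>: "\<beta> = add_mset j \<gamma>" by (metis insert_DiffM)
      have r: "add_mset i (add_mset j \<gamma>) - {#j#} = add_mset i \<gamma>"
        by (simp add: add_mset_commute)
      have l: "lsign i (add_mset j \<gamma>) * lsign j (add_mset i (add_mset j \<gamma>)) =
        \<sigma> i j * (lsign j (add_mset j \<gamma>) * lsign i \<gamma>)"
        using False by (simp add: lsign_add_mset sg_commute[of p i j])
      show ?thesis
        using False unfolding \<beta>
        by (simp add: symP_def symI_def fun_apply r flip_par_flip_par[of i j] del: lsign_add_mset_self)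
          (use l in \<open>auto simp: algebra_simps count_eq_zero_iff\<close>)
    next
      case nin: False
      then show ?thesis using False by (auto simp: symP_def symI_def fun_apply)
    qed
  qed
qed

lemma symPI_self:
  assumes S: "S \<in> V"
  shows "symP j (symI j S) = (\<lambda>\<beta>. real (count \<beta> j) *\<^sub>R S \<beta>)"
proof
  fix \<beta>
  show "symP j (symI j S) \<beta> = real (count \<beta> j) *\<^sub>R S \<beta>"
  proof (cases "j \<in># \<beta> \<and> (p < j \<longrightarrow> count \<beta> j = 1)")
    case True
    then show ?thesis by (simp add: symP_def symI_def of_nat_diff Suc_le_eq)
  next
    case False
    then have "count \<beta> j = 0 \<or> p < j \<and> 2 \<le> count \<beta> j"
      using count_greater_zero_iff[of \<beta> j]
      by (auto simp: count_eq_zero_iff simp del: count_greater_zero_iff)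
    then consider "count \<beta> j = 0" | "p < j" "2 \<le> count \<beta> j" by linarith
    then show ?thesis
      using False odd_repeated[OF S, of j \<beta>] by cases (auto simp: symP_def)
  qed
qed

text \<open>Euler's identity: each summand multiplies a monomial by the multiplicity of one index,
  and the multiplicities add up to the degree.\<close>

lemma sum_symPI:
  assumes S: "S \<in> V"
  shows "(\<Sum>j\<in>idx. symP j (symI j S)) = degscale real S"
proof
  fix \<beta>
  have "(\<Sum>j\<in>idx. symP j (symI j S)) \<beta> = (\<Sum>j\<in>idx. real (count \<beta> j)) *\<^sub>R S \<beta>"
    by (simp add: sum_fun_apply symPI_self[OF S] scaleR_sum_left)
  also have "\<dots> = degscale real S \<beta>"
  proof (cases "S \<beta> = 0")
    case False
    then have "set_mset \<beta> \<subseteq> idx" using symbols_midx[OF S] by (auto simp: midx_def)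
    then have "(\<Sum>j\<in>idx. count \<beta> j) = size \<beta>"
      unfolding size_multiset_overloaded_eq
      by (intro sum.mono_neutral_right) (auto simp: not_in_iff)
    then show ?thesis by (simp add: degscale_def flip: of_nat_sum)
  qed (simp add: degscale_def)
  finally show "(\<Sum>j\<in>idx. symP j (symI j S)) \<beta> = degscale real S \<beta>" .
qed

lemma symI_degscale: "symI j (degscale \<phi> S) = degscale (\<lambda>m. \<phi> (Suc m)) (symI j S)"
  by (rule ext) (simp add: symI_def degscale_def algebra_simps)

lemma symY_degscale: "symY j (degscale \<phi> S) = degscale \<phi> (symY j S)"
  by (rule ext) (simp add: symY_def degscale_def)

lemma symD_degscale: "S \<in> V \<Longrightarrow> j \<in> idx \<Longrightarrow> symD j (degscale \<phi> S) = degscale \<phi> (symD j S)"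
  by (rule ext) (simp add: symD_def degscale_def sderiv_scaleR[of _ p q])

text \<open>The shift stands on the left so that the rule undoes the one of
  \<open>symI_degscale\<close>: a product of \<open>symP\<close> with \<open>symI\<close> then
  commutes with every \<open>degscale \<phi>\<close> by rewriting.\<close>

lemma symP_degscale: "symP j (degscale (\<lambda>m. \<phi> (Suc m)) S) = degscale \<phi> (symP j S)"
  by (rule ext) (auto simp: symP_def degscale_def size_Diff_singleton Suc_diff_1 nonempty_has_size
      dest!: size_Suc_Diff1)

lemma degscale_degscale: "degscale \<phi> (degscale \<psi> S) = degscale (\<lambda>m. \<phi> m * \<psi> m) S"
  by (rule ext) (simp add: degscale_def)

subsection \<open>Decomposition into monomials\<close>

lemma sing_zero [simp]: "sing \<alpha> 0 = 0"
  by (rule ext) (simp add: sing_def fun_apply)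

lemma sing_scaleR: "sing \<alpha> (c *\<^sub>R f) = c *\<^sub>R sing \<alpha> f"
  by (rule ext) (simp add: sing_def fun_apply)

lemma symbols_decompose:
  assumes "finite A" "{\<alpha>. S \<alpha> \<noteq> 0} \<subseteq> A"
  shows "S = (\<Sum>\<alpha>\<in>A. sing \<alpha> (S \<alpha>))"
proof
  fix \<beta>
  have "(\<Sum>\<alpha>\<in>A. sing \<alpha> (S \<alpha>)) \<beta> = (\<Sum>\<alpha>\<in>A. if \<beta> = \<alpha> then S \<alpha> else 0)"
    by (simp add: sum_fun_apply sing_def)
  also have "\<dots> = S \<beta>"
    using assms by auto
  finally show "S \<beta> = (\<Sum>\<alpha>\<in>A. sing \<alpha> (S \<alpha>)) \<beta>" by simp
qed

lemma symbols_induct [consumes 1, case_names sing add]: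
  assumes S: "S \<in> V"
    and sing: "\<And>\<alpha> f. \<alpha> \<in> midx p q \<Longrightarrow> f \<in> F \<Longrightarrow> P (sing \<alpha> f)"
    and add: "\<And>S T. S \<in> V \<Longrightarrow> T \<in> V \<Longrightarrow> P S \<Longrightarrow> P T \<Longrightarrow> P (S + T)"
  shows "P S"
proof -
  have "{#} \<in> midx p q" by (simp add: midx_def)
  then have "P 0" using sing[of "{#}" 0] by simp
  have "(\<Sum>\<alpha>\<in>A. sing \<alpha> (S \<alpha>)) \<in> V \<and> P (\<Sum>\<alpha>\<in>A. sing \<alpha> (S \<alpha>))" if "finite A" "A \<subseteq> {\<alpha>. S \<alpha> \<noteq> 0}" for A
    using that
  proof (induction A)
    case empty
    then show ?case using \<open>P 0\<close> by simp
  next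
    case (insert \<alpha> A)
    then have "\<alpha> \<in> midx p q" using symbols_midx[OF S] by auto
    then show ?case using insert S by (simp add: sing add)
  qed
  from this[of "{\<alpha>. S \<alpha> \<noteq> 0}"] show ?thesis
    using symbols_decompose[of "{\<alpha>. S \<alpha> \<noteq> 0}" S] symbols_finite[OF S] by simp
qed

lemma symY_sing: "symY j (sing \<alpha> f) = sing \<alpha> (coord p j \<odot> f)"
  by (rule ext) (simp add: symY_def sing_def)

lemma symD_sing: "symD j (sing \<alpha> f) = sing \<alpha> (sderiv p j f)"
  by (rule ext) (simp add: symD_def sing_def)

lemma symP_sing: "symP j (sing \<alpha> f) =
    (if p < j \<and> j \<in># \<alpha> then 0 else sing (add_mset j \<alpha>) (lsign j \<alpha> *\<^sub>R flip (par' j) f))"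
proof
  fix \<beta>
  show "symP j (sing \<alpha> f) \<beta> =
    (if p < j \<and> j \<in># \<alpha> then 0 else sing (add_mset j \<alpha>) (lsign j \<alpha> *\<^sub>R flip (par' j) f)) \<beta>"
  proof (cases "\<beta> = add_mset j \<alpha>")
    case True
    then show ?thesis by (auto simp: symP_def sing_def fun_apply count_eq_zero_iff)
  next
    case False
    then have "j \<in># \<beta> \<Longrightarrow> \<beta> - {#j#} \<noteq> \<alpha>" by (metis insert_DiffM)
    then show ?thesis using False by (auto simp: symP_def sing_def fun_apply)
  qed
qed

lemma symI_sing: "symI j (sing \<alpha> f) =
    sing (\<alpha> - {#j#}) ((real (count \<alpha> j) * lsign j \<alpha>) *\<^sub>R flip (par' j) f)"
proof
  fix \<beta>
  show "symI j (sing \<alpha> f) \<beta> =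
    sing (\<alpha> - {#j#}) ((real (count \<alpha> j) * lsign j \<alpha>) *\<^sub>R flip (par' j) f) \<beta>"
  proof (cases "j \<in># \<alpha>")
    case True
    then obtain \<gamma> where "\<alpha> = add_mset j \<gamma>" by (metis insert_DiffM)
    then show ?thesis by (auto simp: symI_def sing_def)
  next
    case False
    then have "add_mset j \<beta> \<noteq> \<alpha>" "count \<alpha> j = 0" by (auto simp: not_in_iff)
    then show ?thesis by (simp add: symI_def sing_def)
  qed
qed

text \<open>Every monomial symbol arises from one of degree zero by left products, taken in increasing order
  of the factors so that no sign occurs.\<close>

lemma sing_eq_symP:
  assumes "\<alpha> \<in> midx p q" "\<alpha> \<noteq> {#}"
  defines "j \<equiv> Min (set_mset \<alpha>)"
  shows "sing \<alpha> f = symP j (sing (\<alpha> - {#j#}) (flip (par' j) f))" "j \<in># \<alpha>" "j \<in> idx"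
proof -
  show j: "j \<in># \<alpha>" using assms by (simp add: j_def)
  then show "j \<in> idx" using assms(1) by (auto simp: midx_def)
  have "lsign j (\<alpha> - {#j#}) = 1"
  proof -
    have "\<not> l < j" if "l \<in># \<alpha>" for l
      using that by (simp add: j_def not_less)
    then have "{#l \<in># \<alpha>. p < l \<and> l < j#} = {#}" by (auto intro: multiset_eqI simp: not_in_iff[symmetric])
    then have "lsign j \<alpha> = 1" unfolding lsign_def by (simp only: size_empty) simp
    then show ?thesis by simp
  qed
  moreover have "j \<notin># \<alpha> - {#j#}" if "p < j"
    using assms(1) that by (auto simp: midx_def in_diff_count dest!: spec[of _ j])
  ultimately show "sing \<alpha> f = symP j (sing (\<alpha> - {#j#}) (flip (par' j) f))"
    using j by (auto simp: symP_sing)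
qed

end

section \<open>Words in the basis vectors\<close>

lemma vee_move_front:
  "vee p (u @ j # v) = (-1) ^ (par p j * sum_list (map (par p) u)) *\<^sub>R vee p (j # u @ v)"
proof (induction u arbitrary: v rule: rev_induct)
  case (snoc x u)
  have "vee p ((u @ [x]) @ j # v) = (-1) ^ (par p x * par p j) *\<^sub>R vee p (u @ j # x # v)"
    using vee_swap[of p u x j v] by simp
  also have "vee p (u @ j # x # v) = (-1) ^ (par p j * sum_list (map (par p) u)) *\<^sub>R vee p (j # u @ x # v)"
    by (rule snoc)
  finally show ?case by (simp add: power_add algebra_simps)
qed simp

lemma sum_par_nth: "m \<le> length w \<Longrightarrow> (\<Sum>n<m. par p (w ! n)) = sum_list (map (par p) (take m w))"
  by (simp add: sum_list_sum_nth atLeast0LessThan)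

lemma sum_list_par: "sum_list (map (par p) w) = length (filter (\<lambda>l. p < l) w)"
  by (induction w) (auto simp: par_def)

context superspace
begin

abbreviation word :: "nat multiset \<Rightarrow> nat list" where
  "word \<alpha> \<equiv> sorted_list_of_multiset \<alpha>"

lemma vee_word: "\<alpha> \<in> midx p q \<Longrightarrow> vee p (word \<alpha>) = mono_e \<alpha>"
  by (rule vee_sorted)

lemma remove_nth_word:
  assumes "m < length (word \<alpha>)" "word \<alpha> ! m = j"
  shows "take m (word \<alpha>) @ drop (Suc m) (word \<alpha>) = word (\<alpha> - {#j#})"
proof -
  let ?w = "word \<alpha>" and ?v = "take m (word \<alpha>) @ drop (Suc m) (word \<alpha>)"
  have w: "?w = take m ?w @ j # drop (Suc m) ?w"
    using assms id_take_nth_drop by metis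
  have "sorted (take m ?w @ j # drop (Suc m) ?w)"
    by (subst w[symmetric]) simp
  then have "sorted ?v"
    by (auto simp: sorted_append)
  moreover have "mset ?v = \<alpha> - {#j#}"
  proof -
    have "\<alpha> = mset (take m ?w @ j # drop (Suc m) ?w)"
      by (subst w[symmetric]) simp
    also have "\<dots> = add_mset j (mset ?v)" by simp
    finally show ?thesis by (metis add_mset_remove_trivial)
  qed
  ultimately show ?thesis
    by (metis sorted_sort_id sorted_list_of_multiset_mset)
qed

text \<open>An odd index occurs once in a sorted word, so everything before it is strictly smaller,
  and the odd factors before it are those counted by \<open>lsign\<close>.\<close>

lemma sign_before_nth:
  assumes "\<alpha> \<in> midx p q" "m < length (word \<alpha>)" "word \<alpha> ! m = j"
  shows "(-1) ^ (par' j * (\<Sum>n<m. par' (word \<alpha> ! n))) = lsign j \<alpha>"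
proof (cases "p < j")
  case True
  let ?w = "word \<alpha>"
  have w: "?w = take m ?w @ j # drop (Suc m) ?w"
    using assms id_take_nth_drop by metis
  have "sorted (take m ?w @ j # drop (Suc m) ?w)"
    by (subst w[symmetric]) simp
  then have s: "l \<in> set (take m ?w) \<Longrightarrow> l \<le> j" "l \<in> set (drop (Suc m) ?w) \<Longrightarrow> j \<le> l" for l
    by (simp_all add: sorted_append)
  have "count (mset (take m ?w @ j # drop (Suc m) ?w)) j \<le> 1"
    using assms(1) True by (subst w[symmetric]) (simp add: midx_def)
  then have "count (mset (take m ?w)) j = 0" by simp
  then have "j \<notin> set (take m ?w)"
    by (metis count_eq_zero_iff set_mset_mset)
  with s(1) have lt: "\<And>l. l \<in> set (take m ?w) \<Longrightarrow> l < j" by (metis le_neq_implies_less)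
  have "size {#l \<in># \<alpha>. p < l \<and> l < j#} = length (filter (\<lambda>l. p < l \<and> l < j) ?w)"
    by (metis mset_filter mset_sorted_list_of_multiset size_mset)
  also have "\<dots> = length (filter (\<lambda>l. p < l \<and> l < j) (take m ?w @ j # drop (Suc m) ?w))"
    by (subst w[symmetric]) simp
  also have "\<dots> = length (filter (\<lambda>l. p < l \<and> l < j) (take m ?w)) + length (filter (\<lambda>l. p < l \<and> l < j) (drop (Suc m) ?w))"
    by simp
  also have "filter (\<lambda>l. p < l \<and> l < j) (drop (Suc m) ?w) = []"
    using s(2) by (auto simp: filter_empty_conv not_less)
  also have "filter (\<lambda>l. p < l \<and> l < j) (take m ?w) = filter (\<lambda>l. p < l) (take m ?w)"
    using lt by (intro filter_cong) auto
  finally show ?thesis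
    using assms(2) by (simp add: lsign_def sum_par_nth sum_list_par)
qed (simp add: lsign_even par_def)

lemma sum_nth_eq_count:
  "(\<Sum>m<length (word \<alpha>). if word \<alpha> ! m = j then c else 0) = real (count \<alpha> j) *\<^sub>R (c :: 'a :: real_vector)"
proof -
  have "(\<Sum>m<length (word \<alpha>). if word \<alpha> ! m = j then c else 0) = (\<Sum>m\<in>{m. m < length (word \<alpha>) \<and> word \<alpha> ! m = j}. c)"
    by (rule sum.mono_neutral_cong_right) auto
  also have "\<dots> = real (card {m. m < length (word \<alpha>) \<and> word \<alpha> ! m = j}) *\<^sub>R c"
    by (simp add: sum_constant_scaleR)
  also have "card {m. m < length (word \<alpha>) \<and> word \<alpha> ! m = j} = count \<alpha> j"
  proof -
    have "count (mset (word \<alpha>)) j = length (filter (\<lambda>l. l = j) (word \<alpha>))"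
      unfolding count_mset count_list_eq_length_filter
      by (intro arg_cong[of _ _ length] filter_cong) auto
    then show ?thesis by (simp add: length_filter_conv_card)
  qed
  finally show ?thesis .
qed

text \<open>Every occurrence of \<open>j\<close> yields the same shorter monomial with the same
  sign, so the sum over positions is a multiplicity.\<close>

lemma interior_word_eps:
  assumes "\<alpha> \<in> midx p q"
  shows "interior_word p (eps j) (word \<alpha>) = (real (count \<alpha> j) * lsign j \<alpha>) *\<^sub>R mono_e (\<alpha> - {#j#})"
proof -
  let ?w = "word \<alpha>"
  have "interior_word p (eps j) ?w = (\<Sum>m<length ?w. \<Sum>a\<in>{0,1}.
     ((-1) ^ (a * (\<Sum>n<m. par p (?w ! n))) * (if par p (?w ! m) = a then eps j (?w ! m) else 0))
       *\<^sub>R vee p (take m ?w @ drop (Suc m) ?w))"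
    unfolding interior_word_def by (rule sum.swap)
  also have "\<dots> = (\<Sum>m<length ?w. if ?w ! m = j then lsign j \<alpha> *\<^sub>R mono_e (\<alpha> - {#j#}) else 0)"
  proof (rule sum.cong)
    fix m assume "m \<in> {..<length ?w}"
    then have m: "m < length ?w" by simp
    show "(\<Sum>a\<in>{0,1}. ((-1) ^ (a * (\<Sum>n<m. par p (?w ! n))) * (if par p (?w ! m) = a then eps j (?w ! m) else 0))
       *\<^sub>R vee p (take m ?w @ drop (Suc m) ?w)) =
       (if ?w ! m = j then lsign j \<alpha> *\<^sub>R mono_e (\<alpha> - {#j#}) else 0)"
    proof (cases "?w ! m = j")
      case True
      have v: "vee p (take m ?w @ drop (Suc m) ?w) = mono_e (\<alpha> - {#j#})"
        using remove_nth_word[OF m True] vee_word[OF midx_mono[OF diff_subset_eq_self assms]] by simp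
      have s: "(-1) ^ (par' j * (\<Sum>n<m. par' (?w ! n))) = lsign j \<alpha>"
        by (rule sign_before_nth[OF assms m True])
      show ?thesis
        unfolding v True s[symmetric] using par_cases[of p j]
        by (elim disjE conjE) (simp_all add: eps_def)
    next
      case False
      then show ?thesis by (simp add: eps_def)
    qed
  qed simp
  finally show ?thesis by (simp add: sum_nth_eq_count)
qed

text \<open>The row \<open>eps j\<close> is homogeneous, so a single parity \<open>a\<close>
  contributes; the remaining sum over the parity of the coefficient is a
  \<open>flip\<close>.\<close>

lemma interior_prod_eps:
  assumes S: "S \<in> V"
  shows "interior_prod p (eps j) S = symI j S"
proof -
  have z: "interior_word p (\<lambda>i. 0) w = 0" for w
    by (simp add: interior_word_def)
  have "interior_prod p (eps j) S = (\<Sum>\<alpha> | S \<alpha> \<noteq> 0. symI j (sing \<alpha> (S \<alpha>)))"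
    unfolding interior_prod_def
  proof (rule sum.cong)
    fix \<alpha> assume "\<alpha> \<in> {\<alpha>. S \<alpha> \<noteq> 0}"
    then have \<alpha>: "\<alpha> \<in> midx p q" using symbols_midx[OF S] by simp
    have h: "(\<lambda>i. if par' i = a then eps j i else 0) = (if a = par' j then eps j else (\<lambda>i. 0))" for a
      by (auto simp: eps_def)
    have "(\<Sum>a\<in>{0,1}. \<Sum>b\<in>{0,1}. (-1) ^ (a * b) *\<^sub>R (hpart b (S \<alpha>) \<otimes>\<^sub>s
        interior_word p (\<lambda>i. if par p i = a then eps j i else 0) (word \<alpha>))) =
      (\<Sum>b\<in>{0,1}. (-1) ^ (par' j * b) *\<^sub>R (hpart b (S \<alpha>) \<otimes>\<^sub>s interior_word p (eps j) (word \<alpha>)))"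
      unfolding h using par_cases[of p j] by (elim disjE conjE) (simp_all add: z)
    also have "\<dots> = (\<Sum>b\<in>{0,1}. (-1) ^ (par' j * b) *\<^sub>R hpart b (S \<alpha>)) \<otimes>\<^sub>s interior_word p (eps j) (word \<alpha>)"
      by (simp only: tens_sum_left tens_scaleR_left)
    also have "\<dots> = flip (par' j) (S \<alpha>) \<otimes>\<^sub>s interior_word p (eps j) (word \<alpha>)"
      unfolding flip_eq_sum_hpart ..
    also have "\<dots> = symI j (sing \<alpha> (S \<alpha>))"
      by (simp add: interior_word_eps[OF \<alpha>] tens_scaleR tens_mono_e symI_sing sing_scaleR)
    finally show "(\<Sum>a\<in>{0,1}. \<Sum>b\<in>{0,1}. (-1) ^ (a * b) *\<^sub>R (hpart b (S \<alpha>) \<otimes>\<^sub>s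
        interior_word p (\<lambda>i. if par p i = a then eps j i else 0) (word \<alpha>))) = symI j (sing \<alpha> (S \<alpha>))" .
  qed simp
  also have "\<dots> = symI j S"
    unfolding symI_sum[symmetric] symbols_decompose[OF symbols_finite[OF S] order_refl, symmetric] ..
  finally show ?thesis .
qed

lemma sym_div_eq:
  assumes S: "S \<in> V"
  shows "sym_div p q S = (\<Sum>j\<in>idx. \<epsilon> j *\<^sub>R symI j (symD j S))"
  unfolding sym_div_def symD_def[symmetric]
  by (intro sum.cong refl) (simp add: interior_prod_eps S)

lemma vee_Cons_word:
  assumes "\<alpha> \<in> midx p q" "j \<in> idx"
  shows "vee p (j # word \<alpha>) = (if p < j \<and> j \<in># \<alpha> then 0 else lsign j \<alpha> *\<^sub>R mono_e (add_mset j \<alpha>))"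
proof -
  have inv: "odd_inversions p w = 0" if "sorted w" for w
    using that by (induction w) (auto simp: filter_empty_conv)
  have "length (filter (\<lambda>l. p < l \<and> l < j) (word \<alpha>)) = size {#l \<in># \<alpha>. p < l \<and> l < j#}"
    by (metis mset_filter mset_sorted_list_of_multiset size_mset)
  then have "(-1) ^ odd_inversions p (j # word \<alpha>) = lsign j \<alpha>"
    by (simp add: inv lsign_def par_def)
  moreover have "(\<forall>i>p. count (mset (j # word \<alpha>)) i \<le> 1) \<longleftrightarrow> \<not> (p < j \<and> j \<in># \<alpha>)"
  proof
    assume *: "\<forall>i>p. count (mset (j # word \<alpha>)) i \<le> 1"
    show "\<not> (p < j \<and> j \<in># \<alpha>)"
      using *[rule_format, of j] by (auto simp: not_in_iff)
  next
    assume "\<not> (p < j \<and> j \<in># \<alpha>)"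
    then show "\<forall>i>p. count (mset (j # word \<alpha>)) i \<le> 1"
      using assms(1) by (auto simp: midx_def not_in_iff)
  qed
  ultimately show ?thesis by (simp only: vee_def) simp
qed

text \<open>The elementary matrix acts as p_j \<iota>_i. With s the parity of the factors before
  position \<open>m\<close>, the matrix contributes the exponent (par i + par j) s and moving e_j to
  the front contributes par j s; what remains, par i s, is the sign of the interior product. The
  \<open>flip\<close> on the left accounts for the twists contained in \<open>symI\<close> and
  \<open>symP\<close>.\<close>

lemma rho_word_elem_mat:
  assumes \<alpha>: "\<alpha> \<in> midx p q" and ij: "i \<in> idx" "j \<in> idx"
  shows "flip (par' i + par' j) f \<otimes>\<^sub>s rho_word p q (elem_mat i j) (word \<alpha>) = symP j (symI i (sing \<alpha> f))"
proof -
  let ?w = "word \<alpha>"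
  define v where "v = (if p < j \<and> j \<in># \<alpha> - {#i#} then 0
    else (lsign i \<alpha> * lsign j (\<alpha> - {#i#})) *\<^sub>R mono_e (add_mset j (\<alpha> - {#i#})))"
  have "rho_word p q (elem_mat i j) ?w = (\<Sum>m<length ?w. \<Sum>a\<in>{0,1}. \<Sum>k=1..p+q.
     ((-1) ^ (a * (\<Sum>n<m. par p (?w ! n))) * mpart p a (elem_mat i j) k (?w ! m)) *\<^sub>R vee p (?w[m := k]))"
    unfolding rho_word_def by (rule sum.swap)
  also have "\<dots> = (\<Sum>m<length ?w. if ?w ! m = i then v else 0)"
  proof (rule sum.cong)
    fix m assume "m \<in> {..<length ?w}"
    then have m: "m < length ?w" by simp
    define s where "s = (\<Sum>n<m. par p (?w ! n))"
    have "(\<Sum>k=1..p+q. ((-1) ^ (a * s) * mpart p a (elem_mat i j) k (?w ! m)) *\<^sub>R vee p (?w[m := k]))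
      = (if ?w ! m = i \<and> even (par' i + par' j + a) then (-1) ^ (a * s) *\<^sub>R vee p (?w[m := j]) else 0)" for a
    proof -
      have "(\<Sum>k=1..p+q. ((-1) ^ (a * s) * mpart p a (elem_mat i j) k (?w ! m)) *\<^sub>R vee p (?w[m := k]))
        = (\<Sum>k=1..p+q. if k = j then (if ?w ! m = i \<and> even (par' i + par' j + a) then (-1) ^ (a * s) *\<^sub>R vee p (?w[m := j]) else 0) else 0)"
        by (intro sum.cong refl) (auto simp: mpart_def elem_mat_def)
      then show ?thesis using ij by simp
    qed
    then have "(\<Sum>a\<in>{0,1}. \<Sum>k=1..p+q. ((-1) ^ (a * s) * mpart p a (elem_mat i j) k (?w ! m)) *\<^sub>R vee p (?w[m := k]))
      = (if ?w ! m = i then (-1) ^ ((par' i + par' j) * s) *\<^sub>R vee p (?w[m := j]) else 0)"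
      using par_cases[of p i] par_cases[of p j] by auto
    also have "\<dots> = (if ?w ! m = i then v else 0)"
    proof (cases "?w ! m = i")
      case True
      have "vee p (?w[m := j]) = vee p (take m ?w @ j # drop (Suc m) ?w)"
        using m by (simp add: upd_conv_take_nth_drop)
      also have "\<dots> = (-1) ^ (par' j * s) *\<^sub>R vee p (j # word (\<alpha> - {#i#}))"
        using m unfolding vee_move_front remove_nth_word[OF m True] s_def by (simp add: sum_par_nth)
      also have "\<dots> = (-1) ^ (par' j * s) *\<^sub>R (if p < j \<and> j \<in># \<alpha> - {#i#} then 0
          else lsign j (\<alpha> - {#i#}) *\<^sub>R mono_e (add_mset j (\<alpha> - {#i#})))"
        using vee_Cons_word[OF midx_mono[OF diff_subset_eq_self \<alpha>] ij(2)] by simp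
      finally have "(-1) ^ ((par' i + par' j) * s) *\<^sub>R vee p (?w[m := j]) =
        ((-1) ^ (par' i * s) * ((-1) ^ (par' j * s) * (-1) ^ (par' j * s))) *\<^sub>R
        (if p < j \<and> j \<in># \<alpha> - {#i#} then 0 else lsign j (\<alpha> - {#i#}) *\<^sub>R mono_e (add_mset j (\<alpha> - {#i#})))"
        by (simp add: add_mult_distrib power_add mult.assoc)
      then show ?thesis
        using True sign_before_nth[OF \<alpha> m True] unfolding s_def v_def by simp
    qed simp
    finally show "(\<Sum>a\<in>{0,1}. \<Sum>k=1..p+q. ((-1) ^ (a * (\<Sum>n<m. par p (?w ! n))) *
        mpart p a (elem_mat i j) k (?w ! m)) *\<^sub>R vee p (?w[m := k])) = (if ?w ! m = i then v else 0)"
      unfolding s_def .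
  qed simp
  also have "\<dots> = real (count \<alpha> i) *\<^sub>R v"
    by (rule sum_nth_eq_count)
  finally have "flip (par' i + par' j) f \<otimes>\<^sub>s rho_word p q (elem_mat i j) (word \<alpha>) =
    flip (par' i + par' j) f \<otimes>\<^sub>s (real (count \<alpha> i) *\<^sub>R v)"
    by simp
  also have "\<dots> = symP j (symI i (sing \<alpha> f))"
    unfolding v_def
    by (auto simp: symI_sing symP_sing symP_scaleR sing_scaleR tens_scaleR tens_mono_e flip_flip add.commute)
  finally show ?thesis .
qed

section \<open>Differential operators\<close>

definition dpow :: "nat multiset \<Rightarrow> sfun \<Rightarrow> sfun" where
  "dpow \<alpha> f = foldr (sderiv p) (word \<alpha>) f"

lemma foldr_sderiv_sfuns: "f \<in> F \<Longrightarrow> set w \<subseteq> idx \<Longrightarrow> foldr (sderiv p) w f \<in> F"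
  by (induction w) auto

lemma foldr_sderiv_add: "f \<in> F \<Longrightarrow> g \<in> F \<Longrightarrow> set w \<subseteq> idx \<Longrightarrow>
    foldr (sderiv p) w (f + g) = foldr (sderiv p) w f + foldr (sderiv p) w g"
  by (induction w) (auto simp: sderiv_add[of _ p q] foldr_sderiv_sfuns)

lemma foldr_sderiv_scaleR: "f \<in> F \<Longrightarrow> set w \<subseteq> idx \<Longrightarrow>
    foldr (sderiv p) w (c *\<^sub>R f) = c *\<^sub>R foldr (sderiv p) w f"
  by (induction w) (auto simp: sderiv_scaleR[of _ p q] foldr_sderiv_sfuns)

lemma sderiv_odd_square:
  assumes "f \<in> F" "j \<in> idx" "p < j"
  shows "sderiv p j (sderiv p j f) = 0"
proof -
  have "sderiv p j (sderiv p j f) = - sderiv p j (sderiv p j f)"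
    using sderiv_commute[OF assms(1,2,2)] assms(3) by (simp add: sg_def par_def)
  then show ?thesis
    using scaleR_left_imp_eq by (metis eq_neg_iff_add_eq_0 scaleR_2 scaleR_eq_0_iff zero_neq_numeral)
qed

text \<open>The new derivative crosses the smaller ones up to its sorted position, with a sign for
  each odd pair; an odd derivative that meets its own copy gives zero.\<close>

lemma sderiv_foldr_sderiv:
  assumes "f \<in> F" "set w \<subseteq> idx" "j \<in> idx" "sorted w"
  shows "sderiv p j (foldr (sderiv p) w f) = (if p < j \<and> j \<in> set w then 0
    else (-1) ^ (par' j * length (filter (\<lambda>l. p < l \<and> l < j) w)) *\<^sub>R foldr (sderiv p) (insort j w) f)"
  using assms(2,4)
proof (induction w)
  case (Cons i w)
  let ?g = "foldr (sderiv p) w f"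
  have g: "?g \<in> F" using Cons.prems assms(1) by (intro foldr_sderiv_sfuns) auto
  show ?case
  proof (cases "j \<le> i")
    case True
    then have lt: "\<not> l < j" if "l \<in> set (i # w)" for l
      using Cons.prems that by auto
    then have "filter (\<lambda>l. p < l \<and> l < j) (i # w) = []"
      by (auto simp: filter_empty_conv)
    moreover have "sderiv p j (sderiv p i ?g) = 0" if "p < j" "j \<in> set (i # w)"
    proof -
      have "i = j" using that lt True Cons.prems by (cases "i = j") auto
      then show ?thesis using sderiv_odd_square[OF g assms(3) that(1)] by simp
    qed
    ultimately show ?thesis
      using True by (simp del: filter.simps)
  next
    case False
    have i: "i \<in> idx" using Cons.prems by simp
    have IH: "sderiv p j ?g = (if p < j \<and> j \<in> set w then 0
      else (-1) ^ (par' j * length (filter (\<lambda>l. p < l \<and> l < j) w)) *\<^sub>R foldr (sderiv p) (insort j w) f)"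
      using Cons by simp
    have ins: "foldr (sderiv p) (insort j w) f \<in> F"
      using Cons.prems assms by (intro foldr_sderiv_sfuns) (auto simp: set_insort_key)
    have "sderiv p j (foldr (sderiv p) (i # w) f) = \<sigma> j i *\<^sub>R sderiv p i (sderiv p j ?g)"
      using sderiv_commute[OF g assms(3) i] by simp
    also have "\<dots> = (if p < j \<and> j \<in> set w then 0
      else (\<sigma> j i * (-1) ^ (par' j * length (filter (\<lambda>l. p < l \<and> l < j) w))) *\<^sub>R
        sderiv p i (foldr (sderiv p) (insort j w) f))"
      unfolding IH using ins i by (simp add: sderiv_scaleR[of _ p q])
    finally show ?thesis
      using False by (auto simp: sg_def par_def)
  qed
qed simp

lemma word_subset: "\<alpha> \<in> midx p q \<Longrightarrow> set (word \<alpha>) \<subseteq> idx"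
  by (simp add: midx_def)

lemma dpow_sfuns [simp]: "f \<in> F \<Longrightarrow> \<alpha> \<in> midx p q \<Longrightarrow> dpow \<alpha> f \<in> F"
  unfolding dpow_def by (intro foldr_sderiv_sfuns word_subset)

lemma dpow_empty [simp]: "dpow {#} f = f"
  by (simp add: dpow_def)

lemma dpow_add: "f \<in> F \<Longrightarrow> g \<in> F \<Longrightarrow> \<alpha> \<in> midx p q \<Longrightarrow> dpow \<alpha> (f + g) = dpow \<alpha> f + dpow \<alpha> g"
  unfolding dpow_def by (intro foldr_sderiv_add word_subset)

lemma dpow_scaleR: "f \<in> F \<Longrightarrow> \<alpha> \<in> midx p q \<Longrightarrow> dpow \<alpha> (c *\<^sub>R f) = c *\<^sub>R dpow \<alpha> f"
  unfolding dpow_def by (intro foldr_sderiv_scaleR word_subset)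

lemma sderiv_dpow:
  assumes "f \<in> F" "\<alpha> \<in> midx p q" "j \<in> idx"
  shows "sderiv p j (dpow \<alpha> f) = (if p < j \<and> j \<in># \<alpha> then 0 else lsign j \<alpha> *\<^sub>R dpow (add_mset j \<alpha>) f)"
proof -
  have "length (filter (\<lambda>l. p < l \<and> l < j) (word \<alpha>)) = size {#l \<in># \<alpha>. p < l \<and> l < j#}"
    by (metis mset_filter mset_sorted_list_of_multiset size_mset)
  then show ?thesis
    unfolding dpow_def lsign_def
    by (subst sderiv_foldr_sderiv[OF assms(1) word_subset[OF assms(2)] assms(3)]) simp_all
qed

section \<open>Linearity of the affine quantization\<close>

lemma Qaff_eq_sum:
  assumes "finite A" "{\<alpha>. S \<alpha> \<noteq> 0} \<subseteq> A" "f \<in> F"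
  shows "Qaff p q S f = (\<Sum>\<alpha>\<in>A. S \<alpha> \<odot> dpow \<alpha> f)"
proof -
  have "Qaff p q S f = (\<Sum>\<alpha> | S \<alpha> \<noteq> 0. S \<alpha> \<odot> dpow \<alpha> f)"
    using assms(3) by (simp add: Qaff_def on_sfuns_def dpow_def)
  also have "\<dots> = (\<Sum>\<alpha>\<in>A. S \<alpha> \<odot> dpow \<alpha> f)"
    using assms by (intro sum.mono_neutral_left) auto
  finally show ?thesis .
qed

lemma Qaff_outside: "f \<notin> F \<Longrightarrow> Qaff p q S f = 0"
  by (simp add: Qaff_def on_sfuns_def)

lemma Qaff_add: "S \<in> V \<Longrightarrow> T \<in> V \<Longrightarrow> Qaff p q (S + T) f = Qaff p q S f + Qaff p q T f"
proof (cases "f \<in> F")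
  case True
  assume ST: "S \<in> V" "T \<in> V"
  let ?A = "{\<alpha>. S \<alpha> \<noteq> 0} \<union> {\<alpha>. T \<alpha> \<noteq> 0}"
  have A: "finite ?A" using ST by (simp add: symbols_finite)
  have "Qaff p q U f = (\<Sum>\<alpha>\<in>?A. U \<alpha> \<odot> dpow \<alpha> f)" if "U \<in> {S, T, S + T}" for U
    using that by (intro Qaff_eq_sum[OF A _ True]) (auto simp: fun_apply)
  then show ?thesis by (simp add: fun_apply sprod_add_left sum.distrib)
qed (simp add: Qaff_outside)

lemma Qaff_scaleR: "S \<in> V \<Longrightarrow> Qaff p q (c *\<^sub>R S) f = c *\<^sub>R Qaff p q S f"
proof (cases "f \<in> F")
  case True
  assume S: "S \<in> V"
  let ?A = "{\<alpha>. S \<alpha> \<noteq> 0}"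
  have A: "finite ?A" using S by (simp add: symbols_finite)
  have "Qaff p q U f = (\<Sum>\<alpha>\<in>?A. U \<alpha> \<odot> dpow \<alpha> f)" if "U \<in> {S, c *\<^sub>R S}" for U
    using that by (intro Qaff_eq_sum[OF A _ True]) (auto simp: fun_apply)
  then show ?thesis by (simp add: fun_apply scaleR_sum_right)
qed (simp add: Qaff_outside)

lemma Qaff_zero [simp]: "Qaff p q 0 f = 0"
  using Qaff_scaleR[of 0 0 f] by simp

lemma Qaff_minus: "S \<in> V \<Longrightarrow> Qaff p q (- S) f = - Qaff p q S f"
  using Qaff_scaleR[of S "-1" f] by simp

lemma Qaff_diff: "S \<in> V \<Longrightarrow> T \<in> V \<Longrightarrow> Qaff p q (S - T) f = Qaff p q S f - Qaff p q T f"
  using Qaff_add[of S "- T" f] by (simp add: Qaff_minus)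

lemma Qaff_sum: "(\<And>i. i \<in> A \<Longrightarrow> S i \<in> V) \<Longrightarrow> Qaff p q (\<Sum>i\<in>A. S i) f = (\<Sum>i\<in>A. Qaff p q (S i) f)"
  by (induction A rule: infinite_finite_induct) (simp_all add: Qaff_add V_sum)

lemma Qaff_sing: "f \<in> F \<Longrightarrow> Qaff p q (sing \<alpha> g) f = g \<odot> dpow \<alpha> f"
  by (subst Qaff_eq_sum[of "{\<alpha>}"]) (auto simp: sing_def)

lemma Qaff_sfuns [simp]: "S \<in> V \<Longrightarrow> Qaff p q S f \<in> F"
proof (cases "f \<in> F")
  case True
  assume "S \<in> V"
  then show ?thesis
    by (induction rule: symbols_induct) (simp_all add: Qaff_sing Qaff_add True)
qed (simp add: Qaff_outside)

lemma Qaff_arg_add: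
  assumes "S \<in> V" "f \<in> F" "g \<in> F"
  shows "Qaff p q S (f + g) = Qaff p q S f + Qaff p q S g"
  using assms(1)
  by (induction rule: symbols_induct)
    (simp_all add: Qaff_sing Qaff_add assms dpow_add sprod_add_right)

lemma Qaff_arg_scaleR:
  assumes "S \<in> V" "f \<in> F"
  shows "Qaff p q S (c *\<^sub>R f) = c *\<^sub>R Qaff p q S f"
  using assms(1)
  by (induction rule: symbols_induct)
    (simp_all add: Qaff_sing Qaff_add assms dpow_scaleR scaleR_add_right)

lemma Qaff_arg_sum:
  "S \<in> V \<Longrightarrow> (\<And>i. i \<in> A \<Longrightarrow> f i \<in> F) \<Longrightarrow> Qaff p q S (\<Sum>i\<in>A. f i) = (\<Sum>i\<in>A. Qaff p q S (f i))"
proof (induction A rule: infinite_finite_induct)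
  case (insert k A)
  then show ?case by (simp add: Qaff_arg_add sfuns_sum)
qed (use Qaff_arg_scaleR[of S 0 0] in simp_all)

section \<open>Composition with coordinates and derivatives\<close>

lemma Qaff_Y_left:
  assumes "S \<in> V" "f \<in> F" "j \<in> idx"
  shows "coord p j \<odot> Qaff p q S f = Qaff p q (symY j S) f"
  using assms(1)
  by (induction rule: symbols_induct)
    (use assms in \<open>simp_all add: symY_sing Qaff_sing coord_sprod_assoc Qaff_add symY_add sprod_add_right\<close>)

text \<open>By the Leibniz rule the derivative either hits the coefficient or passes it, with a
  \<open>flip\<close>, and joins the monomial of derivatives; its sorting sign there is the
  \<open>lsign\<close> in \<open>symP\<close>.\<close>

lemma Qaff_D_left:
  assumes "S \<in> V" "f \<in> F" "j \<in> idx"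
  shows "sderiv p j (Qaff p q S f) = Qaff p q (symD j S) f + Qaff p q (symP j S) f"
  using assms(1)
proof (induction rule: symbols_induct)
  case (sing \<alpha> g)
  have "sderiv p j (Qaff p q (sing \<alpha> g) f) =
      sderiv p j g \<odot> dpow \<alpha> f + flip (par' j) g \<odot> sderiv p j (dpow \<alpha> f)"
    using sing assms by (simp add: Qaff_sing sderiv_sprod[of _ p q])
  then show ?case
    using sing assms by (auto simp: symD_sing symP_sing Qaff_sing sderiv_dpow)
next
  case (add S T)
  have "sderiv p j (Qaff p q (S + T) f) = sderiv p j (Qaff p q S f) + sderiv p j (Qaff p q T f)"
    using add.hyps assms by (simp add: Qaff_add sderiv_add[of _ p q])
  then show ?case
    using add assms by (simp add: Qaff_add symD_add symP_add)
qed

text \<open>Precomposition with an operator \<open>Z\<close> corresponds to an operator \<open>T\<close> on symbols; as symbols are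
  generated in degree zero by left products, it suffices to compare them in degree zero.\<close>

lemma Qaff_right:
  assumes j: "j \<in> idx"
    and Z: "\<And>f. f \<in> F \<Longrightarrow> Z f \<in> F"
    and TV: "\<And>S. S \<in> V \<Longrightarrow> T S \<in> V"
    and T_add: "\<And>S U. S \<in> V \<Longrightarrow> U \<in> V \<Longrightarrow> T (S + U) = T S + T U"
    and base: "\<And>f g. f \<in> F \<Longrightarrow> g \<in> F \<Longrightarrow> flip (par' j) (g \<odot> Z f) = Qaff p q (T (sing {#} g)) f"
    and step: "\<And>S i. S \<in> V \<Longrightarrow> i \<in> idx \<Longrightarrow>
      T (symP i S) = \<sigma> i j *\<^sub>R (symD i (T S) + symP i (T S)) - T (symD i S)"
    and S: "S \<in> V" and f: "f \<in> F"
  shows "flip (par' j) (Qaff p q S (Z f)) = Qaff p q (T S) f"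
  using S
proof (induction rule: symbols_induct)
  case (sing \<alpha> g)
  then show ?case
  proof (induction "size \<alpha>" arbitrary: \<alpha> g)
    case 0
    then have "\<alpha> = {#}" by simp
    then show ?case using base[OF f, of g] 0 by (simp add: Qaff_sing Z f)
  next
    case (Suc n)
    then have ne: "\<alpha> \<noteq> {#}" by auto
    define i where "i = Min (set_mset \<alpha>)"
    define S where "S = sing (\<alpha> - {#i#}) (flip (par' i) g)"
    note i = sing_eq_symP[OF Suc.prems(1) ne, folded i_def]
    have m: "\<alpha> - {#i#} \<in> midx p q" "n = size (\<alpha> - {#i#})"
      using Suc i(2) midx_mono[OF diff_subset_eq_self] by (simp_all add: size_Diff_singleton)
    then have S: "S \<in> V" using Suc.prems by (simp add: S_def)
    have IH: "flip (par' j) (Qaff p q S (Z f)) = Qaff p q (T S) f"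
      "flip (par' j) (Qaff p q (symD i S) (Z f)) = Qaff p q (T (symD i S)) f"
      unfolding S_def symD_sing using Suc.prems i(3) m by (auto intro!: Suc.hyps(1))
    \<comment> \<open>\<open>Qaff_D_left\<close> is solved for the term with \<open>symP i\<close>.
      Composition with a derivative on the left commutes with precomposition by \<open>Z\<close>, so
      the claim for \<open>symP i S\<close> reduces to \<open>S\<close> and \<open>symD i S\<close>,
      both of smaller degree.\<close>
    have "Qaff p q (sing \<alpha> g) (Z f) = sderiv p i (Qaff p q S (Z f)) - Qaff p q (symD i S) (Z f)"
      using Qaff_D_left[OF S Z[OF f] i(3)] by (simp add: i(1)[of g] S_def)
    then have "flip (par' j) (Qaff p q (sing \<alpha> g) (Z f)) =
        \<sigma> i j *\<^sub>R sderiv p i (Qaff p q (T S) f) - Qaff p q (T (symD i S)) f"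
      using S i(3) IH by (simp add: flip_sderiv[of _ p q] sg_def mult.commute)
    also have "sderiv p i (Qaff p q (T S) f) = Qaff p q (symD i (T S) + symP i (T S)) f"
      using TV[OF S] f i(3) by (simp add: Qaff_D_left Qaff_add)
    also have "\<sigma> i j *\<^sub>R Qaff p q (symD i (T S) + symP i (T S)) f - Qaff p q (T (symD i S)) f =
        Qaff p q (T (symP i S)) f"
      using S TV i(3) by (simp add: step Qaff_diff Qaff_scaleR)
    finally show ?case by (simp add: i(1)[of g] S_def)
  qed
next
  case (add S U)
  then show ?case by (simp add: Qaff_add T_add TV)
qed

lemma sg_self: "\<sigma> j j = \<epsilon> j"
  by (simp add: sg_def)

text \<open>Conjugating an operator by \<open>flip a\<close> multiplies its part of parity b by
  (-1)^(a b). The two flips thus supply the sign with which \<open>coord p j\<close> passes the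
  operator, and the formula is the one for precomposition with that coordinate.\<close>

lemma Qaff_Y_right:
  assumes j: "j \<in> idx" and S: "S \<in> V" and f: "f \<in> F"
  shows "flip (par' j) (Qaff p q S (flip (par' j) (coord p j \<odot> f))) =
    Qaff p q (symY j S + \<epsilon> j *\<^sub>R symI j S) f"
proof (rule Qaff_right[OF j, where T = "\<lambda>S. symY j S + \<epsilon> j *\<^sub>R symI j S"])
  fix S i
  assume S: "S \<in> V" and i: "i \<in> idx"
  define d where "d = (if i = j then S else 0)"
  have d: "\<sigma> i j *\<^sub>R d = \<epsilon> j *\<^sub>R d"
    by (simp add: d_def sg_self)
  have "symI j (symP i S) = \<sigma> i j *\<^sub>R symP i (symI j S) + d"
    using symIP[OF S, of j i] by (auto simp: d_def sg_commute[of p j i])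
  moreover have "symD i (symY j S + \<epsilon> j *\<^sub>R symI j S) =
      \<sigma> i j *\<^sub>R symY j (symD i S) + d + (\<epsilon> j * \<sigma> i j) *\<^sub>R symI j (symD i S)"
    using S i j by (simp add: d_def symD_add symD_scaleR symDY symDI)
  moreover have "symP i (symY j S + \<epsilon> j *\<^sub>R symI j S) =
      \<sigma> i j *\<^sub>R symY j (symP i S) + \<epsilon> j *\<^sub>R symP i (symI j S)"
    by (simp add: symP_add symP_scaleR symPY[of i j] sg_commute[of p j i])
  ultimately show "symY j (symP i S) + \<epsilon> j *\<^sub>R symI j (symP i S) =
     \<sigma> i j *\<^sub>R (symD i (symY j S + \<epsilon> j *\<^sub>R symI j S) + symP i (symY j S + \<epsilon> j *\<^sub>R symI j S)) -
     (symY j (symD i S) + \<epsilon> j *\<^sub>R symI j (symD i S))"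
    by (simp add: scaleR_add_right d mult.left_commute[of "\<sigma> i j"] mult.commute[of "\<epsilon> j"])
next
  fix f g assume "f \<in> F" "g \<in> F"
  then show "flip (par' j) (g \<odot> flip (par' j) (coord p j \<odot> f)) =
      Qaff p q (symY j (sing {#} g) + \<epsilon> j *\<^sub>R symI j (sing {#} g)) f"
    using j by (simp add: flip_sprod flip_sprod_coord symY_sing symI_sing Qaff_sing coord_sprod_assoc)
qed (use S f j in \<open>simp_all add: symY_add symI_add scaleR_add_right\<close>)

lemma dpow_single: "dpow {#j#} f = sderiv p j f"
  by (simp add: dpow_def)

lemma Qaff_D_right:
  assumes j: "j \<in> idx" and S: "S \<in> V" and f: "f \<in> F"
  shows "flip (par' j) (Qaff p q S (flip (par' j) (sderiv p j f))) = Qaff p q (symP j S) f"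
proof (rule Qaff_right[OF j, where T = "\<lambda>S. symP j S"])
  fix S i
  assume S: "S \<in> V" and i: "i \<in> idx"
  show "symP j (symP i S) = \<sigma> i j *\<^sub>R (symD i (symP j S) + symP i (symP j S)) - symP j (symD i S)"
    using S i j by (simp add: symDP symPP[of i j] scaleR_add_right)
next
  fix f g assume "f \<in> F" "g \<in> F"
  then show "flip (par' j) (g \<odot> flip (par' j) (sderiv p j f)) = Qaff p q (symP j (sing {#} g)) f"
    by (simp add: flip_sprod symP_sing Qaff_sing dpow_single lsign_def)
qed (use S f j in \<open>simp_all add: symP_add\<close>)

text \<open>If the operator is zero, so is its supercommutator with each coordinate, which by
  \<open>Qaff_Y_left\<close> and \<open>Qaff_Y_right\<close> has symbol \<iota>_j S up to sign. By
  induction on the degree bound all \<iota>_j S vanish, hence \<open>S\<close> has degree zero and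
  is read off by applying the operator to the constant \<open>sone\<close>.\<close>

lemma Qaff_eq_0_imp:
  assumes "S \<in> V" "\<And>f. f \<in> F \<Longrightarrow> Qaff p q S f = 0"
  shows "S = 0"
proof -
  have "S = 0" if "\<And>\<alpha>. S \<alpha> \<noteq> 0 \<Longrightarrow> size \<alpha> \<le> n" for n
    using assms that
  proof (induction n arbitrary: S)
    case (0 S)
    have "S \<alpha> = 0" if "\<alpha> \<noteq> {#}" for \<alpha>
      using 0(3)[of \<alpha>] that by auto
    then have S: "S = sing {#} (S {#})"
      by (auto simp: sing_def)
    have "Qaff p q S sone = S {#}"
      using 0(1) by (subst S) (simp add: Qaff_sing sprod_sone[of _ p q])
    then have "S {#} = 0" using 0(2)[of sone] by simp
    then show ?case using S by simp
  next
    case (Suc n S)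
    have I: "symI j S = 0" if j: "j \<in> idx" for j
    proof (rule Suc.IH)
      show "symI j S \<in> V" using Suc.prems j by simp
      show "size \<alpha> \<le> n" if "symI j S \<alpha> \<noteq> 0" for \<alpha>
        using that Suc.prems(3)[of "add_mset j \<alpha>"] by (cases "S (add_mset j \<alpha>) = 0") (auto simp: symI_def)
      fix f assume f: "f \<in> F"
      have "flip (par' j) (coord p j \<odot> f) \<in> F" using j f by simp
      then have "Qaff p q (symY j S + \<epsilon> j *\<^sub>R symI j S) f = 0"
        using Qaff_Y_right[OF j Suc.prems(1) f] Suc.prems(2) by simp
      moreover have "Qaff p q (symY j S) f = 0"
        using Qaff_Y_left[OF Suc.prems(1) f j] Suc.prems(2)[OF f] by simp
      ultimately show "Qaff p q (symI j S) f = 0"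
        using Suc.prems(1) j by (simp add: Qaff_add Qaff_scaleR)
    qed
    have "S \<alpha> = 0" if ne: "\<alpha> \<noteq> {#}" for \<alpha>
    proof (rule ccontr)
      assume \<alpha>: "S \<alpha> \<noteq> 0"
      from ne obtain j \<beta> where \<beta>: "\<alpha> = add_mset j \<beta>" by (metis multiset_cases)
      then have "j \<in> idx" using symbols_midx[OF Suc.prems(1) \<alpha>] by (simp add: midx_def)
      then have "symI j S \<beta> = 0" using I by (simp add: fun_apply)
      then show False using \<alpha> by (simp add: symI_def \<beta>)
    qed
    then have S: "S = sing {#} (S {#})"
      by (auto simp: sing_def)
    have "Qaff p q S sone = S {#}"
      using Suc.prems(1) by (subst S) (simp add: Qaff_sing sprod_sone[of _ p q])
    then have "S {#} = 0" using Suc.prems(2)[of sone] by simp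
    then show ?case using S by simp
  qed
  moreover obtain n where "size \<alpha> \<le> n" if "S \<alpha> \<noteq> 0" for \<alpha>
    using finite_nat_set_iff_bounded_le[of "size ` {\<alpha>. S \<alpha> \<noteq> 0}"] symbols_finite[OF assms(1)] by auto
  ultimately show ?thesis by blast
qed

lemma Qaff_inj:
  assumes "S \<in> V" "T \<in> V" "Qaff p q S = Qaff p q T"
  shows "S = T"
  using Qaff_eq_0_imp[of "S - T"] assms by (simp add: Qaff_diff)

end

section \<open>Actions of homogeneous vector fields\<close>

lemma flip_parity: "even (a + b) \<Longrightarrow> flip a f = flip b f"
  by (intro ext) (auto simp: flip_def fun_apply minus_one_power_iff)

lemma hpart_homogeneous:
  assumes "flip 1 f = (-1) ^ b *\<^sub>R f"
  shows "hpart a f = (if even (a + b) then f else 0)"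
proof (intro ext)
  fix I x
  have "(-1) ^ card I * f I x = (-1) ^ b * f I x"
    using fun_cong[OF fun_cong[OF assms, of I], of x] by (simp add: flip_def fun_apply)
  then show "hpart a f I x = (if even (a + b) then f else 0) I x"
    by (auto simp: hpart_def fun_apply minus_one_power_iff split: if_splits)
qed

text \<open>Only the residue of \<open>a\<close> modulo 2 matters, so a parity may be given as a sum
  such as \<open>par p i + par p j\<close>, which can equal 2.\<close>

definition homogeneous :: "nat \<Rightarrow> nat \<Rightarrow> vfield \<Rightarrow> bool" where
  "homogeneous p a X \<longleftrightarrow> (\<forall>i. flip 1 (X i) = (-1) ^ (a + par p i) *\<^sub>R X i)"

lemma vpart_homogeneous:
  assumes "homogeneous p a X"
  shows "vpart p b X = (if even (a + b) then X else 0)"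
proof
  fix i
  have "hpart (b + par p i) (X i) = (if even (b + par p i + (a + par p i)) then X i else 0)"
    using assms by (intro hpart_homogeneous) (simp add: homogeneous_def)
  moreover have "even (b + par p i + (a + par p i)) \<longleftrightarrow> even (a + b)" by presburger
  ultimately show "vpart p b X i = (if even (a + b) then X else 0) i"
    by (simp only: vpart_def) (simp add: fun_apply)
qed

context superspace
begin

section \<open>Linearity of the action on operators in the field\<close>

definition fields :: "vfield set" where
  "fields = {X. \<forall>i\<in>idx. X i \<in> F}"

lemma fields_zero [simp]: "0 \<in> fields"
  and fields_add [simp]: "X \<in> fields \<Longrightarrow> Y \<in> fields \<Longrightarrow> X + Y \<in> fields"
  and fields_scaleR [simp]: "X \<in> fields \<Longrightarrow> c *\<^sub>R X \<in> fields"
  and fields_vpart [simp]: "X \<in> fields \<Longrightarrow> vpart p a X \<in> fields"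
  by (simp_all add: fields_def fun_apply vpart_def)

lemma fieldsD [simp]: "X \<in> fields \<Longrightarrow> i \<in> idx \<Longrightarrow> X i \<in> F"
  by (simp add: fields_def)

lemma vpart_add: "vpart p a (X + Y) = vpart p a X + vpart p a Y"
  by (rule ext) (simp add: vpart_def fun_apply hpart_add)

lemma vpart_scaleR: "vpart p a (c *\<^sub>R X) = c *\<^sub>R vpart p a X"
  by (rule ext) (simp add: vpart_def fun_apply hpart_scaleR)

lemma vapply_sfuns [simp]: "X \<in> fields \<Longrightarrow> f \<in> F \<Longrightarrow> vapply p q X f \<in> F"
  unfolding vapply_def by (rule sfuns_sum) simp

lemma vdiv_sfuns [simp]: "X \<in> fields \<Longrightarrow> vdiv p q X \<in> F"
  unfolding vdiv_def by (intro sfuns_sum) simp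

lemma Ldens_sfuns [simp]: "X \<in> fields \<Longrightarrow> f \<in> F \<Longrightarrow> Ldens p q l X f \<in> F"
  by (simp add: Ldens_def)

lemma vapply_add: "f \<in> F \<Longrightarrow> g \<in> F \<Longrightarrow> vapply p q X (f + g) = vapply p q X f + vapply p q X g"
  by (simp add: vapply_def sderiv_add[of _ p q] sprod_add_right sum.distrib)

lemma Ldens_add: "f \<in> F \<Longrightarrow> g \<in> F \<Longrightarrow> Ldens p q l X (f + g) = Ldens p q l X f + Ldens p q l X g"
  by (simp add: Ldens_def vapply_add sprod_add_right scaleR_add_right)

lemma vapply_field_add: "vapply p q (X + Y) f = vapply p q X f + vapply p q Y f"
  by (simp add: vapply_def fun_apply sprod_add_left sum.distrib)

lemma vapply_field_scaleR: "vapply p q (c *\<^sub>R X) f = c *\<^sub>R vapply p q X f"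
  by (simp add: vapply_def fun_apply scaleR_sum_right)

lemma vdiv_field_add: "X \<in> fields \<Longrightarrow> Y \<in> fields \<Longrightarrow> vdiv p q (X + Y) = vdiv p q X + vdiv p q Y"
  by (simp add: vdiv_def fun_apply hpart_add sderiv_add[of _ p q] scaleR_add_right sum.distrib)

lemma vdiv_field_scaleR: "X \<in> fields \<Longrightarrow> vdiv p q (c *\<^sub>R X) = c *\<^sub>R vdiv p q X"
  by (simp add: vdiv_def fun_apply hpart_scaleR sderiv_scaleR[of _ p q] scaleR_sum_right
      scaleR_add_right mult.commute)

lemma Ldens_field_add:
  "X \<in> fields \<Longrightarrow> Y \<in> fields \<Longrightarrow> Ldens p q l (X + Y) f = Ldens p q l X f + Ldens p q l Y f"
  by (simp add: Ldens_def vapply_field_add vdiv_field_add sprod_add_left scaleR_add_right)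

lemma Ldens_field_scaleR:
  "X \<in> fields \<Longrightarrow> Ldens p q l (c *\<^sub>R X) f = c *\<^sub>R Ldens p q l X f"
  by (simp add: Ldens_def vapply_field_scaleR vdiv_field_scaleR scaleR_add_right scaleR_left_commute)

lemma Ldens_zero [simp]: "Ldens p q l 0 f = 0"
  using Ldens_field_scaleR[of 0 l 0 f] by simp

lemma oppart_Qaff_add:
  assumes "S \<in> V" "f \<in> F" "g \<in> F"
  shows "oppart b (Qaff p q S) (f + g) = oppart b (Qaff p q S) f + oppart b (Qaff p q S) g"
  using assms by (simp add: oppart_def hpart_add Qaff_arg_add)

lemma oppart_Qaff_scaleR:
  assumes "S \<in> V" "f \<in> F"
  shows "oppart b (Qaff p q S) (c *\<^sub>R f) = c *\<^sub>R oppart b (Qaff p q S) f"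
  using assms by (simp add: oppart_def hpart_scaleR Qaff_arg_scaleR scaleR_add_right)

lemma oppart_Qaff_sfuns [simp]: "S \<in> V \<Longrightarrow> oppart b (Qaff p q S) f \<in> F"
  by (simp add: oppart_def)

definition Lop_part :: "real \<Rightarrow> real \<Rightarrow> nat \<Rightarrow> nat \<Rightarrow> vfield \<Rightarrow> sop \<Rightarrow> sfun \<Rightarrow> sfun" where
  "Lop_part l m a b X D f = Ldens p q m (vpart p a X) (oppart b D f)
     - (-1) ^ (a * b) *\<^sub>R oppart b D (Ldens p q l (vpart p a X) f)"

lemma Lop_eq_sum: "f \<in> F \<Longrightarrow> Lop p q l m X D f = (\<Sum>a\<in>{0,1}. \<Sum>b\<in>{0,1}. Lop_part l m a b X D f)"
  unfolding Lop_def on_sfuns_def Lop_part_def by (simp only: if_True)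

lemma Lop_outside: "f \<notin> F \<Longrightarrow> Lop p q l m X D f = 0"
  by (simp add: Lop_def on_sfuns_def)

lemma Lop_field_add:
  assumes X: "X \<in> fields" and Y: "Y \<in> fields" and S: "S \<in> V"
  shows "Lop p q l m (X + Y) (Qaff p q S) f = Lop p q l m X (Qaff p q S) f + Lop p q l m Y (Qaff p q S) f"
proof (cases "f \<in> F")
  case True
  have "Lop_part l m a b (X + Y) (Qaff p q S) f =
      Lop_part l m a b X (Qaff p q S) f + Lop_part l m a b Y (Qaff p q S) f" for a b
    unfolding Lop_part_def vpart_add Ldens_field_add[OF fields_vpart[OF X] fields_vpart[OF Y]]
      oppart_Qaff_add[OF S Ldens_sfuns[OF fields_vpart[OF X] True] Ldens_sfuns[OF fields_vpart[OF Y] True]]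
      scaleR_add_right by (rule add_diff_add)
  then show ?thesis
    by (simp only: Lop_eq_sum[OF True] sum.distrib)
qed (simp add: Lop_outside)

lemma Lop_field_scaleR:
  assumes X: "X \<in> fields" and S: "S \<in> V"
  shows "Lop p q l m (c *\<^sub>R X) (Qaff p q S) f = c *\<^sub>R Lop p q l m X (Qaff p q S) f"
proof (cases "f \<in> F")
  case True
  have "Lop_part l m a b (c *\<^sub>R X) (Qaff p q S) f = c *\<^sub>R Lop_part l m a b X (Qaff p q S) f" for a b
    unfolding Lop_part_def vpart_scaleR Ldens_field_scaleR[OF fields_vpart[OF X]]
      oppart_Qaff_scaleR[OF S Ldens_sfuns[OF fields_vpart[OF X] True]]
    by (simp only: scaleR_diff_right scaleR_scaleR mult.commute)
  then show ?thesis
    by (simp only: Lop_eq_sum[OF True] scaleR_sum_right)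
qed (simp add: Lop_outside)

text \<open>The super sign between a field of parity \<open>a\<close> and the parts of an operator
  is conjugation by \<open>flip a\<close>. This rewrites the action on operators in a form to which
  the rules for precomposition apply.\<close>

lemma sum_oppart:
  assumes "S \<in> V" "f \<in> F"
  shows "(\<Sum>b\<in>{0,1}. (-1) ^ (a * b) *\<^sub>R oppart b (Qaff p q S) f) =
    flip a (Qaff p q S (flip a f))"
proof -
  let ?D = "Qaff p q S"
  have h: "(\<Sum>b\<in>{0,1}. (-1) ^ (a * b) *\<^sub>R hpart (b + c) g) = (-1) ^ (a * c) *\<^sub>R flip a g"
    if "c \<in> {0,1}" for c g
  proof -
    have "hpart (Suc (Suc 0)) g = hpart 0 g" by (intro ext) (simp add: hpart_def)
    then show ?thesis
      using that unfolding flip_eq_sum_hpart[symmetric] by (auto simp: scaleR_add_right add.commute)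
  qed
  have "(\<Sum>b\<in>{0,1}. (-1) ^ (a * b) *\<^sub>R oppart b ?D f) =
    (\<Sum>c\<in>{0,1}. \<Sum>b\<in>{0,1}. (-1) ^ (a * b) *\<^sub>R hpart (b + c) (?D (hpart c f)))"
    unfolding oppart_def scaleR_sum_right by (rule sum.swap)
  also have "\<dots> = (\<Sum>c\<in>{0,1}. (-1) ^ (a * c) *\<^sub>R flip a (?D (hpart c f)))"
    by (intro sum.cong refl h)
  also have "\<dots> = flip a (?D (\<Sum>c\<in>{0,1}. (-1) ^ (a * c) *\<^sub>R hpart c f))"
    using assms by (simp add: Qaff_arg_add Qaff_arg_scaleR)
  finally show ?thesis unfolding flip_eq_sum_hpart .
qed

lemma Lop_homogeneous:
  assumes X: "X \<in> fields" "homogeneous p a X" and S: "S \<in> V" and f: "f \<in> F"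
  shows "Lop p q l m X (Qaff p q S) f = Ldens p q m X (Qaff p q S f) -
    flip a (Qaff p q S (flip a (Ldens p q l X f)))"
proof -
  let ?D = "Qaff p q S"
  \<comment> \<open>\<open>c\<close> is the representative of the parity \<open>a\<close> in
    \<open>{0,1}\<close>, the range of the sums in the definition of the action.\<close>
  define c :: nat where "c = (if even a then 0 else 1)"
  have c: "even (c + a)" "c \<in> {0,1}" by (simp_all add: c_def)
  have v: "vpart p b X = (if b = c then X else 0)" if "b \<in> {0,1}" for b
    using that vpart_homogeneous[OF X(2)] by (auto simp: c_def)
  have op0: "oppart b ?D 0 = 0" for b
    using oppart_Qaff_scaleR[OF S sfuns_zero, of b 0] by simp
  have "Lop p q l m X ?D f = (\<Sum>b\<in>{0,1}. \<Sum>d\<in>{0,1}.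
     Ldens p q m (vpart p b X) (oppart d ?D f)
       - (-1) ^ (b * d) *\<^sub>R oppart d ?D (Ldens p q l (vpart p b X) f))"
    unfolding Lop_eq_sum[OF f] Lop_part_def ..
  also have "\<dots> = (\<Sum>b\<in>{0,1}. if b = c then (\<Sum>d\<in>{0,1}. Ldens p q m X (oppart d ?D f)
       - (-1) ^ (c * d) *\<^sub>R oppart d ?D (Ldens p q l X f)) else 0)"
    by (intro sum.cong refl) (simp add: v op0)
  also have "\<dots> = (\<Sum>d\<in>{0,1}. Ldens p q m X (oppart d ?D f)) -
      (\<Sum>d\<in>{0,1}. (-1) ^ (c * d) *\<^sub>R oppart d ?D (Ldens p q l X f))"
    using c(2) by (simp only: sum.delta finite.intros if_True sum_subtractf)
  also have "(\<Sum>d\<in>{0,1}. Ldens p q m X (oppart d ?D f)) =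
      Ldens p q m X (\<Sum>d\<in>{0,1}. (-1) ^ (0 * d) *\<^sub>R oppart d ?D f)"
    using S by (simp add: Ldens_add)
  also have "\<dots> = Ldens p q m X (?D f)"
    unfolding sum_oppart[OF S f] by simp
  also have "(\<Sum>d\<in>{0,1}. (-1) ^ (c * d) *\<^sub>R oppart d ?D (Ldens p q l X f)) =
      flip a (?D (flip a (Ldens p q l X f)))"
    using X(1) f by (simp only: sum_oppart[OF S] Ldens_sfuns flip_parity[OF c(1)])
  finally show ?thesis .
qed

section \<open>The action of a homogeneous field on symbols\<close>

lemma str_elem_mat: "i \<in> idx \<Longrightarrow> j \<in> idx \<Longrightarrow> str p idx (elem_mat i j) = (if i = j then \<epsilon> i else 0)"
proof -
  assume "i \<in> idx" "j \<in> idx"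
  have "str p idx (elem_mat i j) = (\<Sum>k\<in>idx. if k = j then (if i = j then \<epsilon> i else 0) else 0)"
    unfolding str_def by (rule sum.cong) (auto simp: elem_mat_def)
  with \<open>j \<in> idx\<close> show ?thesis by simp
qed

text \<open>The three terms are the derivative of the coefficient, the supertrace from the line
  spanned by the weight generator, and the matrix action through \<open>rho_word_elem_mat\<close>;
  the inner \<open>flip\<close> cancels the one in that lemma.\<close>

lemma Lsym_tens_homogeneous:
  assumes X: "homogeneous p a X" and \<alpha>: "\<alpha> \<in> midx p q"
  defines "g \<equiv> \<lambda>f i j. flip a f \<odot> Jcoef p a X i j"
  shows "Lsym_tens p q d X f \<alpha> = sing \<alpha> (vapply p q X f)
    - d *\<^sub>R (\<Sum>i\<in>idx. \<epsilon> i *\<^sub>R sing \<alpha> (g f i i))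
    + (\<Sum>i\<in>idx. \<Sum>j\<in>idx. symP j (symI i (sing \<alpha> (flip (par' i + par' j) (g f i j)))))"
proof -
  define c :: nat where "c = (if even a then 0 else 1)"
  have c: "even (c + a)" "c \<in> {0,1}" by (simp_all add: c_def)
  have v: "vpart p b X = (if b = c then X else 0)" if "b \<in> {0,1}" for b
    using that vpart_homogeneous[OF X] by (auto simp: c_def)
  have J: "Jcoef p c X i j = Jcoef p a X i j" for i j
    using c by (auto simp: Jcoef_def minus_one_power_iff)
  have J0: "Jcoef p b 0 i j = 0" for b i j
    by (simp add: Jcoef_def fun_apply)
  let ?r = "\<lambda>i j. rho p q d (elem_mat i j) \<alpha>"
  let ?U = "\<lambda>h. \<Sum>i=1..p+q. \<Sum>j=1..p+q. (h \<odot> Jcoef p a X i j) \<otimes>\<^sub>s ?r i j"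
  have "(\<Sum>b\<in>{0,1}. (-1) ^ (c * b) *\<^sub>R ?U (hpart b f)) =
    ?U (flip c f)"
  proof -
    have "(\<Sum>b\<in>{0,1}. (-1) ^ (c * b) *\<^sub>R ?U (hpart b f)) =
      (\<Sum>i=1..p+q. \<Sum>j=1..p+q. (\<Sum>b\<in>{0,1}. (-1) ^ (c * b) *\<^sub>R ((hpart b f \<odot> Jcoef p a X i j) \<otimes>\<^sub>s ?r i j)))"
      by (simp add: sum.distrib scaleR_sum_right)
    also have "\<dots> = ?U (\<Sum>b\<in>{0,1}. (-1) ^ (c * b) *\<^sub>R hpart b f)"
      by (simp only: sprod_sum_left sprod_scaleR_left tens_sum_left tens_scaleR_left)
    finally show ?thesis unfolding flip_eq_sum_hpart .
  qed
  moreover have "(\<Sum>b'\<in>{0,1}. \<Sum>b\<in>{0,1}. (-1) ^ (b' * b) *\<^sub>R (\<Sum>i=1..p+q. \<Sum>j=1..p+q.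
        (hpart b f \<odot> Jcoef p b' (vpart p b' X) i j) \<otimes>\<^sub>s ?r i j)) =
    (\<Sum>b'\<in>{0,1}. if b' = c then (\<Sum>b\<in>{0,1}. (-1) ^ (c * b) *\<^sub>R ?U (hpart b f)) else 0)"
  proof (rule sum.cong[OF refl])
    fix b' :: nat assume b': "b' \<in> {0,1}"
    show "(\<Sum>b\<in>{0,1}. (-1) ^ (b' * b) *\<^sub>R (\<Sum>i=1..p+q. \<Sum>j=1..p+q.
        (hpart b f \<odot> Jcoef p b' (vpart p b' X) i j) \<otimes>\<^sub>s ?r i j)) =
      (if b' = c then (\<Sum>b\<in>{0,1}. (-1) ^ (c * b) *\<^sub>R ?U (hpart b f)) else 0)"
      by (cases "b' = c") (simp_all only: v[OF b'] v[OF c(2)] if_True if_False refl J J0 sprod_zero tens_zero sum.neutral_const scaleR_zero_right)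
  qed
  ultimately have "Lsym_tens p q d X f \<alpha> = sing \<alpha> (vapply p q X f) +
    (\<Sum>i=1..p+q. \<Sum>j=1..p+q. g f i j \<otimes>\<^sub>s ?r i j)"
    unfolding Lsym_tens_def g_def tens_mono_e using c(2)
    by (simp only: sum.delta finite.intros if_True flip_parity[OF c(1)])
  also have "(\<Sum>i=1..p+q. \<Sum>j=1..p+q. g f i j \<otimes>\<^sub>s ?r i j) =
    (\<Sum>i\<in>idx. \<Sum>j\<in>idx. (if i = j then - ((d * \<epsilon> i) *\<^sub>R sing \<alpha> (g f i i)) else 0) +
      symP j (symI i (sing \<alpha> (flip (par' i + par' j) (g f i j)))))"
  proof (intro sum.cong refl)
    fix i j assume ij: "i \<in> idx" "j \<in> idx"
    have "g f i j \<otimes>\<^sub>s ?r i j = (- d * (if i = j then \<epsilon> i else 0)) *\<^sub>R sing \<alpha> (g f i j) +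
        (g f i j \<otimes>\<^sub>s rho_word p q (elem_mat i j) (word \<alpha>))"
      unfolding rho_def tens_add tens_scaleR tens_mono_e str_elem_mat[OF ij] ..
    also have "g f i j \<otimes>\<^sub>s rho_word p q (elem_mat i j) (word \<alpha>) =
        symP j (symI i (sing \<alpha> (flip (par' i + par' j) (g f i j))))"
      using rho_word_elem_mat[OF \<alpha> ij, of "flip (par' i + par' j) (g f i j)"] by simp
    finally show "g f i j \<otimes>\<^sub>s ?r i j = (if i = j then - ((d * \<epsilon> i) *\<^sub>R sing \<alpha> (g f i i)) else 0) +
      symP j (symI i (sing \<alpha> (flip (par' i + par' j) (g f i j))))"
      by simp
  qed
  also have "\<dots> = - d *\<^sub>R (\<Sum>i\<in>idx. \<epsilon> i *\<^sub>R sing \<alpha> (g f i i)) +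
    (\<Sum>i\<in>idx. \<Sum>j\<in>idx. symP j (symI i (sing \<alpha> (flip (par' i + par' j) (g f i j)))))"
    by (simp add: sum.distrib scaleR_sum_right sum_negf sum_subtractf)
  finally show ?thesis by simp
qed

lemma Lsym_eqI:
  assumes S: "S \<in> V"
    and L: "\<And>\<alpha> f. \<alpha> \<in> midx p q \<Longrightarrow> f \<in> F \<Longrightarrow> Lsym_tens p q d X f \<alpha> = T (sing \<alpha> f)"
    and T_add: "\<And>S U. S \<in> V \<Longrightarrow> U \<in> V \<Longrightarrow> T (S + U) = T S + T U"
  shows "Lsym p q d X S = T S"
proof -
  have T0: "T 0 = 0" using T_add[of 0 0] by simp
  have m: "\<alpha> \<in> midx p q" if "S \<alpha> \<noteq> 0" for \<alpha> using symbols_midx[OF S that] .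
  have "Lsym p q d X S = (\<Sum>\<alpha> | S \<alpha> \<noteq> 0. T (sing \<alpha> (S \<alpha>)))"
    unfolding Lsym_def by (intro sum.cong refl) (simp add: L m S)
  also have "\<dots> = T (\<Sum>\<alpha> | S \<alpha> \<noteq> 0. sing \<alpha> (S \<alpha>))"
  proof -
    have "(\<Sum>\<alpha>\<in>A. sing \<alpha> (S \<alpha>)) \<in> V \<and> (\<Sum>\<alpha>\<in>A. T (sing \<alpha> (S \<alpha>))) = T (\<Sum>\<alpha>\<in>A. sing \<alpha> (S \<alpha>))"
      if "finite A" "A \<subseteq> {\<alpha>. S \<alpha> \<noteq> 0}" for A
      using that by (induction A) (auto simp: T0 T_add m S)
    then show ?thesis using symbols_finite[OF S] by blast
  qed
  also have "(\<Sum>\<alpha> | S \<alpha> \<noteq> 0. sing \<alpha> (S \<alpha>)) = S"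
    using symbols_decompose[OF symbols_finite[OF S] order_refl] ..
  finally show ?thesis .
qed

lemma Jcoef_field_add:
  "X \<in> fields \<Longrightarrow> Y \<in> fields \<Longrightarrow> i \<in> idx \<Longrightarrow> j \<in> idx \<Longrightarrow>
    Jcoef p a (X + Y) i j = Jcoef p a X i j + Jcoef p a Y i j"
  by (simp add: Jcoef_def fun_apply sderiv_add[of _ p q] scaleR_add_right)

lemma Jcoef_field_scaleR:
  "X \<in> fields \<Longrightarrow> i \<in> idx \<Longrightarrow> j \<in> idx \<Longrightarrow>
    Jcoef p a (c *\<^sub>R X) i j = c *\<^sub>R Jcoef p a X i j"
  by (simp add: Jcoef_def fun_apply sderiv_scaleR[of _ p q] scaleR_left_commute)

lemma Lsym_field_add:
  assumes X: "X \<in> fields" and Y: "Y \<in> fields"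
  shows "Lsym p q d (X + Y) S = Lsym p q d X S + Lsym p q d Y S"
proof -
  have "Lsym_tens p q d (X + Y) f \<alpha> = Lsym_tens p q d X f \<alpha> + Lsym_tens p q d Y f \<alpha>" for f \<alpha>
  proof -
    have "(\<Sum>i=1..p+q. \<Sum>j=1..p+q. (hpart b f \<odot> Jcoef p a (vpart p a (X + Y)) i j) \<otimes>\<^sub>s rho p q d (elem_mat i j) \<alpha>)
      = (\<Sum>i=1..p+q. \<Sum>j=1..p+q. (hpart b f \<odot> Jcoef p a (vpart p a X) i j) \<otimes>\<^sub>s rho p q d (elem_mat i j) \<alpha>) +
        (\<Sum>i=1..p+q. \<Sum>j=1..p+q. (hpart b f \<odot> Jcoef p a (vpart p a Y) i j) \<otimes>\<^sub>s rho p q d (elem_mat i j) \<alpha>)" for a b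
      unfolding sum.distrib[symmetric] using X Y
      by (intro sum.cong refl) (simp add: vpart_add Jcoef_field_add sprod_add_right tens_add_left)
    then show ?thesis
      unfolding Lsym_tens_def by (simp only: vapply_field_add tens_add_left scaleR_add_right sum.distrib add_ac)
  qed
  then show ?thesis by (simp add: Lsym_def sum.distrib)
qed

lemma Lsym_field_scaleR:
  assumes X: "X \<in> fields"
  shows "Lsym p q d (c *\<^sub>R X) S = c *\<^sub>R Lsym p q d X S"
proof -
  have "Lsym_tens p q d (c *\<^sub>R X) f \<alpha> = c *\<^sub>R Lsym_tens p q d X f \<alpha>" for f \<alpha>
  proof -
    have "(\<Sum>i=1..p+q. \<Sum>j=1..p+q. (hpart b f \<odot> Jcoef p a (vpart p a (c *\<^sub>R X)) i j) \<otimes>\<^sub>s rho p q d (elem_mat i j) \<alpha>)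
      = c *\<^sub>R (\<Sum>i=1..p+q. \<Sum>j=1..p+q. (hpart b f \<odot> Jcoef p a (vpart p a X) i j) \<otimes>\<^sub>s rho p q d (elem_mat i j) \<alpha>)" for a b
      unfolding scaleR_sum_right using X
      by (intro sum.cong refl) (simp add: vpart_scaleR Jcoef_field_scaleR tens_scaleR_left)
    then show ?thesis
      unfolding Lsym_tens_def
      by (simp only: vapply_field_scaleR tens_scaleR_left scaleR_add_right scaleR_sum_right
          scaleR_scaleR mult.commute)
  qed
  then show ?thesis by (simp add: Lsym_def scaleR_sum_right)
qed

end

section \<open>The projective fields\<close>

context superspace
begin

text \<open>The conclusion \<open>X i \<in> F\<close> of this rule matches any membership, which makes the simplifier
  loop once \<open>fields\<close> is unfolded.\<close>

declare fieldsD [simp del]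

text \<open>The fields \<partial>_i, y_j \<partial>_i and y_c times the Euler field are homogeneous
  and span the projective fields; equivariance is checked on them.\<close>

definition const_field :: "nat \<Rightarrow> vfield" where
  "const_field i = (\<lambda>k. if k = i then sone else 0)"

definition lin_field :: "nat \<Rightarrow> nat \<Rightarrow> vfield" where
  "lin_field j i = (\<lambda>k. if k = i then coord p j else 0)"

definition quad_field :: "nat \<Rightarrow> vfield" where
  "quad_field c = (\<lambda>k. coord p c \<odot> coord p k)"

lemma const_field_fields [simp]: "const_field i \<in> fields"
  by (simp add: fields_def const_field_def)

lemma lin_field_fields [simp]: "j \<in> idx \<Longrightarrow> lin_field j i \<in> fields"
  by (simp add: fields_def lin_field_def)

lemma quad_field_fields [simp]: "c \<in> idx \<Longrightarrow> quad_field c \<in> fields"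
  by (simp add: fields_def quad_field_def)

lemma const_field_homogeneous: "homogeneous p (par' i) (const_field i)"
  by (simp add: homogeneous_def const_field_def flip: mult_2)

lemma lin_field_homogeneous: "homogeneous p (par' i + par' j) (lin_field j i)"
  by (simp add: homogeneous_def lin_field_def flip_coord power_add)

lemma quad_field_homogeneous: "homogeneous p (par' c) (quad_field c)"
  by (simp add: homogeneous_def quad_field_def flip_sprod flip_coord power_add)

lemma vdiv_eq:
  assumes "X \<in> fields"
  shows "vdiv p q X = (\<Sum>k\<in>idx. sderiv p k (flip (par' k) (X k)))"
  unfolding vdiv_def
proof (rule sum.cong[OF refl])
  fix k assume k: "k \<in> idx"
  have "(\<Sum>a\<in>{0,1}. (-1) ^ (par' k * a) *\<^sub>R sderiv p k (hpart a (X k))) =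
      sderiv p k (\<Sum>a\<in>{0,1}. (-1) ^ (par' k * a) *\<^sub>R hpart a (X k))"
    using k assms by (simp add: sderiv_add[of _ p q] sderiv_scaleR[of _ p q] fieldsD)
  then show "(\<Sum>a\<in>{0,1}. (-1) ^ (par' k * a) *\<^sub>R sderiv p k (hpart a (X k))) =
      sderiv p k (flip (par' k) (X k))"
    unfolding flip_eq_sum_hpart .
qed

lemma Ldens_const_field:
  assumes "f \<in> F" "i \<in> idx"
  shows "Ldens p q l (const_field i) f = sderiv p i f"
proof -
  have "sderiv p k (flip (par' k) (const_field i k)) = 0" for k
    by (simp add: const_field_def)
  then have "vdiv p q (const_field i) = 0"
    by (simp add: vdiv_eq)
  moreover have "vapply p q (const_field i) f = (\<Sum>k\<in>idx. if k = i then sderiv p i f else 0)"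
    unfolding vapply_def using assms
    by (intro sum.cong refl) (auto simp: const_field_def sone_sprod[of _ p q])
  ultimately show ?thesis using assms by (simp add: Ldens_def)
qed

lemma Ldens_lin_field:
  assumes "f \<in> F" "i \<in> idx" "j \<in> idx"
  shows "Ldens p q l (lin_field j i) f =
    coord p j \<odot> sderiv p i f + (if i = j then (l * \<epsilon> j) *\<^sub>R f else 0)"
proof -
  have "vdiv p q (lin_field j i) = (\<Sum>k\<in>idx. if k = i then (if i = j then \<epsilon> j *\<^sub>R sone else 0) else 0)"
    unfolding vdiv_eq[OF lin_field_fields[OF assms(3)]]
  proof (rule sum.cong[OF refl])
    fix k assume "k \<in> idx"
    then show "sderiv p k (flip (par' k) (lin_field j i k)) =
        (if k = i then if i = j then \<epsilon> j *\<^sub>R sone else 0 else 0)"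
      using assms by (simp add: lin_field_def flip_coord sderiv_scaleR[of _ p q] sderiv_coord[of _ _ q])
  qed
  moreover have "vapply p q (lin_field j i) f = (\<Sum>k\<in>idx. if k = i then coord p j \<odot> sderiv p i f else 0)"
    unfolding vapply_def by (intro sum.cong refl) (auto simp: lin_field_def)
  ultimately show ?thesis using assms by (simp add: Ldens_def sone_sprod[of _ p q])
qed

lemma sum_parity_signs: "(\<Sum>k\<in>idx. \<epsilon> k) = real p - real q"
proof -
  have "idx = {1..p} \<union> {p+1..p+q}" by auto
  then have "(\<Sum>k\<in>idx. \<epsilon> k) = (\<Sum>k\<in>{1..p}. \<epsilon> k) + (\<Sum>k\<in>{p+1..p+q}. \<epsilon> k)"
    by (simp only: ) (rule sum.union_disjoint, auto)
  also have "(\<Sum>k\<in>{1..p}. \<epsilon> k) = (\<Sum>k\<in>{1..p}. 1)" by (intro sum.cong) (auto simp: par_def)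
  also have "(\<Sum>k\<in>{p+1..p+q}. \<epsilon> k) = (\<Sum>k\<in>{p+1..p+q}. -1)" by (intro sum.cong) (auto simp: par_def)
  finally show ?thesis by simp
qed

lemma sderiv_quad:
  assumes "k \<in> idx" "l \<in> idx" "c \<in> idx"
  shows "sderiv p k (coord p c \<odot> coord p l) =
    (if k = l then \<sigma> k c *\<^sub>R coord p c else 0) + (if k = c then coord p l else 0)"
  using assms by (simp add: sderiv_coord_sprod[of _ p q] sderiv_coord[of _ _ q] sprod_sone[of _ p q])

text \<open>The divergence is (p - q + 1) y_c: every index k contributes \<epsilon>_k y_c, and k = c
  contributes one further y_c. Hence the density weight disappears from the action.\<close>

lemma Ldens_quad_field:
  assumes "f \<in> F" "c \<in> idx" "q = p + 1"
  shows "Ldens p q l (quad_field c) f = (\<Sum>k\<in>idx. coord p c \<odot> (coord p k \<odot> sderiv p k f))"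
proof -
  have "vdiv p q (quad_field c) = (\<Sum>k\<in>idx. \<epsilon> k *\<^sub>R coord p c + (if k = c then coord p c else 0))"
    unfolding vdiv_eq[OF quad_field_fields[OF assms(2)]]
  proof (rule sum.cong[OF refl])
    fix k assume k: "k \<in> idx"
    have "sderiv p k (flip (par' k) (quad_field c k)) =
        (\<sigma> k c * \<epsilon> k) *\<^sub>R sderiv p k (coord p c \<odot> coord p k)"
      using k assms by (simp add: quad_field_def flip_sprod flip_coord sderiv_scaleR[of _ p q] sg_def mult.commute)
    also have "\<dots> = \<epsilon> k *\<^sub>R coord p c + (if k = c then coord p c else 0)"
      using k assms(2) by (auto simp: sderiv_quad scaleR_add_right sg_self mult.commute[of _ "\<epsilon> k"] mult.assoc)
    finally show "sderiv p k (flip (par' k) (quad_field c k)) = \<epsilon> k *\<^sub>R coord p c + (if k = c then coord p c else 0)" .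
  qed
  also have "\<dots> = (\<Sum>k\<in>idx. \<epsilon> k) *\<^sub>R coord p c + coord p c"
    using assms(2) by (simp add: sum.distrib scaleR_sum_left)
  also have "\<dots> = 0"
    unfolding sum_parity_signs using assms(3) by simp
  finally have "vdiv p q (quad_field c) = 0" .
  then show ?thesis
    by (simp add: Ldens_def vapply_def quad_field_def coord_sprod_assoc)
qed

definition opE :: "symbol \<Rightarrow> symbol" where
  "opE S = (\<Sum>k\<in>idx. symY k (symD k S))"

text \<open>Left multiplication by the symbol of the Euler field.\<close>

definition opW :: "symbol \<Rightarrow> symbol" where
  "opW S = (\<Sum>k\<in>idx. symY k (symP k S))"

text \<open>This and \<open>quad_op\<close> are the Lie derivatives of symbols along
  \<open>lin_field\<close> and, for \<open>q = p + 1\<close>, along \<open>quad_field\<close>,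
  written in the canonical operators.\<close>

definition lin_op :: "real \<Rightarrow> nat \<Rightarrow> nat \<Rightarrow> symbol \<Rightarrow> symbol" where
  "lin_op d j i S = symY j (symD i S) - (\<sigma> i j * \<epsilon> j) *\<^sub>R symP i (symI j S)
     + (if i = j then (d * \<epsilon> j) *\<^sub>R S else 0)"

definition quad_op :: "nat \<Rightarrow> symbol \<Rightarrow> symbol" where
  "quad_op c S = symY c (opE S) - degscale real (symY c S) - \<epsilon> c *\<^sub>R opW (symI c S)"

lemma V_opE [simp]: "S \<in> V \<Longrightarrow> opE S \<in> V"
  unfolding opE_def by (rule V_sum) simp

lemma V_opW [simp]: "S \<in> V \<Longrightarrow> opW S \<in> V"
  unfolding opW_def by (rule V_sum) simp

lemma V_lin_op [simp]: "S \<in> V \<Longrightarrow> i \<in> idx \<Longrightarrow> j \<in> idx \<Longrightarrow> lin_op d j i S \<in> V"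
  by (simp add: lin_op_def)

lemma V_quad_op [simp]: "S \<in> V \<Longrightarrow> c \<in> idx \<Longrightarrow> quad_op c S \<in> V"
  by (simp add: quad_op_def)

lemma opE_add: "S \<in> V \<Longrightarrow> T \<in> V \<Longrightarrow> opE (S + T) = opE S + opE T"
  by (simp add: opE_def symD_add symY_add sum.distrib)

lemma opW_add: "opW (S + T) = opW S + opW T"
  by (simp add: opW_def symP_add symY_add sum.distrib)

lemma opW_scaleR: "opW (c *\<^sub>R S) = c *\<^sub>R opW S"
  by (simp add: opW_def symP_scaleR symY_scaleR scaleR_sum_right)

lemma lin_op_add: "S \<in> V \<Longrightarrow> T \<in> V \<Longrightarrow> i \<in> idx \<Longrightarrow> lin_op d j i (S + T) = lin_op d j i S + lin_op d j i T"
  by (simp add: lin_op_def symD_add symY_add symI_add symP_add scaleR_add_right)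

lemma quad_op_add: "S \<in> V \<Longrightarrow> T \<in> V \<Longrightarrow> quad_op c (S + T) = quad_op c S + quad_op c T"
  by (simp add: quad_op_def opE_add opW_add symY_add symI_add degscale_add scaleR_add_right)

subsection \<open>Action on operators\<close>

text \<open>Precomposition reverses the order, so the coordinate acts on the symbol before p_i does.
  The factor \<open>\<sigma> i j\<close> appears when the flip of parity par i + par j is split and
  its part for \<open>i\<close> is moved across the coordinate.\<close>

lemma Qaff_YD_right:
  assumes ij: "i \<in> idx" "j \<in> idx" and S: "S \<in> V" and f: "f \<in> F"
  shows "flip (par' i + par' j) (Qaff p q S (flip (par' i + par' j) (coord p j \<odot> sderiv p i f))) =
    Qaff p q (\<sigma> i j *\<^sub>R symP i (symY j S + \<epsilon> j *\<^sub>R symI j S)) f"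
proof -
  let ?T = "symY j S + \<epsilon> j *\<^sub>R symI j S"
  have T: "?T \<in> V" using S ij by simp
  have "flip (par' i + par' j) (coord p j \<odot> sderiv p i f) =
      \<sigma> i j *\<^sub>R flip (par' j) (coord p j \<odot> flip (par' i) (sderiv p i f))"
    by (simp add: flip_sprod flip_coord flip_flip sg_def add.commute power_add add_mult_distrib)
  then have "flip (par' i + par' j) (Qaff p q S (flip (par' i + par' j) (coord p j \<odot> sderiv p i f))) =
    \<sigma> i j *\<^sub>R flip (par' i) (flip (par' j) (Qaff p q S (flip (par' j) (coord p j \<odot> flip (par' i) (sderiv p i f)))))"
    using S ij f by (simp add: Qaff_arg_scaleR flip_flip)
  also have "\<dots> = \<sigma> i j *\<^sub>R flip (par' i) (Qaff p q ?T (flip (par' i) (sderiv p i f)))"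
    using S ij f by (simp add: Qaff_Y_right)
  also have "\<dots> = Qaff p q (\<sigma> i j *\<^sub>R symP i ?T) f"
    using T ij f by (simp only: Qaff_D_right Qaff_scaleR V_symP)
  finally show ?thesis .
qed

lemma Lop_const_field:
  assumes "i \<in> idx" "S \<in> V"
  shows "Lop p q l m (const_field i) (Qaff p q S) = Qaff p q (symD i S)"
proof
  fix f
  show "Lop p q l m (const_field i) (Qaff p q S) f = Qaff p q (symD i S) f"
  proof (cases "f \<in> F")
    case True
    then show ?thesis using assms
      by (simp add: Lop_homogeneous[OF const_field_fields const_field_homogeneous]
          Ldens_const_field Qaff_D_left Qaff_D_right)
  qed (simp add: Lop_outside Qaff_outside)
qed

text \<open>The order-raising term y_j p_i occurs in both compositions and cancels; the density
  terms leave the difference \<open>m - l\<close>.\<close>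

lemma Lop_lin_field:
  assumes ij: "i \<in> idx" "j \<in> idx" and S: "S \<in> V"
  shows "Lop p q l m (lin_field j i) (Qaff p q S) = Qaff p q (lin_op (m - l) j i S)"
proof
  fix f
  show "Lop p q l m (lin_field j i) (Qaff p q S) f = Qaff p q (lin_op (m - l) j i S) f"
  proof (cases "f \<in> F")
    case f: True
    let ?a = "par' i + par' j"
    have 1: "Ldens p q m (lin_field j i) (Qaff p q S f) =
        Qaff p q (symY j (symD i S) + symY j (symP i S) + (if i = j then (m * \<epsilon> j) *\<^sub>R S else 0)) f"
      using S ij f
      by (simp add: Ldens_lin_field Qaff_D_left sprod_add_right Qaff_Y_left Qaff_add Qaff_scaleR)
    have "flip ?a (Qaff p q S (flip ?a (if i = j then (l * \<epsilon> j) *\<^sub>R f else 0))) =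
        Qaff p q (if i = j then (l * \<epsilon> j) *\<^sub>R S else 0) f"
    proof (cases "i = j")
      case True
      have "flip (par' j + par' j) g = g" for g using flip_parity[of "par' j + par' j" 0 g] by simp
      then show ?thesis using True S f by (simp add: Qaff_arg_scaleR Qaff_scaleR)
    qed (use Qaff_arg_scaleR[OF S f, of 0] in simp)
    then have 2: "flip ?a (Qaff p q S (flip ?a (Ldens p q l (lin_field j i) f))) =
       Qaff p q (\<sigma> i j *\<^sub>R symP i (symY j S + \<epsilon> j *\<^sub>R symI j S) + (if i = j then (l * \<epsilon> j) *\<^sub>R S else 0)) f"
      using S ij f Qaff_YD_right[OF ij S f]
      by (simp add: Ldens_lin_field Qaff_arg_add Qaff_add)
    have sym: "\<sigma> i j *\<^sub>R symP i (symY j S + \<epsilon> j *\<^sub>R symI j S) =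
        symY j (symP i S) + (\<sigma> i j * \<epsilon> j) *\<^sub>R symP i (symI j S)"
      by (simp add: symP_add symP_scaleR symPY[of i j] sg_commute[of p j i] scaleR_add_right)
    have "Lop p q l m (lin_field j i) (Qaff p q S) f =
      Qaff p q ((symY j (symD i S) + symY j (symP i S) + (if i = j then (m * \<epsilon> j) *\<^sub>R S else 0)) -
        (symY j (symP i S) + (\<sigma> i j * \<epsilon> j) *\<^sub>R symP i (symI j S) + (if i = j then (l * \<epsilon> j) *\<^sub>R S else 0))) f"
      unfolding Lop_homogeneous[OF lin_field_fields[OF ij(2)] lin_field_homogeneous S f] 1 2 sym
      by (rule Qaff_diff[symmetric]) (use S ij in simp_all)
    also have "(symY j (symD i S) + symY j (symP i S) + (if i = j then (m * \<epsilon> j) *\<^sub>R S else 0)) -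
        (symY j (symP i S) + (\<sigma> i j * \<epsilon> j) *\<^sub>R symP i (symI j S) + (if i = j then (l * \<epsilon> j) *\<^sub>R S else 0))
      = lin_op (m - l) j i S"
      by (simp add: lin_op_def left_diff_distrib scaleR_diff_left)
    finally show ?thesis .
  qed (simp add: Lop_outside Qaff_outside)
qed

lemma opW_symY:
  "opW (symY c S) = symY c (opW S)"
  unfolding opW_def symY_sum
  by (intro sum.cong refl) (simp add: symPY[of _ c] symY_scaleR symYY[of _ c] sg_commute[of p c])

lemma sum_YP_right:
  assumes "U \<in> V"
  shows "(\<Sum>k\<in>idx. \<sigma> k k *\<^sub>R symP k (symY k U + \<epsilon> k *\<^sub>R symI k U)) = opW U + degscale real U"
  unfolding opW_def sum_symPI[OF assms, symmetric] sum.distrib[symmetric]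
  by (intro sum.cong refl) (simp add: symP_add symP_scaleR symPY scaleR_add_right, simp add: sg_self)

text \<open>The operators y_c W, with W the operator \<open>opW\<close>, cancel between the two
  compositions. Precomposition with the Euler field adds N U, where U = y_c S + \<epsilon>_c
  \<iota>_c S: its first part belongs to \<open>quad_op\<close>, its second part is the correction
  that makes the affine quantization fail to be equivariant.\<close>

lemma Lop_quad_field:
  assumes c: "c \<in> idx" and S: "S \<in> V" and q: "q = p + 1"
  shows "Lop p q l m (quad_field c) (Qaff p q S) =
    Qaff p q (quad_op c S - \<epsilon> c *\<^sub>R degscale real (symI c S))"
proof
  fix f
  show "Lop p q l m (quad_field c) (Qaff p q S) f =
    Qaff p q (quad_op c S - \<epsilon> c *\<^sub>R degscale real (symI c S)) f"
  proof (cases "f \<in> F")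
    case f: True
    \<comment> \<open>The symbol obtained by precomposing with y_c, up to the conjugation by
      flips.\<close>
    define U where "U = symY c S + \<epsilon> c *\<^sub>R symI c S"
    have U: "U \<in> V" using S c by (simp add: U_def)
    have "Ldens p q m (quad_field c) (Qaff p q S f) =
        (\<Sum>k\<in>idx. Qaff p q (symY c (symY k (symD k S)) + symY c (symY k (symP k S))) f)"
      unfolding Ldens_quad_field[OF Qaff_sfuns[OF S] c q] using S f c
      by (intro sum.cong refl) (simp add: Qaff_D_left sprod_add_right Qaff_Y_left Qaff_add)
    also have "\<dots> = Qaff p q (\<Sum>k\<in>idx. symY c (symY k (symD k S)) + symY c (symY k (symP k S))) f"
      using S c by (intro Qaff_sum[symmetric]) simp
    finally have 1: "Ldens p q m (quad_field c) (Qaff p q S f) = Qaff p q (symY c (opE S) + symY c (opW S)) f"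
      by (simp only: sum.distrib symY_sum[symmetric] opE_def opW_def)
    have YkDk: "Qaff p q U (coord p k \<odot> sderiv p k f) =
        Qaff p q (\<sigma> k k *\<^sub>R symP k (symY k U + \<epsilon> k *\<^sub>R symI k U)) f" if "k \<in> idx" for k
    proof -
      have "flip (par' k + par' k) g = g" for g using flip_parity[of "par' k + par' k" 0 g] by simp
      then show ?thesis using Qaff_YD_right[OF that that U f] by simp
    qed
    have "flip (par' c) (Qaff p q S (flip (par' c) (Ldens p q l (quad_field c) f))) =
        (\<Sum>k\<in>idx. flip (par' c) (Qaff p q S (flip (par' c) (coord p c \<odot> (coord p k \<odot> sderiv p k f)))))"
      unfolding Ldens_quad_field[OF f c q] flip_sum
      using S c f by (subst Qaff_arg_sum) (simp_all add: flip_sum)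
    also have "\<dots> = (\<Sum>k\<in>idx. Qaff p q U (coord p k \<odot> sderiv p k f))"
      using S c f by (intro sum.cong refl) (simp add: Qaff_Y_right U_def)
    also have "\<dots> = (\<Sum>k\<in>idx. Qaff p q (\<sigma> k k *\<^sub>R symP k (symY k U + \<epsilon> k *\<^sub>R symI k U)) f)"
      by (intro sum.cong refl YkDk)
    also have "\<dots> = Qaff p q (\<Sum>k\<in>idx. \<sigma> k k *\<^sub>R symP k (symY k U + \<epsilon> k *\<^sub>R symI k U)) f"
      using U by (intro Qaff_sum[symmetric]) simp
    also have "\<dots> = Qaff p q (opW U + degscale real U) f"
      by (simp only: sum_YP_right[OF U])
    finally have "Lop p q l m (quad_field c) (Qaff p q S) f =
        Qaff p q (symY c (opE S) + symY c (opW S) - (opW U + degscale real U)) f"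
      using S U c unfolding Lop_homogeneous[OF quad_field_fields[OF c] quad_field_homogeneous S f] 1
      by (simp add: Qaff_diff)
    also have "symY c (opE S) + symY c (opW S) - (opW U + degscale real U) =
        quad_op c S - \<epsilon> c *\<^sub>R degscale real (symI c S)"
      by (simp add: U_def quad_op_def opW_add opW_scaleR opW_symY degscale_add degscale_scaleR)
    finally show ?thesis .
  qed (simp add: Lop_outside Qaff_outside)
qed

subsection \<open>Action on symbols\<close>

lemma Lsym_const_field:
  assumes "i \<in> idx" "S \<in> V"
  shows "Lsym p q d (const_field i) S = symD i S"
proof (rule Lsym_eqI[OF assms(2)])
  fix \<alpha> f assume \<alpha>: "\<alpha> \<in> midx p q" and f: "f \<in> F"
  have "vapply p q (const_field i) f = sderiv p i f"
    using Ldens_const_field[OF f assms(1), of 0] by (simp add: Ldens_def)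
  moreover have "Jcoef p a (const_field i) k l = 0" for a k l
    by (simp add: Jcoef_def const_field_def if_distrib[of "sderiv p k"])
  ultimately show "Lsym_tens p q d (const_field i) f \<alpha> = symD i (sing \<alpha> f)"
    unfolding Lsym_tens_homogeneous[OF const_field_homogeneous \<alpha>] by (simp add: symD_sing)
qed (use assms in \<open>simp add: symD_add\<close>)

lemma Lsym_lin_field:
  assumes ij: "i \<in> idx" "j \<in> idx" and S: "S \<in> V"
  shows "Lsym p q d (lin_field j i) S = lin_op d j i S"
proof (rule Lsym_eqI[OF S])
  fix \<alpha> f assume \<alpha>: "\<alpha> \<in> midx p q" and f: "f \<in> F"
  let ?a = "par' i + par' j"
  let ?g = "\<lambda>k l. flip ?a f \<odot> Jcoef p ?a (lin_field j i) k l"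
  let ?C = "- ((\<sigma> i j * \<epsilon> j) *\<^sub>R symP i (symI j (sing \<alpha> f)))"
  have ap: "vapply p q (lin_field j i) f = coord p j \<odot> sderiv p i f"
    using Ldens_lin_field[OF f ij, of 0] by (simp add: Ldens_def)
  have g: "?g k l =
      (if k = j then if l = i then - ((\<sigma> i j * \<epsilon> j) *\<^sub>R flip ?a f) else 0 else 0)"
    if "k \<in> idx" "l \<in> idx" for k l
    using that ij f
    by (auto simp: Jcoef_def lin_field_def sderiv_coord[of _ _ q] sprod_sone[of _ p q] sg_def
        add_mult_distrib2 power_add mult_ac)
  have "(\<Sum>k\<in>idx. \<epsilon> k *\<^sub>R sing \<alpha> (?g k k)) =
      (\<Sum>k\<in>idx. if k = j then if i = j then - (\<epsilon> j *\<^sub>R sing \<alpha> f) else 0 else 0)"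
  proof (rule sum.cong[OF refl])
    fix k assume k: "k \<in> idx"
    have fl: "flip (par' j + par' j) f = f" using flip_parity[of "par' j + par' j" 0 f] by simp
    have "sing \<alpha> (- h) = - sing \<alpha> h" for h using sing_scaleR[of \<alpha> "-1" h] by simp
    then show "\<epsilon> k *\<^sub>R sing \<alpha> (?g k k) =
        (if k = j then if i = j then - (\<epsilon> j *\<^sub>R sing \<alpha> f) else 0 else 0)"
      unfolding g[OF k k] by (auto simp: fl sg_self sing_scaleR)
  qed
  then have tr: "(\<Sum>k\<in>idx. \<epsilon> k *\<^sub>R sing \<alpha> (?g k k)) =
      (if i = j then - (\<epsilon> j *\<^sub>R sing \<alpha> f) else 0)"
    using ij by simp
  have "(\<Sum>k\<in>idx. \<Sum>l\<in>idx. symP l (symI k (sing \<alpha> (flip (par' k + par' l)(?g k l))))) =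
      (\<Sum>k\<in>idx. \<Sum>l\<in>idx. if k = j then if l = i then
        ?C else 0 else 0)"
  proof (intro sum.cong refl)
    fix k l assume kl: "k \<in> idx" "l \<in> idx"
    have "sing \<alpha> (- h) = - sing \<alpha> h" for h using sing_scaleR[of \<alpha> "-1" h] by simp
    moreover have "symI j (- h) = - symI j h" for h using symI_scaleR[of j "-1" h] by simp
    moreover have "symP j (- h) = - symP j h" for j h using symP_scaleR[of j "-1" h] by simp
    ultimately show "symP l (symI k (sing \<alpha> (flip (par' k + par' l)(?g k l)))) = (if k = j then if l = i then
        ?C else 0 else 0)"
      unfolding g[OF kl]
      by (auto simp: sing_scaleR symI_scaleR symP_scaleR add.commute[of "par' j" "par' i"])
  qed
  also have "\<dots> = ?C"
  proof -
    have "(\<Sum>l\<in>idx. if k = j then if l = i then C else 0 else 0) =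
        (if k = j then C else 0)" for k and C :: symbol
      using ij by simp
    then show ?thesis using ij by simp
  qed
  finally show "Lsym_tens p q d (lin_field j i) f \<alpha> = lin_op d j i (sing \<alpha> f)"
    unfolding Lsym_tens_homogeneous[OF lin_field_homogeneous \<alpha>] tr ap
    by (simp add: lin_op_def symY_sing symD_sing)
qed (use ij in \<open>simp add: lin_op_add\<close>)

text \<open>The derivative of the coefficients y_c y_l has a diagonal part, which acts through sum
  p_k \<iota>_k = N, and a part supported in row \<open>c\<close>, which acts through
  \<open>opW\<close> and \<iota>_c. The supertrace term carries the factor p - q + 1 = 0, so the
  weight \<open>d\<close> drops out.\<close>

lemma Lsym_quad_field:
  assumes c: "c \<in> idx" and S: "S \<in> V" and q: "q = p + 1"
  shows "Lsym p q d (quad_field c) S = quad_op c S"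
proof (rule Lsym_eqI[OF S])
  fix \<alpha> f assume \<alpha>: "\<alpha> \<in> midx p q" and f: "f \<in> F"
  let ?s = "sing \<alpha> f"
  have s: "?s \<in> V" using \<alpha> f by simp
  have sing_minus: "sing \<alpha> (- h) = - sing \<alpha> h" for h using sing_scaleR[of \<alpha> "-1" h] by simp
  have sing_add: "sing \<alpha> (h + h') = sing \<alpha> h + sing \<alpha> h'" for h h'
    by (rule ext) (simp add: sing_def fun_apply)
  have symI_minus: "symI j (- h) = - symI j h" for j h using symI_scaleR[of j "-1" h] by simp
  have symP_minus: "symP j (- h) = - symP j h" for j h using symP_scaleR[of j "-1" h] by simp
  have "vapply p q (quad_field c) f = (\<Sum>k\<in>idx. coord p c \<odot> (coord p k \<odot> sderiv p k f))"
    using Ldens_quad_field[OF f c q, of 0] by (simp add: Ldens_def)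
  then have ap: "sing \<alpha> (vapply p q (quad_field c) f) = symY c (opE ?s)"
    by (simp add: opE_def symD_sing symY_sing symY_sum)
      (rule ext, auto simp: sing_def sum_fun_apply)
  define g where "g k l = flip (par' c) f \<odot> Jcoef p (par' c) (quad_field c) k l" for k l
  have sprod_coord: "h \<odot> coord p l = coord p l \<odot> flip (par' l) h" if "h \<in> F" "l \<in> idx" for h l
    using flip_sprod_coord[of p l "flip (par' l) h" sone] that by (simp add: sprod_sone[of _ p q])
  have g: "g k l = - (if k = l then coord p c \<odot> f else 0)
      - (if k = c then \<epsilon> c *\<^sub>R (coord p l \<odot> flip (par' c + par' l) f) else 0)"
    if "k \<in> idx" "l \<in> idx" for k l
  proof -
    have "Jcoef p (par' c) (quad_field c) k l =
        - (if k = l then coord p c else 0) - (if k = c then \<epsilon> c *\<^sub>R coord p l else 0)"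
      using that c by (auto simp: Jcoef_def quad_field_def sderiv_quad sg_def scaleR_add_right)
    then show ?thesis
      using that c f by (auto simp: g_def sprod_diff_right sprod_coord flip_flip add.commute)
  qed
  have "(\<Sum>k\<in>idx. \<epsilon> k *\<^sub>R sing \<alpha> (g k k)) =
      (\<Sum>k\<in>idx. - (\<epsilon> k *\<^sub>R sing \<alpha> (coord p c \<odot> f)) - (if k = c then sing \<alpha> (coord p c \<odot> f) else 0))"
  proof (rule sum.cong[OF refl])
    fix k assume k: "k \<in> idx"
    have fl: "flip (par' c + par' c) f = f" using flip_parity[of "par' c + par' c" 0 f] by simp
    show "\<epsilon> k *\<^sub>R sing \<alpha> (g k k) =
        - (\<epsilon> k *\<^sub>R sing \<alpha> (coord p c \<odot> f)) - (if k = c then sing \<alpha> (coord p c \<odot> f) else 0)"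
      unfolding g[OF k k] diff_conv_add_uminus sing_add sing_minus
      by (auto simp: fl sing_scaleR scaleR_diff_right)
  qed
  also have "\<dots> = - ((\<Sum>k\<in>idx. \<epsilon> k) + 1) *\<^sub>R sing \<alpha> (coord p c \<odot> f)"
    using c by (simp add: sum_subtractf sum_negf scaleR_sum_left scaleR_left_distrib scaleR_diff_left)
  also have "\<dots> = 0"
    unfolding sum_parity_signs using q by simp
  finally have tr: "(\<Sum>k\<in>idx. \<epsilon> k *\<^sub>R sing \<alpha> (g k k)) = 0" .
  have "(\<Sum>k\<in>idx. \<Sum>l\<in>idx. symP l (symI k (sing \<alpha> (flip (par' k + par' l) (g k l))))) =
      (\<Sum>k\<in>idx. \<Sum>l\<in>idx. - (if k = l then symP k (symI k (symY c ?s)) else 0)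
        - (if k = c then \<epsilon> c *\<^sub>R symY l (symP l (symI c ?s)) else 0))"
  proof (intro sum.cong refl)
    fix k l assume kl: "k \<in> idx" "l \<in> idx"
    have fl: "flip (par' k + par' k) h = h" for k h using flip_parity[of "par' k + par' k" 0 h] by simp
    have "flip (par' c + par' l) (coord p l \<odot> flip (par' c + par' l) f) =
        (\<sigma> c l * \<epsilon> l) *\<^sub>R (coord p l \<odot> f)"
      by (simp add: flip_sprod flip_coord add_mult_distrib power_add sg_def)
    moreover have "(\<sigma> c l * \<epsilon> l) *\<^sub>R symP l (symI c (symY l ?s)) = symY l (symP l (symI c ?s))"
      by (simp add: symIY[of c l] symP_scaleR symPY[of l l] sg_commute[of p l c] sg_self mult_ac)
    ultimately have B: "symP l (symI c (sing \<alpha> (flip (par' c + par' l) (coord p l \<odot> flip (par' c + par' l) f))))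
      = symY l (symP l (symI c ?s))"
      by (simp only: sing_scaleR symI_scaleR symP_scaleR symY_sing[symmetric])
    show "symP l (symI k (sing \<alpha> (flip (par' k + par' l) (g k l)))) =
      - (if k = l then symP k (symI k (symY c ?s)) else 0)
        - (if k = c then \<epsilon> c *\<^sub>R symY l (symP l (symI c ?s)) else 0)"
      unfolding g[OF kl] diff_conv_add_uminus flip_add flip_minus sing_add sing_minus symI_add symP_add
        symI_minus symP_minus
      using B by (auto simp: fl sing_scaleR symI_scaleR symP_scaleR symY_sing)
  qed
  also have "\<dots> = - degscale real (symY c ?s) - \<epsilon> c *\<^sub>R opW (symI c ?s)"
  proof -
    have "(\<Sum>k\<in>idx. \<Sum>l\<in>idx. (if k = l then symP k (symI k (symY c ?s)) else 0)) = degscale real (symY c ?s)"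
      using s c by (simp flip: sum_symPI)
    moreover have "(\<Sum>k\<in>idx. \<Sum>l\<in>idx. (if k = c then \<epsilon> c *\<^sub>R symY l (symP l (symI c ?s)) else 0)) =
        \<epsilon> c *\<^sub>R opW (symI c ?s)"
      using c by (subst sum.swap) (simp add: opW_def scaleR_sum_right)
    ultimately show ?thesis
      by (simp only: sum_subtractf sum_negf)
  qed
  finally show "Lsym_tens p q d (quad_field c) f \<alpha> = quad_op c ?s"
    unfolding Lsym_tens_homogeneous[OF quad_field_homogeneous \<alpha>] g_def[symmetric] ap tr
    by (simp add: quad_op_def)
qed (use c in \<open>simp add: quad_op_add\<close>)

end

section \<open>The divergence and the projective fields\<close>

context superspace
begin

abbreviation \<Delta> :: "symbol \<Rightarrow> symbol" where "\<Delta> \<equiv> sym_div p q"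

lemma V_div [simp]: "S \<in> V \<Longrightarrow> \<Delta> S \<in> V"
  unfolding sym_div_eq by (rule V_sum) simp

lemma V_div_power [simp]: "S \<in> V \<Longrightarrow> (\<Delta> ^^ r) S \<in> V"
  by (induction r) simp_all

lemma div_add: "S \<in> V \<Longrightarrow> T \<in> V \<Longrightarrow> \<Delta> (S + T) = \<Delta> S + \<Delta> T"
  by (simp add: sym_div_eq symD_add symI_add scaleR_add_right sum.distrib)

lemma div_scaleR: "S \<in> V \<Longrightarrow> \<Delta> (c *\<^sub>R S) = c *\<^sub>R \<Delta> S"
  by (simp add: sym_div_eq symD_scaleR symI_scaleR scaleR_sum_right mult_ac)

lemma div_diff: "S \<in> V \<Longrightarrow> T \<in> V \<Longrightarrow> \<Delta> (S - T) = \<Delta> S - \<Delta> T"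
  using div_add[of S "- T"] div_scaleR[of T "-1"] by simp

lemma div_zero [simp]: "\<Delta> 0 = 0"
  using div_scaleR[of 0 0] by simp

lemma div_sum: "(\<And>i. i \<in> A \<Longrightarrow> S i \<in> V) \<Longrightarrow> \<Delta> (\<Sum>i\<in>A. S i) = (\<Sum>i\<in>A. \<Delta> (S i))"
  by (induction A rule: infinite_finite_induct) (simp_all add: div_add V_sum)

lemma div_power_add: "S \<in> V \<Longrightarrow> T \<in> V \<Longrightarrow> (\<Delta> ^^ r) (S + T) = (\<Delta> ^^ r) S + (\<Delta> ^^ r) T"
  by (induction r) (simp_all add: div_add)

lemma div_power_scaleR: "S \<in> V \<Longrightarrow> (\<Delta> ^^ r) (c *\<^sub>R S) = c *\<^sub>R (\<Delta> ^^ r) S"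
  by (induction r) (simp_all add: div_scaleR)

lemma div_power_sum: "(\<And>i. i \<in> A \<Longrightarrow> S i \<in> V) \<Longrightarrow> (\<Delta> ^^ r) (\<Sum>i\<in>A. S i) = (\<Sum>i\<in>A. (\<Delta> ^^ r) (S i))"
  by (induction r) (simp_all add: div_sum)

section \<open>Commutators of the divergence with the canonical operators\<close>

lemma div_symI: "S \<in> V \<Longrightarrow> c \<in> idx \<Longrightarrow> \<Delta> (symI c S) = symI c (\<Delta> S)"
proof -
  assume S: "S \<in> V" and c: "c \<in> idx"
  have "symI k (symD k (symI c S)) = symI c (symI k (symD k S))" if "k \<in> idx" for k
    using S that by (simp add: symDI symI_scaleR symII[of _ k c])
  then show ?thesis
    using S c by (simp add: sym_div_eq symI_sum symI_scaleR)
qed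

lemma div_symD: "S \<in> V \<Longrightarrow> i \<in> idx \<Longrightarrow> \<Delta> (symD i S) = symD i (\<Delta> S)"
proof -
  assume S: "S \<in> V" and i: "i \<in> idx"
  have "symI k (symD k (symD i S)) = symD i (symI k (symD k S))" if "k \<in> idx" for k
    using S i that by (simp add: symDD[of S k i] symI_scaleR symDI[of _ i k] sg_commute[of p k i])
  then have "\<Delta> (symD i S) = (\<Sum>k\<in>idx. symD i (\<epsilon> k *\<^sub>R symI k (symD k S)))"
    using S i by (simp add: sym_div_eq symD_scaleR)
  also have "\<dots> = symD i (\<Delta> S)"
    unfolding sym_div_eq[OF S] using S i by (intro symD_sum[symmetric]) simp_all
  finally show ?thesis .
qed

lemma div_symY: "S \<in> V \<Longrightarrow> c \<in> idx \<Longrightarrow> \<Delta> (symY c S) = symY c (\<Delta> S) + \<epsilon> c *\<^sub>R symI c S"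
proof -
  assume S: "S \<in> V" and c: "c \<in> idx"
  have "\<Delta> (symY c S) = (\<Sum>k\<in>idx. \<epsilon> k *\<^sub>R symY c (symI k (symD k S)) + (if k = c then \<epsilon> c *\<^sub>R symI c S else 0))"
    using S c by (auto simp: sym_div_eq symDY[of S _ c] symI_add symI_scaleR symIY[of _ c] sg_commute[of p c]
        scaleR_add_right intro!: sum.cong)
  then show ?thesis
    using S c by (simp add: sym_div_eq sum.distrib symY_sum symY_scaleR)
qed

lemma div_symP: "S \<in> V \<Longrightarrow> i \<in> idx \<Longrightarrow> \<Delta> (symP i S) = symP i (\<Delta> S) + symD i S"
proof -
  assume S: "S \<in> V" and i: "i \<in> idx"
  have "\<Delta> (symP i S) = (\<Sum>k\<in>idx. \<epsilon> k *\<^sub>R symP i (symI k (symD k S)) + (if k = i then symD i S else 0))"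
    using S i by (auto simp: sym_div_eq symDP[of S _ i] symI_scaleR symIP[of _ _ i] scaleR_add_right
        sg_self intro!: sum.cong)
  then show ?thesis
    using S i by (simp add: sym_div_eq sum.distrib symP_sum symP_scaleR)
qed

lemma div_degscale: "S \<in> V \<Longrightarrow> \<Delta> (degscale \<phi> S) = degscale (\<lambda>m. \<phi> (Suc m)) (\<Delta> S)"
  by (simp add: sym_div_eq symD_degscale symI_degscale degscale_sum degscale_scaleR)

lemma div_power_degscale: "S \<in> V \<Longrightarrow> (\<Delta> ^^ r) (degscale \<phi> S) = degscale (\<lambda>m. \<phi> (m + r)) ((\<Delta> ^^ r) S)"
  by (induction r) (simp_all add: div_degscale)

lemma div_opE: "S \<in> V \<Longrightarrow> \<Delta> (opE S) = opE (\<Delta> S) + \<Delta> S"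
proof -
  assume S: "S \<in> V"
  have "\<Delta> (opE S) = (\<Sum>k\<in>idx. \<Delta> (symY k (symD k S)))"
    unfolding opE_def using S by (intro div_sum) simp
  also have "\<dots> = (\<Sum>k\<in>idx. symY k (symD k (\<Delta> S)) + \<epsilon> k *\<^sub>R symI k (symD k S))"
    using S by (intro sum.cong refl) (simp add: div_symY div_symD)
  finally show ?thesis
    using S by (simp add: sum.distrib opE_def sym_div_eq[of S])
qed

text \<open>The constant is the superdimension: reordering \<iota>_k p_k leaves \<epsilon>_k for
  every k, and these signs sum to p - q.\<close>

lemma div_opW: "S \<in> V \<Longrightarrow> \<Delta> (opW S) = opW (\<Delta> S) + opE S + degscale real S + (real p - real q) *\<^sub>R S"
proof -
  assume S: "S \<in> V"
  have "\<Delta> (opW S) = (\<Sum>k\<in>idx. \<Delta> (symY k (symP k S)))"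
    unfolding opW_def using S by (intro div_sum) simp
  also have "\<dots> = (\<Sum>k\<in>idx. symY k (symP k (\<Delta> S)) + symY k (symD k S) + symP k (symI k S) + \<epsilon> k *\<^sub>R S)"
    using S by (intro sum.cong refl)
      (simp add: div_symY div_symP symY_add symIP scaleR_add_right sg_self)
  finally show ?thesis
    by (simp only: sum.distrib sum_symPI[OF S] opW_def[symmetric] opE_def[symmetric]
        scaleR_sum_left[symmetric] sum_parity_signs)
qed

lemma symI_opE: "S \<in> V \<Longrightarrow> symI c (opE S) = opE (symI c S)"
  by (simp add: opE_def symI_sum symIY[of c] symDI[of S _ c] symY_scaleR sg_commute[of p _ c])

lemma degscale_Suc: "degscale (\<lambda>m. real (Suc m)) S = degscale real S + S"
  by (rule ext) (simp add: degscale_def fun_apply scaleR_add_left)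

text \<open>Both products in \<open>lin_op\<close> produce the commutator \<epsilon>_j \<iota>_j
  \<partial>_i, with opposite signs.\<close>

lemma div_lin_op:
  assumes S: "S \<in> V" and ij: "i \<in> idx" "j \<in> idx"
  shows "\<Delta> (lin_op d j i S) = lin_op d j i (\<Delta> S)"
proof -
  have "\<Delta> (symY j (symD i S)) = symY j (symD i (\<Delta> S)) + \<epsilon> j *\<^sub>R symI j (symD i S)"
    using S ij by (simp add: div_symY div_symD)
  moreover have "\<Delta> (symP i (symI j S)) = symP i (symI j (\<Delta> S)) + \<sigma> i j *\<^sub>R symI j (symD i S)"
    using S ij by (simp add: div_symP div_symI symDI)
  ultimately show ?thesis
    using S ij by (simp add: lin_op_def div_add div_diff div_scaleR scaleR_add_right mult_ac)
qed

text \<open>In the commutator the terms y_c \<Delta> cancel, and so do the terms with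
  \<open>opE\<close> and \<iota>_c. The degree operator and \<open>opW\<close> each leave -
  \<epsilon>_c N \<iota>_c. The remaining multiples of \<iota>_c are - \<epsilon>_c from shifting N
  and - (p - q) \<epsilon>_c from the superdimension; they cancel because p - q = -1.\<close>

lemma div_quad_op:
  assumes S: "S \<in> V" and c: "c \<in> idx" and q: "q = p + 1"
  shows "\<Delta> (quad_op c S) = quad_op c (\<Delta> S) - (2 * \<epsilon> c) *\<^sub>R degscale real (symI c S)"
proof -
  have 1: "\<Delta> (symY c (opE S)) = symY c (opE (\<Delta> S)) + symY c (\<Delta> S) + \<epsilon> c *\<^sub>R opE (symI c S)"
    using S c by (simp add: div_symY div_opE symY_add symI_opE)
  have 2: "\<Delta> (degscale real (symY c S)) =
      degscale real (symY c (\<Delta> S)) + symY c (\<Delta> S) + \<epsilon> c *\<^sub>R degscale real (symI c S) + \<epsilon> c *\<^sub>R symI c S"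
    using S c by (simp add: div_degscale degscale_Suc div_symY degscale_add degscale_scaleR
        del: of_nat_Suc)
  have 3: "\<Delta> (opW (symI c S)) = opW (symI c (\<Delta> S)) + opE (symI c S) + degscale real (symI c S) - symI c S"
  proof -
    have "real p - real q = -1" using q by simp
    then show ?thesis using S c by (simp add: div_opW div_symI)
  qed
  have "\<Delta> (quad_op c S) = \<Delta> (symY c (opE S)) - \<Delta> (degscale real (symY c S)) - \<epsilon> c *\<^sub>R \<Delta> (opW (symI c S))"
    using S c by (simp add: quad_op_def div_diff div_scaleR)
  moreover have "(2 * \<epsilon> c) *\<^sub>R U = \<epsilon> c *\<^sub>R U + \<epsilon> c *\<^sub>R U" for U :: symbol
    by (simp flip: scaleR_add_left)
  ultimately show ?thesis
    unfolding 1 2 3 quad_op_def by (simp add: scaleR_add_right scaleR_diff_right)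
qed

text \<open>Each of the r + 1 commutators contributes - 2 \<epsilon>_c N \<iota>_c, and moving it
  out through s further divergences replaces N by N + s. Summing 2 (m + s) over s from 0 to r gives
  (r + 1) (2m + r).\<close>

lemma div_power_quad_op:
  assumes S: "S \<in> V" and c: "c \<in> idx" and q: "q = p + 1"
  shows "(\<Delta> ^^ Suc r) (quad_op c S) = quad_op c ((\<Delta> ^^ Suc r) S)
    - \<epsilon> c *\<^sub>R degscale (\<lambda>m. real (Suc r) * real (2 * m + r)) (symI c ((\<Delta> ^^ r) S))"
proof (induction r)
  case 0
  have "degscale (\<lambda>m. real (2 * m)) T = 2 *\<^sub>R degscale real T" for T
    by (rule ext) (simp add: degscale_def fun_apply)
  then show ?case using div_quad_op[OF S c q] by (simp add: mult.commute)
next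
  case (Suc r)
  let ?T = "(\<Delta> ^^ Suc r) S"
  have T: "?T \<in> V" "(\<Delta> ^^ r) S \<in> V" using S by simp_all
  have "(\<Delta> ^^ Suc (Suc r)) (quad_op c S) = \<Delta> (quad_op c ?T)
      - \<epsilon> c *\<^sub>R \<Delta> (degscale (\<lambda>m. real (Suc r) * real (2 * m + r)) (symI c ((\<Delta> ^^ r) S)))"
    using Suc T c by (simp add: div_diff div_scaleR del: of_nat_Suc of_nat_add of_nat_mult funpow.simps)
      (simp add: div_diff div_scaleR)
  also have "\<Delta> (degscale (\<lambda>m. real (Suc r) * real (2 * m + r)) (symI c ((\<Delta> ^^ r) S))) =
      degscale (\<lambda>m. real (Suc r) * real (2 * Suc m + r)) (symI c ?T)"
    using T c by (simp add: div_degscale div_symI add_ac)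
  also have "\<Delta> (quad_op c ?T) = quad_op c (\<Delta> ?T) - (2 * \<epsilon> c) *\<^sub>R degscale real (symI c ?T)"
    by (rule div_quad_op[OF T(1) c q])
  also have "quad_op c (\<Delta> ?T) - (2 * \<epsilon> c) *\<^sub>R degscale real (symI c ?T)
      - \<epsilon> c *\<^sub>R degscale (\<lambda>m. real (Suc r) * real (2 * Suc m + r)) (symI c ?T) =
    quad_op c (\<Delta> ?T) - \<epsilon> c *\<^sub>R degscale (\<lambda>m. real (Suc (Suc r)) * real (2 * m + Suc r)) (symI c ?T)"
  proof -
    \<comment> \<open>This is (r + 2) (2m + r + 1) = 2m + (r + 1) (2m + 2 + r), the step in that
      sum.\<close>
    have "degscale (\<lambda>m. real (Suc (Suc r)) * real (2 * m + Suc r)) U =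
        2 *\<^sub>R degscale real U + degscale (\<lambda>m. real (Suc r) * real (2 * Suc m + r)) U" for U
      by (rule ext) (simp add: degscale_def fun_apply algebra_simps flip: scaleR_add_left)
    then show ?thesis by (simp add: scaleR_add_right mult.commute del: of_nat_Suc)
  qed
  finally show ?case by simp
qed

lemma degscale_diff: "degscale \<phi> (S - T) = degscale \<phi> S - degscale \<phi> T"
  by (rule ext) (simp add: degscale_def fun_apply scaleR_diff_right)

lemma lin_op_degscale: "S \<in> V \<Longrightarrow> i \<in> idx \<Longrightarrow> lin_op d j i (degscale \<phi> S) = degscale \<phi> (lin_op d j i S)"
  unfolding lin_op_def
  by (simp add: symD_degscale symY_degscale symI_degscale symP_degscale degscale_add degscale_diff
      degscale_scaleR)

lemma opE_degscale: "S \<in> V \<Longrightarrow> opE (degscale \<phi> S) = degscale \<phi> (opE S)"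
  by (simp add: opE_def symD_degscale symY_degscale degscale_sum)

lemma opW_symI_degscale: "opW (symI c (degscale \<phi> S)) = degscale \<phi> (opW (symI c S))"
  by (simp add: opW_def symI_degscale symP_degscale symY_degscale degscale_sum)

lemma quad_op_degscale: "S \<in> V \<Longrightarrow> quad_op c (degscale \<phi> S) = degscale \<phi> (quad_op c S)"
  unfolding quad_op_def
  by (simp add: opE_degscale opW_symI_degscale symY_degscale degscale_diff degscale_scaleR
      degscale_degscale mult.commute)

section \<open>The quantization map\<close>

text \<open>A strict degree bound: with bound 0 it characterizes the zero symbol, and truncated
  subtraction gives the right bound when a lowering operator annihilates the symbol.\<close>

definition vanishes_from :: "nat \<Rightarrow> symbol \<Rightarrow> bool" where
  "vanishes_from n S \<longleftrightarrow> (\<forall>\<alpha>. n \<le> size \<alpha> \<longrightarrow> S \<alpha> = 0)"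

lemma vanishes_from_0: "vanishes_from 0 S \<longleftrightarrow> S = 0"
  by (auto simp: vanishes_from_def fun_apply)

lemma vanishes_from_mono: "vanishes_from m S \<Longrightarrow> m \<le> n \<Longrightarrow> vanishes_from n S"
  by (auto simp: vanishes_from_def)

lemma vanishes_from_add: "vanishes_from n S \<Longrightarrow> vanishes_from n T \<Longrightarrow> vanishes_from n (S + T)"
  by (simp add: vanishes_from_def fun_apply)

lemma vanishes_from_diff: "vanishes_from n S \<Longrightarrow> vanishes_from n T \<Longrightarrow> vanishes_from n (S - T)"
  by (simp add: vanishes_from_def fun_apply)

lemma vanishes_from_scaleR: "vanishes_from n S \<Longrightarrow> vanishes_from n (c *\<^sub>R S)"
  by (simp add: vanishes_from_def fun_apply)

lemma vanishes_from_sum: "(\<And>i. i \<in> A \<Longrightarrow> vanishes_from n (S i)) \<Longrightarrow> vanishes_from n (\<Sum>i\<in>A. S i)"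
  by (simp add: vanishes_from_def sum_fun_apply)

lemma vanishes_from_degscale: "vanishes_from n S \<Longrightarrow> vanishes_from n (degscale \<phi> S)"
  by (simp add: vanishes_from_def degscale_def)

lemma vanishes_from_symY: "vanishes_from n S \<Longrightarrow> vanishes_from n (symY j S)"
  by (simp add: vanishes_from_def symY_def)

lemma vanishes_from_symD: "vanishes_from n S \<Longrightarrow> vanishes_from n (symD j S)"
  by (simp add: vanishes_from_def symD_def)

lemma vanishes_from_symP: "vanishes_from n S \<Longrightarrow> vanishes_from (Suc n) (symP j S)"
  by (auto simp: vanishes_from_def symP_def size_Diff_singleton)

lemma vanishes_from_symI: "vanishes_from n S \<Longrightarrow> vanishes_from (n - 1) (symI j S)"
  by (auto simp: vanishes_from_def symI_def)

lemma vanishes_from_div: "S \<in> V \<Longrightarrow> vanishes_from n S \<Longrightarrow> vanishes_from (n - 1) (\<Delta> S)"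
  unfolding sym_div_eq
  by (intro vanishes_from_sum vanishes_from_scaleR vanishes_from_symI vanishes_from_symD)

lemma vanishes_from_div_power: "S \<in> V \<Longrightarrow> vanishes_from n S \<Longrightarrow> vanishes_from (n - r) ((\<Delta> ^^ r) S)"
proof (induction r)
  case (Suc r)
  then show ?case using vanishes_from_div[of "(\<Delta> ^^ r) S" "n - r"] by simp
qed simp

lemma vanishes_from_symP_symI:
  "vanishes_from (Suc n) S \<Longrightarrow> vanishes_from (Suc n) (symP i (symI j S))"
  using vanishes_from_symP[OF vanishes_from_symI[of "Suc n" S j]] by simp

lemma vanishes_from_lin_op: "vanishes_from (Suc n) S \<Longrightarrow> vanishes_from (Suc n) (lin_op d j i S)"
  unfolding lin_op_def
  by (auto intro!: vanishes_from_add vanishes_from_diff vanishes_from_scaleR vanishes_from_symY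
      vanishes_from_symD vanishes_from_symP_symI)

lemma vanishes_from_quad_op: "vanishes_from (Suc n) S \<Longrightarrow> vanishes_from (Suc n) (quad_op c S)"
  unfolding quad_op_def opE_def opW_def
  by (intro vanishes_from_diff vanishes_from_scaleR vanishes_from_symY vanishes_from_sum
      vanishes_from_symD vanishes_from_degscale vanishes_from_symP_symI)

lemma symbols_bounded: "S \<in> V \<Longrightarrow> \<exists>M. vanishes_from (Suc M) S"
proof -
  assume "S \<in> V"
  then obtain M where "\<forall>n\<in>size ` {\<alpha>. S \<alpha> \<noteq> 0}. n \<le> M"
    using finite_nat_set_iff_bounded_le symbols_finite by (metis finite_imageI)
  then show ?thesis by (intro exI[of _ M]) (force simp: vanishes_from_def)
qed

text \<open>The parameter \<open>t\<close> takes the place (1, 1), where the quotient defining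
  \<open>Ccoef\<close> has the form 0/0. One family of coefficients then covers all degrees.\<close>

definition qcoef :: "real \<Rightarrow> nat \<Rightarrow> nat \<Rightarrow> real" where
  "qcoef t k r = (if k = 1 \<and> r = 1 then t else Ccoef k r)"

lemma qcoef_0 [simp]: "qcoef t k 0 = 1"
  by (simp add: qcoef_def Ccoef_def)

text \<open>The recurrence at order r + 1 and degree k = m + r + 1, where 2k - 1 - (r + 1) = 2m + r
  and k - (r + 1) = m. For m = r = 0 both sides are zero whatever \<open>t\<close> is; otherwise k
  is at least 2 and the product formula applies with nonzero denominator 2m + r.\<close>

lemma qcoef_rec:
  "real (Suc r) * real (2 * m + r) * qcoef t (m + Suc r) (Suc r) = real m * qcoef t (Suc (m + r)) r"
proof (cases "m + r = 0")
  case False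
  define k where "k = m + Suc r"
  define P where "P = (\<Prod>j=1..r. real k - real j)"
  define R where "R = (\<Prod>j=1..r. 2 * real k - 1 - real j)"
  have c: "qcoef t k (Suc r) = Ccoef k (Suc r)" "qcoef t k r = Ccoef k r"
    using False by (auto simp: qcoef_def k_def)
  have "Ccoef k (Suc r) = P * (real k - real (Suc r)) / (fact (Suc r) * (R * (2 * real k - 1 - real (Suc r))))"
    by (simp add: Ccoef_def P_def R_def)
  also have "\<dots> = P * real m / ((real (Suc r) * fact r) * (R * real (2 * m + r)))"
    by (simp add: k_def)
  also have "\<dots> = Ccoef k r * (real m / (real (Suc r) * real (2 * m + r)))"
    by (simp add: Ccoef_def P_def R_def)
  finally have "real (Suc r) * real (2 * m + r) * Ccoef k (Suc r) =
      real (Suc r) * real (2 * m + r) * (Ccoef k r * (real m / (real (Suc r) * real (2 * m + r))))"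
    by simp
  also have "\<dots> = real m * Ccoef k r"
  proof -
    have "0 < 2 * m + r" using False by simp
    then have "real (2 * m + r) \<noteq> 0" by (simp only: of_nat_eq_0_iff)
    then have "real (Suc r) * real (2 * m + r) \<noteq> 0" by (simp only: mult_eq_0_iff) simp
    moreover have "a * (C * (x / a)) = x * C" if "a \<noteq> 0" for a C x :: real
      using that by simp
    ultimately show ?thesis by blast
  qed
  finally show ?thesis
    using c by (simp add: k_def)
qed simp

text \<open>The total symbol of \<^term>\<open>Qmap p q t S\<close> for a symbol of degree at most \<open>M\<close>. A component of
  degree \<open>m\<close> of \<open>\<Delta>\<^sup>r S\<close> comes from degree \<open>m + r\<close>, which selects the coefficient.\<close>

definition qsym :: "real \<Rightarrow> nat \<Rightarrow> symbol \<Rightarrow> symbol" where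
  "qsym t M S = (\<Sum>r\<le>M. degscale (\<lambda>m. qcoef t (m + r) r) ((\<Delta> ^^ r) S))"

lemma V_qsym [simp]: "S \<in> V \<Longrightarrow> qsym t M S \<in> V"
  unfolding qsym_def by (rule V_sum) simp

lemma qsym_add: "S \<in> V \<Longrightarrow> T \<in> V \<Longrightarrow> qsym t M (S + T) = qsym t M S + qsym t M T"
  by (simp add: qsym_def div_power_add degscale_add sum.distrib)

lemma qsym_scaleR: "S \<in> V \<Longrightarrow> qsym t M (c *\<^sub>R S) = c *\<^sub>R qsym t M S"
  by (simp add: qsym_def div_power_scaleR degscale_scaleR scaleR_sum_right)

lemma vanishes_from_qsym: "S \<in> V \<Longrightarrow> vanishes_from n S \<Longrightarrow> vanishes_from n (qsym t M S)"
  unfolding qsym_def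
  by (intro vanishes_from_sum vanishes_from_degscale vanishes_from_mono[OF vanishes_from_div_power]) auto

text \<open>Triangularity: every positive power of the divergence lowers the degree, and the term
  without divergence has coefficient 1.\<close>

lemma qsym_top:
  assumes S: "S \<in> V" "vanishes_from (Suc n) S"
  shows "vanishes_from n (S - qsym t M S)"
  unfolding vanishes_from_def
proof (intro allI impI)
  fix \<beta> :: "nat multiset"
  assume n: "n \<le> size \<beta>"
  have "((\<Delta> ^^ r) S) \<beta> = 0" if "r > 0" for r
  proof -
    have "vanishes_from (Suc n - r) ((\<Delta> ^^ r) S)" using S by (rule vanishes_from_div_power)
    then show ?thesis using that n by (auto simp: vanishes_from_def)
  qed
  then have "qsym t M S \<beta> = (\<Sum>r\<le>M. if r = 0 then S \<beta> else 0)"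
    unfolding qsym_def sum_fun_apply[of _ _ \<beta>] by (intro sum.cong refl) (simp add: degscale_def)
  then show "(S - qsym t M S) \<beta> = 0" by (simp add: fun_apply)
qed

text \<open>\<open>qsym\<close> is built from the degree operator and the divergence only, so
  whatever commutes with both commutes with it. This settles the affine fields.\<close>

lemma qsym_commute:
  assumes S: "S \<in> V"
    and TV: "\<And>S. S \<in> V \<Longrightarrow> T S \<in> V"
    and T_add: "\<And>S U. S \<in> V \<Longrightarrow> U \<in> V \<Longrightarrow> T (S + U) = T S + T U"
    and T_deg: "\<And>S \<phi>. S \<in> V \<Longrightarrow> T (degscale \<phi> S) = degscale \<phi> (T S)"
    and T_div: "\<And>S. S \<in> V \<Longrightarrow> T (\<Delta> S) = \<Delta> (T S)"
  shows "T (qsym t M S) = qsym t M (T S)"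
proof -
  have T_sum: "T (\<Sum>r\<le>n. U r) = (\<Sum>r\<le>n. T (U r))" if "\<And>r. U r \<in> V" for U and n :: nat
    using that by (induction n) (simp_all add: T_add V_sum)
  have "T ((\<Delta> ^^ r) S) = (\<Delta> ^^ r) (T S)" for r
    using S by (induction r) (simp_all add: T_div)
  then show ?thesis
    using S by (simp add: qsym_def T_sum T_deg)
qed

text \<open>Pushing the powers of the divergence through \<open>quad_op\<close> produces a
  commutator term at order r + 1, which the recurrence identifies with the correction at order r.
  The two sums thus match after an index shift, up to the last correction
  \<open>R M\<close>.\<close>

lemma qsym_quad_op:
  assumes S: "S \<in> V" and M: "vanishes_from (Suc M) S" and c: "c \<in> idx" and q: "q = p + 1"
  shows "quad_op c (qsym t M S) - \<epsilon> c *\<^sub>R degscale real (symI c (qsym t M S)) = qsym t M (quad_op c S)"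
proof -
  define G where "G r = degscale (\<lambda>m. qcoef t (m + r) r)" for r
  define D where "D r = (\<Delta> ^^ r) S" for r
  have D: "D r \<in> V" for r using S by (simp add: D_def)
  define R where "R r = degscale (\<lambda>m. real m * qcoef t (Suc (m + r)) r) (symI c (D r))" for r
  have quad_sum: "quad_op c (\<Sum>r\<le>n. U r) = (\<Sum>r\<le>n. quad_op c (U r))" if "\<And>r. U r \<in> V" for U and n :: nat
    using that by (induction n) (simp_all add: quad_op_add V_sum)
  \<comment> \<open>The M-th power of the divergence leaves only degree zero, which the interior
    product annihilates; so the correction without a partner in the shifted sum is zero.\<close>
  have RM: "R M = 0"
  proof -
    have "vanishes_from (Suc M - M - 1) (symI c (D M))"
      unfolding D_def by (intro vanishes_from_symI vanishes_from_div_power S M)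
    then show ?thesis by (simp add: R_def vanishes_from_0)
  qed
  have "quad_op c (qsym t M S) = (\<Sum>r\<le>M. G r (quad_op c (D r)))"
    using D by (simp add: qsym_def quad_sum quad_op_degscale G_def D_def)
  moreover have "degscale real (symI c (qsym t M S)) = (\<Sum>r\<le>M. R r)"
    by (simp add: qsym_def symI_sum symI_degscale degscale_sum degscale_degscale R_def D_def)
  moreover have "qsym t M (quad_op c S) = (\<Sum>r\<le>M. G r (quad_op c (D r))) - \<epsilon> c *\<^sub>R (\<Sum>r\<le>M. R r)"
  proof (cases M)
    case 0
    then show ?thesis using RM by (simp add: qsym_def G_def D_def)
  next
    case (Suc n)
    have step: "G (Suc r) ((\<Delta> ^^ Suc r) (quad_op c S)) = G (Suc r) (quad_op c (D (Suc r))) - \<epsilon> c *\<^sub>R R r" for r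
    proof -
      have "G (Suc r) (degscale (\<lambda>m. real (Suc r) * real (2 * m + r)) (symI c (D r))) = R r"
        unfolding G_def degscale_degscale R_def
        by (intro arg_cong[of _ _ "\<lambda>\<phi>. degscale \<phi> _"] ext)
          (use qcoef_rec in \<open>simp add: mult.commute del: of_nat_Suc of_nat_add of_nat_mult\<close>)
      moreover have "G k (U - a *\<^sub>R W) = G k U - a *\<^sub>R G k W" for k U W a
        by (rule ext) (simp add: G_def degscale_def fun_apply algebra_simps)
      ultimately show ?thesis
        unfolding div_power_quad_op[OF S c q] D_def[symmetric] by simp
    qed
    have "qsym t M (quad_op c S) = G 0 (quad_op c S) + (\<Sum>r\<le>n. G (Suc r) ((\<Delta> ^^ Suc r) (quad_op c S)))"
      unfolding qsym_def G_def[symmetric] Suc by (subst sum.atMost_Suc_shift) simp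
    also have "\<dots> = G 0 (quad_op c (D 0)) + (\<Sum>r\<le>n. G (Suc r) (quad_op c (D (Suc r)))) - \<epsilon> c *\<^sub>R (\<Sum>r\<le>n. R r)"
      unfolding step by (simp add: sum_subtractf scaleR_sum_right D_def)
    also have "G 0 (quad_op c (D 0)) + (\<Sum>r\<le>n. G (Suc r) (quad_op c (D (Suc r)))) = (\<Sum>r\<le>M. G r (quad_op c (D r)))"
      unfolding Suc by (subst sum.atMost_Suc_shift) simp
    also have "(\<Sum>r\<le>n. R r) = (\<Sum>r\<le>M. R r)"
      using RM unfolding Suc by simp
    finally show ?thesis .
  qed
  ultimately show ?thesis by simp
qed

section \<open>Identification of the map with the affine quantization of \<open>qsym\<close>\<close>

lemma deg_part_eq: "deg_part k S = degscale (\<lambda>m. if m = k then 1 else 0) S"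
  by (rule ext) (simp add: deg_part_def degscale_def)

lemma V_deg_part [simp]: "S \<in> V \<Longrightarrow> deg_part k S \<in> V"
  by (simp add: deg_part_eq)

lemma div_power_deg_part:
  assumes "S \<in> V"
  shows "degscale (\<lambda>m. \<phi> (m + r)) ((\<Delta> ^^ r) (deg_part k S)) = \<phi> k *\<^sub>R (\<Delta> ^^ r) (deg_part k S)"
  unfolding deg_part_eq div_power_degscale[OF assms] degscale_degscale
  by (rule ext) (simp add: degscale_def fun_apply)

lemma Qdeg_eq:
  assumes S: "S \<in> V"
  shows "Qdeg p q t k (deg_part k S) = Qaff p q (\<Sum>r\<le>k. qcoef t k r *\<^sub>R (\<Delta> ^^ r) (deg_part k S))"
proof
  fix f
  let ?S = "deg_part k S"
  have SV: "?S \<in> V" using S by simp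
  show "Qdeg p q t k ?S f = Qaff p q (\<Sum>r\<le>k. qcoef t k r *\<^sub>R (\<Delta> ^^ r) ?S) f"
  proof (cases "f \<in> F")
    case f: True
    have "Qaff p q (\<Sum>r\<le>k. qcoef t k r *\<^sub>R (\<Delta> ^^ r) ?S) f = (\<Sum>r\<le>k. qcoef t k r *\<^sub>R Qaff p q ((\<Delta> ^^ r) ?S) f)"
      using SV by (simp add: Qaff_sum Qaff_scaleR)
    moreover have "Qdeg p q t k ?S f = (\<Sum>r\<le>k. qcoef t k r *\<^sub>R Qaff p q ((\<Delta> ^^ r) ?S) f)"
    proof (cases "k = 1")
      case True
      \<comment> \<open>In degree one the divergence has degree zero, so its affine quantization is
        the multiplication used in the definition of the map.\<close>
      have "vanishes_from (Suc k) ?S" by (auto simp: vanishes_from_def deg_part_def)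
      then have "vanishes_from 1 (\<Delta> ?S)" using vanishes_from_div[OF SV, of "Suc k"] True by simp
      then have "\<Delta> ?S \<alpha> = 0" if "\<alpha> \<noteq> {#}" for \<alpha>
        using that by (auto simp: vanishes_from_def Suc_le_eq nonempty_has_size)
      then have "\<Delta> ?S = sing {#} (\<Delta> ?S {#})"
        by (auto simp: sing_def)
      then have "Qaff p q (\<Delta> ?S) f = \<Delta> ?S {#} \<odot> f"
        using Qaff_sing[OF f, of "{#}" "\<Delta> ?S {#}"] by simp
      then show ?thesis using True f
        by (simp add: Qdeg_def on_sfuns_def qcoef_def Ccoef_def)
    next
      case False
      then show ?thesis using f
        by (simp add: Qdeg_def on_sfuns_def qcoef_def atMost_atLeast0)
    qed
    ultimately show ?thesis by simp
  qed (simp add: Qdeg_def on_sfuns_def Qaff_outside)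
qed

text \<open>The inner sums over \<open>r \<le> k\<close> may be extended to
  \<open>r \<le> M\<close>, since higher powers of the divergence kill degree \<open>k\<close>;
  after exchanging the sums the degree parts recombine. The bound \<open>M\<close> is free, so two
  symbols can be treated with a common one.\<close>

lemma Qmap_eq:
  assumes S: "S \<in> V" and M: "vanishes_from (Suc M) S"
  shows "Qmap p q t S = Qaff p q (qsym t M S)"
proof -
  define K where "K = size ` {\<alpha>. S \<alpha> \<noteq> 0}"
  have K: "finite K" using symbols_finite[OF S] by (simp add: K_def)
  have KM: "k \<le> M" if "k \<in> K" for k
    using that M by (force simp: K_def vanishes_from_def not_less_eq_eq)
  have dec: "S = (\<Sum>k\<in>K. deg_part k S)"
  proof
    fix \<alpha>
    have "(\<Sum>k\<in>K. deg_part k S) \<alpha> = (\<Sum>k\<in>K. if k = size \<alpha> then S \<alpha> else 0)"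
      unfolding sum_fun_apply[of _ _ \<alpha>] by (intro sum.cong refl) (simp add: deg_part_def)
    then show "S \<alpha> = (\<Sum>k\<in>K. deg_part k S) \<alpha>"
      using K by (auto simp: K_def)
  qed
  have "qsym t M S = (\<Sum>r\<le>M. \<Sum>k\<in>K. qcoef t k r *\<^sub>R (\<Delta> ^^ r) (deg_part k S))"
    unfolding qsym_def
  proof (intro sum.cong refl)
    fix r
    have "(\<Delta> ^^ r) S = (\<Sum>k\<in>K. (\<Delta> ^^ r) (deg_part k S))"
      by (subst dec) (rule div_power_sum, simp add: S)
    then show "degscale (\<lambda>m. qcoef t (m + r) r) ((\<Delta> ^^ r) S) =
        (\<Sum>k\<in>K. qcoef t k r *\<^sub>R (\<Delta> ^^ r) (deg_part k S))"
      using S div_power_deg_part[OF S, of "\<lambda>k. qcoef t k r" r] by (simp add: degscale_sum)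
  qed
  also have "\<dots> = (\<Sum>k\<in>K. \<Sum>r\<le>M. qcoef t k r *\<^sub>R (\<Delta> ^^ r) (deg_part k S))"
    by (rule sum.swap)
  also have "\<dots> = (\<Sum>k\<in>K. \<Sum>r\<le>k. qcoef t k r *\<^sub>R (\<Delta> ^^ r) (deg_part k S))"
  proof (rule sum.cong[OF refl])
    fix k assume k: "k \<in> K"
    have "(\<Delta> ^^ r) (deg_part k S) = 0" if "k < r" for r
    proof -
      have "vanishes_from (Suc k) (deg_part k S)" by (auto simp: vanishes_from_def deg_part_def)
      then have "vanishes_from (Suc k - r) ((\<Delta> ^^ r) (deg_part k S))"
        using S by (intro vanishes_from_div_power) simp_all
      then show ?thesis using that by (simp add: vanishes_from_0)
    qed
    then show "(\<Sum>r\<le>M. qcoef t k r *\<^sub>R (\<Delta> ^^ r) (deg_part k S)) =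
        (\<Sum>r\<le>k. qcoef t k r *\<^sub>R (\<Delta> ^^ r) (deg_part k S))"
      using KM[OF k] by (intro sum.mono_neutral_right) auto
  qed
  finally have *: "qsym t M S = (\<Sum>k\<in>K. \<Sum>r\<le>k. qcoef t k r *\<^sub>R (\<Delta> ^^ r) (deg_part k S))" .
  show ?thesis
  proof
    fix f
    show "Qmap p q t S f = Qaff p q (qsym t M S) f"
      unfolding Qmap_def K_def[symmetric] sum_fun_apply[of _ _ f] Qdeg_eq[OF S] *
      by (rule Qaff_sum[symmetric]) (simp add: V_sum S)
  qed
qed

lemma Qmap_linear:
  assumes "S \<in> V" "T \<in> V"
  shows "Qmap p q t (a *\<^sub>R S + b *\<^sub>R T) = a *\<^sub>R Qmap p q t S + b *\<^sub>R Qmap p q t T"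
proof -
  obtain M N where "vanishes_from (Suc M) S" "vanishes_from (Suc N) T"
    using symbols_bounded assms by metis
  then have *: "vanishes_from (Suc (max M N)) S" "vanishes_from (Suc (max M N)) T"
    by (auto elim!: vanishes_from_mono)
  then have "vanishes_from (Suc (max M N)) (a *\<^sub>R S + b *\<^sub>R T)"
    by (intro vanishes_from_add vanishes_from_scaleR)
  then show ?thesis
    using assms * by (intro ext) (simp add: Qmap_eq[of _ "max M N"] fun_apply qsym_add qsym_scaleR
        Qaff_add Qaff_scaleR)
qed

lemma Qmap_add: "S \<in> V \<Longrightarrow> T \<in> V \<Longrightarrow> Qmap p q t (S + T) = Qmap p q t S + Qmap p q t T"
  using Qmap_linear[of S T t 1 1] by simp

lemma Qmap_scaleR: "S \<in> V \<Longrightarrow> Qmap p q t (c *\<^sub>R S) = c *\<^sub>R Qmap p q t S"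
  using Qmap_linear[of S 0 t c 0] by simp

text \<open>The defect \<open>T - qsym t M T\<close> has smaller degree and is hit by some
  \<open>U\<close> by induction; then \<open>U + T\<close> is a preimage of
  \<open>T\<close>.\<close>

lemma qsym_surj:
  assumes "T \<in> V" "vanishes_from n T"
  shows "\<exists>S\<in>V. vanishes_from n S \<and> qsym t M S = T"
  using assms
proof (induction n arbitrary: T)
  case 0
  then have "T = 0" by (simp add: vanishes_from_0)
  then show ?case using qsym_scaleR[of 0 t M 0] 0 by (intro bexI[of _ 0]) simp_all
next
  case (Suc n)
  obtain U where U: "U \<in> V" "vanishes_from n U" "qsym t M U = T - qsym t M T"
    using Suc.IH[of "T - qsym t M T"] qsym_top[OF Suc.prems] Suc.prems by auto
  then have "qsym t M (U + T) = T" using Suc.prems by (simp add: qsym_add)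
  moreover have "vanishes_from (Suc n) (U + T)"
    by (intro vanishes_from_add vanishes_from_mono[OF U(2)] Suc.prems(2)) simp
  ultimately show ?case using U Suc.prems by (intro bexI[of _ "U + T"]) simp_all
qed

text \<open>If the image is zero, then \<open>S\<close> equals \<open>S - qsym t M S\<close>, so
  every degree bound for \<open>S\<close> can be lowered by one, down to zero.\<close>

lemma qsym_eq_0:
  assumes "S \<in> V" "qsym t M S = 0"
  shows "S = 0"
proof -
  have "S = 0" if "vanishes_from n S" for n
    using that
  proof (induction n)
    case (Suc n)
    then show ?case using qsym_top[OF assms(1), of n t M] assms(2) by simp
  qed (simp add: vanishes_from_0)
  then show ?thesis using symbols_bounded[OF assms(1)] by blast
qed

section \<open>Bijectivity and principal symbols\<close>

lemma vanishes_from_Suc_iff: "vanishes_from (Suc k) S \<longleftrightarrow> (\<forall>\<alpha>. S \<alpha> \<noteq> 0 \<longrightarrow> size \<alpha> \<le> k)"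
  by (auto simp: vanishes_from_def not_less_eq_eq[symmetric])

lemma diffops_ord_iff: "D \<in> diffops_ord p q k \<longleftrightarrow> (\<exists>S\<in>V. vanishes_from (Suc k) S \<and> D = Qaff p q S)"
  by (auto simp: diffops_ord_def vanishes_from_Suc_iff)

lemma total_symbol_Qaff: "S \<in> V \<Longrightarrow> total_symbol p q (Qaff p q S) = S"
  unfolding total_symbol_def by (rule the_equality) (auto intro: Qaff_inj)

lemma Qmap_quantization: "quantization p q (Qmap p q t)"
  unfolding quantization_def
proof (intro conjI ballI allI)
  show "bij_betw (Qmap p q t) V (diffops p q)"
    unfolding bij_betw_def
  proof
    show "inj_on (Qmap p q t) V"
    proof (rule inj_onI)
      fix S T assume ST: "S \<in> V" "T \<in> V" "Qmap p q t S = Qmap p q t T"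
      have "Qmap p q t (S - T) = 0"
        using ST Qmap_linear[of S T t 1 "-1"] by simp
      moreover obtain M where "vanishes_from (Suc M) (S - T)"
        using symbols_bounded ST by (metis V_diff)
      ultimately have "Qaff p q (qsym t M (S - T)) = 0"
        using ST Qmap_eq[of "S - T" M t] by simp
      then have "qsym t M (S - T) = 0"
        using ST by (intro Qaff_eq_0_imp) (simp_all add: fun_apply)
      then show "S = T" using qsym_eq_0[of "S - T" t M] ST by simp
    qed
    show "Qmap p q t ` V = diffops p q"
    proof (intro set_eqI iffI)
      fix D assume "D \<in> Qmap p q t ` V"
      then obtain S where S: "S \<in> V" "D = Qmap p q t S" by blast
      obtain M where M: "vanishes_from (Suc M) S" using symbols_bounded S by blast
      then have "D \<in> diffops_ord p q M"
        unfolding diffops_ord_iff using S vanishes_from_qsym[of S "Suc M" t M] Qmap_eq[of S M t]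
        by (intro bexI[of _ "qsym t M S"]) simp_all
      then show "D \<in> diffops p q" by (auto simp: diffops_def)
    next
      fix D assume "D \<in> diffops p q"
      then obtain k T where T: "T \<in> V" "vanishes_from (Suc k) T" "D = Qaff p q T"
        by (auto simp: diffops_def diffops_ord_iff)
      then obtain S where "S \<in> V" "vanishes_from (Suc k) S" "qsym t k S = T"
        using qsym_surj by blast
      then show "D \<in> Qmap p q t ` V" using T Qmap_eq[of S k t] by (intro image_eqI[of _ _ S]) simp_all
    qed
  qed
next
  fix k T assume "T \<in> symbols_deg p q k"
  then have T: "T \<in> V" "\<And>\<alpha>. T \<alpha> \<noteq> 0 \<Longrightarrow> size \<alpha> = k" by (auto simp: symbols_deg_def)
  then have van: "vanishes_from (Suc k) T" by (auto simp: vanishes_from_Suc_iff)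
  note Q = Qmap_eq[OF T(1) van]
  show "Qmap p q t T \<in> diffops_ord p q k"
    unfolding Q diffops_ord_iff using T(1) van
    by (intro bexI[of _ "qsym t k T"]) (simp_all add: vanishes_from_qsym)
  have "vanishes_from k (T - qsym t k T)" by (rule qsym_top[OF T(1) van])
  then have "qsym t k T \<alpha> = T \<alpha>" if "size \<alpha> = k" for \<alpha>
    using that by (simp add: vanishes_from_def fun_apply)
  then show "principal_symbol p q k (Qmap p q t T) = T"
    unfolding Q principal_symbol_def total_symbol_Qaff[OF V_qsym[OF T(1)]]
    using T(2) by (intro ext) (force simp: deg_part_def)
qed (rule Qmap_linear)

section \<open>Equivariance\<close>

text \<open>A linear space of fields, so that generators suffice. The condition that the Lie
  derivative is again a symbol is included because the map is linear only on symbols.\<close>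

definition equivariant_fields :: "real \<Rightarrow> real \<Rightarrow> real \<Rightarrow> vfield set" where
  "equivariant_fields t l m = {X \<in> fields. \<forall>S\<in>V. Lsym p q (m - l) X S \<in> V \<and>
     Lop p q l m X (Qmap p q t S) = Qmap p q t (Lsym p q (m - l) X S)}"

lemma equivariant_fields_zero: "0 \<in> equivariant_fields t l m"
  and equivariant_fields_add:
    "X \<in> equivariant_fields t l m \<Longrightarrow> Y \<in> equivariant_fields t l m \<Longrightarrow> X + Y \<in> equivariant_fields t l m"
  and equivariant_fields_scaleR:
    "X \<in> equivariant_fields t l m \<Longrightarrow> c *\<^sub>R X \<in> equivariant_fields t l m"
proof -
  \<comment> \<open>Additivity of the action in the field is available for affine quantizations of
    symbols; the operators \<open>Qmap p q t S\<close> are of this form.\<close>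
  have Q: "\<exists>U\<in>V. Qmap p q t S = Qaff p q U" if S: "S \<in> V" for S
  proof -
    obtain M where "vanishes_from (Suc M) S" using symbols_bounded[OF S] by blast
    then show ?thesis using S Qmap_eq[of S M t] by (intro bexI[of _ "qsym t M S"]) simp_all
  qed
  have add: "Lop p q l m (X + Y) (Qmap p q t S) = Lop p q l m X (Qmap p q t S) + Lop p q l m Y (Qmap p q t S)"
    if "X \<in> fields" "Y \<in> fields" "S \<in> V" for X Y S
    using Q[OF that(3)] that by (auto simp: Lop_field_add fun_apply)
  have scaleR: "Lop p q l m (c *\<^sub>R X) (Qmap p q t S) = c *\<^sub>R Lop p q l m X (Qmap p q t S)"
    if "X \<in> fields" "S \<in> V" for X S c
    using Q[OF that(2)] that by (auto simp: Lop_field_scaleR fun_apply)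
  show "X + Y \<in> equivariant_fields t l m"
    if "X \<in> equivariant_fields t l m" "Y \<in> equivariant_fields t l m" for X Y
    using that by (simp add: equivariant_fields_def add Lsym_field_add Qmap_add)
  show *: "c *\<^sub>R X \<in> equivariant_fields t l m" if "X \<in> equivariant_fields t l m" for X c
    using that by (simp add: equivariant_fields_def scaleR Lsym_field_scaleR Qmap_scaleR)
  have "Lop p q l m 0 (Qmap p q t S) = 0" if "S \<in> V" for S
    using scaleR[OF fields_zero that, of 0] by simp
  moreover have "Lsym p q (m - l) 0 S = 0" for S
    using Lsym_field_scaleR[OF fields_zero, of "m - l" 0 S] by simp
  moreover have "Qmap p q t 0 = 0" using Qmap_scaleR[OF V_zero, of t 0] by simp
  ultimately show "0 \<in> equivariant_fields t l m"
    by (simp add: equivariant_fields_def)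
qed

lemma equivariant_fields_sum:
  "(\<And>i. i \<in> A \<Longrightarrow> X i \<in> equivariant_fields t l m) \<Longrightarrow> (\<Sum>i\<in>A. X i) \<in> equivariant_fields t l m"
  by (induction A rule: infinite_finite_induct)
    (simp_all add: equivariant_fields_zero equivariant_fields_add)

lemma const_field_equivariant:
  assumes i: "i \<in> idx"
  shows "const_field i \<in> equivariant_fields t l m"
  unfolding equivariant_fields_def mem_Collect_eq
proof (intro conjI ballI const_field_fields)
  fix S assume S: "S \<in> V"
  then obtain M where M: "vanishes_from (Suc M) S" using symbols_bounded by blast
  have "symD i (qsym t M S) = qsym t M (symD i S)"
    by (rule qsym_commute[OF S]) (use i in \<open>simp_all add: symD_add symD_degscale div_symD\<close>)
  then show "Lop p q l m (const_field i) (Qmap p q t S) = Qmap p q t (Lsym p q (m - l) (const_field i) S)"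
    using S i M by (simp add: Lsym_const_field Qmap_eq[of _ M] vanishes_from_symD Lop_const_field)
  show "Lsym p q (m - l) (const_field i) S \<in> V"
    using S i by (simp add: Lsym_const_field)
qed

lemma lin_field_equivariant:
  assumes ij: "i \<in> idx" "j \<in> idx"
  shows "lin_field j i \<in> equivariant_fields t l m"
  unfolding equivariant_fields_def mem_Collect_eq
proof (intro conjI ballI lin_field_fields ij)
  fix S assume S: "S \<in> V"
  then obtain M where M: "vanishes_from (Suc M) S" using symbols_bounded by blast
  have "lin_op (m - l) j i (qsym t M S) = qsym t M (lin_op (m - l) j i S)"
    by (rule qsym_commute[OF S]) (use ij in \<open>simp_all add: lin_op_add lin_op_degscale div_lin_op\<close>)
  then show "Lop p q l m (lin_field j i) (Qmap p q t S) = Qmap p q t (Lsym p q (m - l) (lin_field j i) S)"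
    using S ij M by (simp add: Lsym_lin_field Qmap_eq[of _ M] vanishes_from_lin_op Lop_lin_field)
  show "Lsym p q (m - l) (lin_field j i) S \<in> V"
    using S ij by (simp add: Lsym_lin_field)
qed

lemma quad_field_equivariant:
  assumes c: "c \<in> idx" and q: "q = p + 1"
  shows "quad_field c \<in> equivariant_fields t l m"
  unfolding equivariant_fields_def mem_Collect_eq
proof (intro conjI ballI quad_field_fields c)
  fix S assume S: "S \<in> V"
  then obtain M where M: "vanishes_from (Suc M) S" using symbols_bounded by blast
  have "Lop p q l m (quad_field c) (Qaff p q (qsym t M S)) = Qaff p q (qsym t M (quad_op c S))"
    unfolding Lop_quad_field[OF c V_qsym[OF S] q] qsym_quad_op[OF S M c q] ..
  then show "Lop p q l m (quad_field c) (Qmap p q t S) = Qmap p q t (Lsym p q (m - l) (quad_field c) S)"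
    unfolding Lsym_quad_field[OF c S q]
    using S c M by (simp add: Qmap_eq[of _ M] vanishes_from_quad_op)
  show "Lsym p q (m - l) (quad_field c) S \<in> V"
    unfolding Lsym_quad_field[OF c S q] using S c by simp
qed

text \<open>The equality concerns functions of all natural indices, not just those of coordinates.
  The constant and linear parts agree outside the range because \<open>v\<close> and the rows of
  \<open>A\<close> vanish there, the quadratic part because \<open>quad_field\<close> is not cut
  off.\<close>

lemma proj_field_eq:
  assumes "\<forall>i. i \<notin> idx \<longrightarrow> v i = 0 \<and> A i = 0"
  shows "proj_field p q (v, A, \<xi>) = (\<Sum>i\<in>idx. (- v i) *\<^sub>R const_field i)
    + (\<Sum>i\<in>idx. \<Sum>j\<in>idx. (- ((-1) ^ (par' j * (par' i + par' j)) * A i j)) *\<^sub>R lin_field j i)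
    + (\<Sum>j\<in>idx. (\<xi> j * \<epsilon> j) *\<^sub>R quad_field j)" (is "_ = ?R")
proof
  fix k
  have 1: "(\<Sum>i\<in>idx. (- v i) *\<^sub>R const_field i) k = - (v k *\<^sub>R sone)"
  proof -
    have "(\<Sum>i\<in>idx. (- v i) *\<^sub>R const_field i) k = (\<Sum>i\<in>idx. if k = i then - (v k *\<^sub>R sone) else 0)"
      unfolding sum_fun_apply[of _ _ k] by (intro sum.cong refl) (auto simp: const_field_def fun_apply)
    then show ?thesis using assms by auto
  qed
  have 2: "(\<Sum>i\<in>idx. \<Sum>j\<in>idx. (- ((-1) ^ (par' j * (par' i + par' j)) * A i j)) *\<^sub>R lin_field j i) k =
      - (\<Sum>j\<in>idx. ((-1) ^ (par' j * (par' k + par' j)) * A k j) *\<^sub>R coord p j)"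
  proof -
    have "(\<Sum>i\<in>idx. \<Sum>j\<in>idx. (- ((-1) ^ (par' j * (par' i + par' j)) * A i j)) *\<^sub>R lin_field j i) k =
      (\<Sum>i\<in>idx. if k = i then - (\<Sum>j\<in>idx. ((-1) ^ (par' j * (par' k + par' j)) * A k j) *\<^sub>R coord p j) else 0)"
      unfolding sum_fun_apply[of _ _ k]
      by (intro sum.cong refl) (auto simp: lin_field_def fun_apply sum_negf)
    then show ?thesis using assms by (auto simp: fun_apply)
  qed
  have 3: "(\<Sum>j\<in>idx. (\<xi> j * \<epsilon> j) *\<^sub>R quad_field j) k = (\<Sum>j\<in>idx. (\<xi> j * \<epsilon> j) *\<^sub>R (coord p j \<odot> coord p k))"
    unfolding sum_fun_apply[of _ _ k] by (simp add: quad_field_def scaleR_fun_apply)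
  show "proj_field p q (v, A, \<xi>) k = ?R k"
    unfolding plus_fun_apply[of _ _ k] 1 2 3 by (simp add: proj_field_def)
qed

lemma proj_field_equivariant:
  assumes "h \<in> psl p q" "q = p + 1"
  shows "proj_field p q h \<in> equivariant_fields t l m"
proof -
  obtain v A \<xi> where h: "h = (v, A, \<xi>)" by (metis prod_cases3)
  have "\<forall>i. i \<notin> idx \<longrightarrow> v i = 0 \<and> A i = 0"
    using assms(1) by (auto simp: h psl_def pgl_coords_def fun_eq_iff fun_apply)
  from proj_field_eq[OF this] show ?thesis
    unfolding h
    by (simp only:) (intro equivariant_fields_add equivariant_fields_sum equivariant_fields_scaleR
        const_field_equivariant lin_field_equivariant quad_field_equivariant assms(2))
qed

end

theorem theorem5p2p2:
  fixes p q :: nat and lam mu t :: real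
  assumes "q = p + 1"
  shows "quantization p q (Qmap p q t) \<and> equivariant p q lam mu (psl p q) (Qmap p q t)"
  using superspace.Qmap_quantization superspace.proj_field_equivariant[OF _ assms, of _ t lam mu]
  by (auto simp: equivariant_def superspace.equivariant_fields_def)

end
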